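(* Let $\Pi=[c_1,c_2,\dots,c_n,c_1]$ ($n\ge 3$) be a positively oriented Jordan polygon with distinct vertices $c_1,\dots,c_n\in\mathbb{C}$, bounding the domain $D$. Then there exist real numbers $0=t_0<t_1<\dots<t_n=2\pi$ such that the Poisson integral $f$ of the step function $$f(e^{it})=c_k\quad (t_{k-1}<t<t_k),\qquad k=1,\dots,n,$$ is a univalent harmonic mapping of the unit disk $U=\{|z|<1\}$ onto $D$.
   Context: A Jordan polygon is a closed polygonal path that is a simple closed curve; "positively oriented" means $D$ lies to the left as the vertices are traversed in the order $c_1,c_2,\dots,c_n,c_1$. The Poisson integral of a bounded function on $\partial U$ is its harmonic extension to $U$. *)

theory Defs
  imports "HOL-Analysis.Analysis"
begin

fun polypath :: "complex list \<Rightarrow> real \<Rightarrow> complex" where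
  "polypath [] = linepath 0 0"
| "polypath [a] = linepath a a"
| "polypath [a, b] = linepath a b"
| "polypath (a # b # c # cs) = linepath a b +++ polypath (b # c # cs)"

definition closed_polygon :: "complex list \<Rightarrow> real \<Rightarrow> complex" where
  "closed_polygon cs = polypath (cs @ [hd cs])"

definition lies_left_of_polygon :: "complex set \<Rightarrow> complex list \<Rightarrow> bool" where
  "lies_left_of_polygon D cs \<longleftrightarrow>
     (\<forall>k < length cs. \<forall>s \<in> {0<..<1::real}.
        let a = cs ! k; b = cs ! (Suc k mod length cs); p = (1 - s) *\<^sub>R a + s *\<^sub>R b in
        (\<forall>\<^sub>F e in at_right (0::real). p + of_real e * \<i> * (b - a) \<in> D))"

definition step_fun :: "(nat \<Rightarrow> real) \<Rightarrow> complex list \<Rightarrow> real \<Rightarrow> complex" where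
  "step_fun t cs \<theta> = (\<Sum>k<length cs. if t k < \<theta> \<and> \<theta> < t (Suc k) then cs ! k else 0)"

definition poisson_kernel :: "complex \<Rightarrow> real \<Rightarrow> real" where
  "poisson_kernel z \<theta> = (1 - (cmod z)\<^sup>2) / (cmod (cis \<theta> - z))\<^sup>2"

definition poisson_integral :: "(real \<Rightarrow> complex) \<Rightarrow> complex \<Rightarrow> complex" where
  "poisson_integral g z =
     of_real (1 / (2 * pi)) * integral {0..2*pi} (\<lambda>\<theta>. of_real (poisson_kernel z \<theta>) * g \<theta>)"

definition harmonic_real_on :: "complex set \<Rightarrow> (complex \<Rightarrow> real) \<Rightarrow> bool" where
  "harmonic_real_on S u \<longleftrightarrow> open S \<and>
    (\<exists>ux uy uxx uxy uyx uyy.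
       (\<forall>z\<in>S.
          ((\<lambda>s. u (z + of_real s)) has_real_derivative ux z) (at 0) \<and>
          ((\<lambda>s. u (z + \<i> * of_real s)) has_real_derivative uy z) (at 0) \<and>
          ((\<lambda>s. ux (z + of_real s)) has_real_derivative uxx z) (at 0) \<and>
          ((\<lambda>s. ux (z + \<i> * of_real s)) has_real_derivative uxy z) (at 0) \<and>
          ((\<lambda>s. uy (z + of_real s)) has_real_derivative uyx z) (at 0) \<and>
          ((\<lambda>s. uy (z + \<i> * of_real s)) has_real_derivative uyy z) (at 0) \<and>
          uxx z + uyy z = 0) \<and>
       continuous_on S u \<and> continuous_on S ux \<and> continuous_on S uy \<and>
       continuous_on S uxx \<and> continuous_on S uxy \<and> continuous_on S uyx \<and>
       continuous_on S uyy)"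

definition harmonic_on :: "complex set \<Rightarrow> (complex \<Rightarrow> complex) \<Rightarrow> bool" where
  "harmonic_on S f \<longleftrightarrow> harmonic_real_on S (\<lambda>z. Re (f z)) \<and> harmonic_real_on S (\<lambda>z. Im (f z))"

end

theory Submission
  imports Defs "HOL-Complex_Analysis.Complex_Analysis"
begin

text \<open>
  Write \<open>d\<close> for the jump of the step function at the point \<open>\<zeta>\<close> of the unit circle. The Poisson
  integral has the form \<open>h + cnj g\<close>, where up to a constant factor \<open>h'\<close> and \<open>g'\<close> are
  \<open>\<Sum> d / (z - \<zeta>)\<close> and \<open>\<Sum> cnj d / (z - \<zeta>)\<close>. These have the same modulus on the circle, so as soon as
  the numerator of \<open>h'\<close> has no zero in the closed disk, the maximum principle gives \<open>\<bar>g'\<bar> < \<bar>h'\<bar>\<close> and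
  the map is a local homeomorphism. Its cluster values at the circle lie on the polygon, hence it is
  proper over the inside of the polygon, and since the inside is simply connected it is a homeomorphism
  onto it.

  The absence of zeros is propagated by ear clipping (Bshouty, Lundberg and Weitsman). If a vertex is
  inserted so that it forms a positively oriented triangle with its two neighbours, and is given a
  sufficiently short arc, then the numerator acquires one new zero, close to the new arc and outside the
  closed disk. A simple polygon is built up from a single edge by such insertions because it
  has a triangulation; the intermediate polygons need not be simple.
\<close>

section \<open>Proper local homeomorphisms\<close>

text \<open>The obstacle is that the domain need not be convex: univalence cannot in general be had
  for every choice of the angles \<open>t\<close>, so the angles have to be constructed.
  Zero-freeness, rather than univalence, is followed through the insertions because it involves only
  the list of jumps: whether an insertion preserves it is decided by the quotient
  \<open>d1 / (d1 + d2)\<close> of the two new jumps, and the sign of its imaginary part is the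
  orientation of the inserted triangle. Simplicity of the curve serves to orient and triangulate the
  final polygon and to identify the image. The starting two-gon is degenerate: its numerator is a
  nonzero constant, but its map collapses the disk to a segment and both derivatives have equal
  modulus. Strictness of the final inequality therefore has a separate source, namely that the jumps
  of the final polygon are not all parallel.\<close>

lemma finite_separation:
  fixes F :: "'a::metric_space set"
  assumes "finite F"
  obtains d where "d > 0" "\<And>x y. x \<in> F \<Longrightarrow> y \<in> F \<Longrightarrow> x \<noteq> y \<Longrightarrow> d \<le> dist x y"
proof -
  let ?E = "insert 1 {dist x y |x y. x \<in> F \<and> y \<in> F \<and> x \<noteq> y}"
  have "{dist x y |x y. x \<in> F \<and> y \<in> F \<and> x \<noteq> y} \<subseteq> (\<lambda>(x, y). dist x y) ` (F \<times> F)"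
    by auto
  then have fin: "finite ?E"
    using assms by (meson finite.insertI finite_SigmaI finite_imageI finite_subset)
  show ?thesis
  proof
    show "Min ?E > 0"
      using fin by (subst Min_gr_iff) auto
  next
    fix x y assume "x \<in> F" "y \<in> F" "x \<noteq> y"
    then show "Min ?E \<le> dist x y"
      using fin by (intro Min_le) auto
  qed
qed

text \<open>A fibre is compact by properness and discrete by local injectivity, hence finite, and
  its points get pairwise disjoint sheets \<open>W x\<close>. What remains of the preimage of a
  small closed ball, \<open>C\<close>, is compact and misses the fibre; removing the image of
  \<open>C\<close> from the ball leaves a neighbourhood whose whole preimage lies in the
  sheets.\<close>

proposition covering_space_proper_local_homeomorphism:
  fixes f :: "'a::euclidean_space \<Rightarrow> 'b::euclidean_space"
  assumes S: "open S" and T: "open T" and contf: "continuous_on S f" and im: "f ` S = T"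
    and proper: "\<And>K. compact K \<Longrightarrow> K \<subseteq> T \<Longrightarrow> compact (S \<inter> f -` K)"
    and loc: "\<And>x. x \<in> S \<Longrightarrow> \<exists>U V g. open U \<and> x \<in> U \<and> U \<subseteq> S \<and> open V \<and> homeomorphism U V f g"
  shows "covering_space S f T"
proof
  show "continuous_on S f" "f ` S = T" by fact+
  fix y assume y: "y \<in> T"
  define F where "F = S \<inter> f -` {y}"
  have cF: "compact F"
    unfolding F_def using proper[of "{y}"] y by simp
  obtain U V g where UV: "\<And>x. x \<in> S \<Longrightarrow> open (U x) \<and> x \<in> U x \<and> U x \<subseteq> S \<and> open (V x) \<and> homeomorphism (U x) (V x) f (g x)"
    using loc by metis
  have FS: "F \<subseteq> S" unfolding F_def by auto
  have UF: "U x \<inter> F = {x}" if "x \<in> F" for x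
  proof -
    have hm: "homeomorphism (U x) (V x) f (g x)" and xU: "x \<in> U x"
      using UV that FS by blast+
    have "z = x" if "z \<in> U x" "z \<in> F" for z
    proof -
      have "f z = f x" using that \<open>x \<in> F\<close> by (auto simp: F_def)
      then show ?thesis
        using homeomorphism_apply1[OF hm] that(1) xU by metis
    qed
    then show ?thesis using xU that by auto
  qed
  have finF: "finite F"
  proof -
    have "F \<subseteq> (\<Union>x\<in>F. U x)" using UV FS by blast
    then obtain C where C: "C \<subseteq> F" "finite C" "F \<subseteq> (\<Union>x\<in>C. U x)"
      using compactE_image[OF cF, of F U] UV FS by (metis subset_iff)
    have "F \<subseteq> C"
    proof
      fix z assume "z \<in> F"
      then obtain x where "x \<in> C" "z \<in> U x" using C(3) by blast
      then have "z = x" using UF[of x] \<open>z \<in> F\<close> C(1) by blast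
      then show "z \<in> C" using \<open>x \<in> C\<close> by simp
    qed
    then show ?thesis using C finite_subset by blast
  qed
  obtain d where d: "d > 0" "\<And>x z. x \<in> F \<Longrightarrow> z \<in> F \<Longrightarrow> x \<noteq> z \<Longrightarrow> d \<le> dist x z"
    using finite_separation[OF finF] by blast
  define W where "W = (\<lambda>x. U x \<inter> ball x (d/2))"
  have W: "open (W x)" "x \<in> W x" "W x \<subseteq> U x" "W x \<subseteq> S" if "x \<in> F" for x
    using that UV FS d(1) unfolding W_def by auto
  have disjW: "W x \<inter> W z = {}" if "x \<in> F" "z \<in> F" "x \<noteq> z" for x z
  proof -
    have "d \<le> dist x z" using d(2) that by blast
    then have "ball x (d/2) \<inter> ball z (d/2) = {}"
      by (intro disjoint_ballI) simp
    then show ?thesis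
      unfolding W_def by blast
  qed
  have openfW: "open (f ` W x)" if "x \<in> F" for x
  proof -
    have hm: "homeomorphism (U x) (V x) f (g x)" "open (V x)" using UV that FS by auto
    have "openin (top_of_set (V x)) (f ` W x)"
      by (intro homeomorphism_imp_open_map[OF hm(1)] open_subset W that)
    then show ?thesis using hm(2) openin_open_trans by blast
  qed
  obtain r where r: "r > 0" "cball y r \<subseteq> T" using T y open_contains_cball by blast
  define C where "C = (S \<inter> f -` cball y r) - (\<Union>x\<in>F. W x)"
  have "compact C" unfolding C_def
    using W by (intro compact_diff proper r open_UN) auto
  moreover have CS: "C \<subseteq> S" unfolding C_def by auto
  ultimately have cC: "compact (f ` C)"
    using compact_continuous_image contf continuous_on_subset by blast
  have yC: "y \<notin> f ` C"
  proof
    assume "y \<in> f ` C"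
    then obtain x where "x \<in> C" "f x = y" by auto
    then have "x \<in> F" using CS by (auto simp: F_def)
    then show False using \<open>x \<in> C\<close> W(2) by (auto simp: C_def)
  qed
  define N where "N = (ball y r \<inter> (\<Inter>x\<in>F. f ` W x)) - f ` C"
  have oN: "open N"
    unfolding N_def using finF openfW cC by (intro open_Diff open_Int open_INT ballI compact_imp_closed) auto
  have yN: "y \<in> N"
    unfolding N_def using r yC W(2) by (force simp: F_def)
  have NT: "N \<subseteq> T" unfolding N_def using r ball_subset_cball by blast
  have cover: "S \<inter> f -` N = (\<Union>x\<in>F. W x \<inter> f -` N)"
  proof
    show "S \<inter> f -` N \<subseteq> (\<Union>x\<in>F. W x \<inter> f -` N)"
    proof
      fix z assume z: "z \<in> S \<inter> f -` N"
      then have "z \<notin> C" "f z \<in> cball y r" by (auto simp: N_def)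
      then have "z \<in> (\<Union>x\<in>F. W x)" using z by (auto simp: C_def)
      then show "z \<in> (\<Union>x\<in>F. W x \<inter> f -` N)" using z by auto
    qed
    show "(\<Union>x\<in>F. W x \<inter> f -` N) \<subseteq> S \<inter> f -` N" using W(4) by blast
  qed
  show "\<exists>T'. y \<in> T' \<and> openin (top_of_set T) T' \<and>
        (\<exists>v. \<Union>v = S \<inter> f -` T' \<and> (\<forall>u\<in>v. openin (top_of_set S) u) \<and> pairwise disjnt v \<and>
             (\<forall>u\<in>v. \<exists>q. homeomorphism u T' f q))"
  proof (intro exI conjI)
    show "y \<in> N" by fact
    show "openin (top_of_set T) N" using oN NT T by (simp add: openin_open_eq)
    let ?v = "(\<lambda>x. W x \<inter> f -` N) ` F"
    show "\<Union>?v = S \<inter> f -` N" using cover by simp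
    show "\<forall>u\<in>?v. openin (top_of_set S) u"
    proof
      fix u assume "u \<in> ?v"
      then obtain x where x: "x \<in> F" "u = W x \<inter> f -` N" by auto
      have "open (W x \<inter> f -` N)"
        using W x oN by (intro continuous_open_preimage continuous_on_subset[OF contf]) auto
      then show "openin (top_of_set S) u" using x W(4) S by (auto simp: openin_open_eq)
    qed
    show "pairwise disjnt ?v"
    proof (rule pairwiseI)
      fix u u' assume "u \<in> ?v" "u' \<in> ?v" "u \<noteq> u'"
      then obtain x x' where "x \<in> F" "u = W x \<inter> f -` N" "x' \<in> F" "u' = W x' \<inter> f -` N" "x \<noteq> x'"
        by blast
      then show "disjnt u u'"
        using disjW[of x x'] by (auto simp: disjnt_def)
    qed
    show "\<forall>u\<in>?v. \<exists>q. homeomorphism u N f q"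
    proof
      fix u assume "u \<in> ?v"
      then obtain x where x: "x \<in> F" "u = W x \<inter> f -` N" by auto
      have "homeomorphism (U x) (V x) f (g x)" using UV x FS by auto
      moreover have "u \<subseteq> U x" using x W(3) by auto
      moreover have "N \<subseteq> f ` W x" using x by (auto simp: N_def)
      then have "f ` u = N"
        unfolding x(2) by blast
      ultimately have "homeomorphism u N f (g x)"
        using homeomorphism_of_subsets[of "U x" "V x" f "g x" u] by (metis homeomorphism_image1 image_mono)
      then show "\<exists>q. homeomorphism u N f q" by blast
    qed
  qed
qed

text \<open>The identity of \<open>S\<close> lifts to a section \<open>g\<close> through
  \<open>x\<close>. Then \<open>g \<circ> p\<close> and \<open>id\<close> are two lifts of
  \<open>p\<close> that agree at \<open>x\<close>, so they agree on the connected \<open>C\<close>,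
  and \<open>y = g (p y) = g (p x) = x\<close>.\<close>

lemma inj_on_covering_space_simply_connected:
  fixes p :: "'a::real_normed_vector \<Rightarrow> 'b::real_normed_vector"
  assumes cov: "covering_space C p S" and C: "connected C"
    and S: "simply_connected S" "locally path_connected S"
  shows "inj_on p C"
proof
  fix x y assume xy: "x \<in> C" "y \<in> C" "p x = p y"
  have pC: "p \<in> C \<rightarrow> S" and cp: "continuous_on C p"
    using cov covering_space_imp_surjective covering_space_imp_continuous by blast+
  obtain g where g: "continuous_on S g" "g \<in> S \<rightarrow> C" "g (p x) = x" "\<And>y. y \<in> S \<Longrightarrow> p (g y) = y"
    using covering_space_lift_strong[OF cov xy(1) _ S, of "p x" "\<lambda>x. x"] pC xy(1) by (auto simp: continuous_on_id)
  have "(g \<circ> p) y = id y"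
  proof (rule covering_space_lift_unique[OF cov, of "g \<circ> p" x id C p y])
    show "continuous_on C (g \<circ> p)"
      by (metis continuous_on_compose cp cov covering_space_imp_surjective g(1))
  qed (use g pC cp xy C in \<open>auto simp: Pi_iff\<close>)
  then show "x = y" unfolding comp_apply id_apply using xy(3) g(3) by metis
qed

text \<open>In the plane it suffices that the complement is connected, and the complement of the
  inside is the closure of the connected outside.\<close>

lemma simply_connected_inside_simple_path:
  fixes c :: "real \<Rightarrow> complex"
  assumes "simple_path c" "pathfinish c = pathstart c"
  shows "simply_connected (inside (path_image c))"
proof -
  have J: "open (inside (path_image c))" "connected (inside (path_image c))" "bounded (inside (path_image c))"
    "open (outside (path_image c))" "connected (outside (path_image c))" "\<not> bounded (outside (path_image c))"
    "frontier (outside (path_image c)) = path_image c"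
    using Jordan_inside_outside[OF assms] by auto
  have eq: "- inside (path_image c) = closure (outside (path_image c))"
    using J(4,7) inside_Un_outside[of "path_image c"] inside_Int_outside[of "path_image c"]
      inside_no_overlap[of "path_image c"] closure_Un_frontier[of "outside (path_image c)"]
    by blast
  have "connected (- inside (path_image c))" unfolding eq using J(5) connected_imp_connected_closure by blast
  then show ?thesis
    using simply_connected_iff_simple J by blast
qed

text \<open>By \<open>bdry\<close>, all cluster values at the boundary of \<open>S\<close> lie on
  the curve. Off the curve the open image is therefore also relatively closed, so it contains or
  misses each component of the complement; boundedness rules out the outside. The same hypothesis
  makes \<open>f\<close> proper over the inside, and injectivity follows from the covering
  property.\<close>

proposition local_homeomorphism_onto_inside:
  fixes f :: "complex \<Rightarrow> complex" and c :: "real \<Rightarrow> complex"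
  assumes c: "simple_path c" "pathfinish c = pathstart c"
    and S: "open S" "connected S" "bounded S" "S \<noteq> {}"
    and contf: "continuous_on S f" and bf: "bounded (f ` S)"
    and loc: "\<And>x. x \<in> S \<Longrightarrow> \<exists>U V g. open U \<and> x \<in> U \<and> U \<subseteq> S \<and> open V \<and> homeomorphism U V f g"
    and bdry: "\<And>X x y. \<lbrakk>\<And>n. X n \<in> S; X \<longlonglongrightarrow> x; x \<notin> S; (\<lambda>n. f (X n)) \<longlonglongrightarrow> y\<rbrakk> \<Longrightarrow> y \<in> path_image c"
  shows "inj_on f S \<and> f ` S = inside (path_image c)"
proof -
  let ?I = "inside (path_image c)" and ?O = "outside (path_image c)"
  have J: "open ?I" "connected ?I" "?I \<noteq> {}" "open ?O" "connected ?O" "\<not> bounded ?O" "frontier ?O = path_image c"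
    using Jordan_inside_outside[OF c] by auto
  have limpt: "\<exists>x\<in>S. f x = y" if y: "y \<notin> path_image c" and X: "\<And>n. X n \<in> S" "(\<lambda>n. f (X n)) \<longlonglongrightarrow> y" for X y
  proof -
    have "compact (closure S)" using S(3) compact_closure by blast
    moreover have "\<forall>n. X n \<in> closure S" using X(1) closure_subset by blast
    ultimately obtain x r where xr: "strict_mono (r :: nat \<Rightarrow> nat)" "(X \<circ> r) \<longlonglongrightarrow> x"
      unfolding compact_def by metis
    have fl: "(\<lambda>n. f ((X \<circ> r) n)) \<longlonglongrightarrow> y"
      using LIMSEQ_subseq_LIMSEQ[OF X(2) xr(1)] by (simp add: o_def)
    have xS: "x \<in> S"
      using bdry[of "X \<circ> r" x y] X(1) xr(2) fl y by auto
    then have "isCont f x"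
      using contf S(1) continuous_on_eq_continuous_at by blast
    then have "(\<lambda>n. f ((X \<circ> r) n)) \<longlonglongrightarrow> f x"
      using xr(2) by (rule isCont_tendsto_compose)
    then have "f x = y" using fl LIMSEQ_unique by blast
    then show ?thesis using xS by blast
  qed
  have opf: "open (f ` S)"
  proof (subst open_subopen, intro ballI)
    fix y assume "y \<in> f ` S"
    then obtain x where x: "x \<in> S" "y = f x" by auto
    obtain U V g where UV: "open U" "x \<in> U" "U \<subseteq> S" "open V" "homeomorphism U V f g"
      using loc[OF x(1)] by blast
    have "f ` U = V" using UV(5) homeomorphism_image1 by blast
    then have "V \<subseteq> f ` S" "y \<in> V" using UV x by auto
    then show "\<exists>T. open T \<and> y \<in> T \<and> T \<subseteq> f ` S" using UV(4) by blast
  qed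
  have dich: "\<Omega> \<inter> f ` S = {} \<or> \<Omega> \<subseteq> f ` S" if \<Omega>: "connected \<Omega>" "\<Omega> \<inter> path_image c = {}" for \<Omega>
  proof -
    have "closedin (top_of_set \<Omega>) (\<Omega> \<inter> f ` S)"
    proof (subst closedin_limpt, intro conjI allI impI)
      fix y assume "y islimpt \<Omega> \<inter> f ` S \<and> y \<in> \<Omega>"
      then have y: "y islimpt \<Omega> \<inter> f ` S" "y \<in> \<Omega>" by auto
      then obtain Y where Y: "\<And>n. Y n \<in> f ` S" "Y \<longlonglongrightarrow> y"
        unfolding islimpt_sequential by blast
      then obtain X where X: "\<And>n. X n \<in> S" "\<And>n. Y n = f (X n)" unfolding image_iff by metis
      then have "Y = (\<lambda>n. f (X n))" by presburger
      then have "\<exists>x\<in>S. f x = y"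
        using limpt[of y X] y(2) \<Omega>(2) X(1) Y(2) by blast
      then show "y \<in> \<Omega> \<inter> f ` S" using y(2) by blast
    qed auto
    moreover have "openin (top_of_set \<Omega>) (\<Omega> \<inter> f ` S)" using opf by (simp add: openin_open_Int)
    ultimately show ?thesis using \<Omega>(1) connected_clopen by blast
  qed
  have "\<not> ?O \<subseteq> f ` S" using J(6) bf bounded_subset by blast
  then have fO: "?O \<inter> f ` S = {}" using dich[OF J(5)] outside_no_overlap by blast
  \<comment> \<open>Every point of the curve is in the closure of the outside, so an open set
    meeting the curve would meet the outside as well.\<close>
  have fc: "f ` S \<inter> path_image c = {}"
  proof (rule ccontr)
    assume "f ` S \<inter> path_image c \<noteq> {}"
    then obtain y where "y \<in> f ` S" "y \<in> closure ?O" using J(7) by (auto simp: frontier_def)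
    then show False using opf fO open_Int_closure_eq_empty[of "f ` S" ?O] by blast
  qed
  have fI: "f ` S \<subseteq> ?I"
    using fO fc inside_Un_outside[of "path_image c"] by blast
  then have im: "f ` S = ?I"
    using dich[OF J(2)] S(4) inside_no_overlap by blast
  have "covering_space S f ?I"
  proof (rule covering_space_proper_local_homeomorphism[OF S(1) J(1) contf im _ loc])
    fix K assume K: "compact K" "K \<subseteq> ?I"
    have "closed (S \<inter> f -` K)"
      unfolding closed_sequential_limits
    proof (intro allI impI)
      fix X x assume "(\<forall>n. X n \<in> S \<inter> f -` K) \<and> X \<longlonglongrightarrow> x"
      then have X: "\<And>n. X n \<in> S" "\<And>n. f (X n) \<in> K" "X \<longlonglongrightarrow> x" by auto
      obtain y r where yr: "y \<in> K" "strict_mono (r :: nat \<Rightarrow> nat)" "((\<lambda>n. f (X n)) \<circ> r) \<longlonglongrightarrow> y"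
        using K(1) X(2) unfolding compact_def by (metis (no_types, lifting))
      have yn: "y \<notin> path_image c" using yr(1) K(2) inside_no_overlap by blast
      have xS: "x \<in> S"
        using bdry[of "X \<circ> r" x y] X(1) LIMSEQ_subseq_LIMSEQ[OF X(3) yr(2)] yr(3) yn
        by (auto simp: o_def)
      then have "isCont f x"
        using contf S(1) continuous_on_eq_continuous_at by blast
      then have "(\<lambda>n. f (X n)) \<longlonglongrightarrow> f x"
        using X(3) by (rule isCont_tendsto_compose)
      then have "f x = y"
        using LIMSEQ_subseq_LIMSEQ[OF _ yr(2)] yr(3) LIMSEQ_unique by blast
      then show "x \<in> S \<inter> f -` K" using xS yr(1) by simp
    qed
    moreover have "bounded (S \<inter> f -` K)" using S(3) bounded_subset by blast
    ultimately show "compact (S \<inter> f -` K)" using compact_eq_bounded_closed by blast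
  qed
  then have "inj_on f S"
    using inj_on_covering_space_simply_connected S(2) simply_connected_inside_simple_path[OF c]
      open_imp_locally_path_connected[OF J(1)] by blast
  then show ?thesis using im by blast
qed

section \<open>Splitting a jump of the step function\<close>

fun node_poly :: "(complex \<times> complex) list \<Rightarrow> complex \<Rightarrow> complex" where
  "node_poly [] z = 1"
| "node_poly ((\<zeta>, d) # js) z = (z - \<zeta>) * node_poly js z"

text \<open>For nodes \<open>\<zeta>\<close> with weights \<open>d\<close>, this is the numerator of
  the sum of the fractions \<open>d / (z - \<zeta>)\<close> over the common denominator
  \<open>node_poly\<close>. Unlike the sum, it still makes sense at the nodes, which lie on the
  circle, where zero-freeness is also required.\<close>

fun res_poly :: "(complex \<times> complex) list \<Rightarrow> complex \<Rightarrow> complex" where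
  "res_poly [] z = 0"
| "res_poly ((\<zeta>, d) # js) z = d * node_poly js z + (z - \<zeta>) * res_poly js z"

lemma node_poly_append: "node_poly (xs @ ys) z = node_poly xs z * node_poly ys z"
proof (induction xs)
  case (Cons x xs)
  then show ?case by (cases x) simp
qed simp

lemma res_poly_append:
  "res_poly (xs @ ys) z = res_poly xs z * node_poly ys z + node_poly xs z * res_poly ys z"
proof (induction xs)
  case (Cons x xs)
  then show ?case by (cases x) (simp add: node_poly_append algebra_simps)
qed simp

lemma holomorphic_node_poly [holomorphic_intros]: "node_poly js holomorphic_on S"
proof (induction js)
  case (Cons x xs)
  then show ?case by (cases x) (auto intro!: holomorphic_intros)
qed (auto intro!: holomorphic_intros)

lemma holomorphic_res_poly [holomorphic_intros]: "res_poly js holomorphic_on S"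
proof (induction js)
  case (Cons x xs)
  then show ?case by (cases x) (auto intro!: holomorphic_intros)
qed (auto intro!: holomorphic_intros)

lemma isCont_node_poly: "isCont (node_poly js) z"
  using holomorphic_on_imp_continuous_on[OF holomorphic_node_poly[of js UNIV]]
  by (simp add: continuous_on_eq_continuous_at)

lemma isCont_res_poly: "isCont (res_poly js) z"
  using holomorphic_on_imp_continuous_on[OF holomorphic_res_poly[of js UNIV]]
  by (simp add: continuous_on_eq_continuous_at)

lemma res_poly_at_node: "res_poly (xs @ (\<zeta>, d) # ys) \<zeta> = d * node_poly (xs @ ys) \<zeta>"
  by (simp add: res_poly_append node_poly_append)

lemma node_poly_eq_0_iff: "node_poly js z = 0 \<longleftrightarrow> z \<in> fst ` set js"
proof (induction js)
  case (Cons x xs)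
  then show ?case by (cases x) auto
qed simp

lemma Re_nonpos_if_norm_one_plus_le: "Re y \<le> 0" if "norm (1 + y) \<le> 1"
  using complex_Re_le_cmod[of "1 + y"] that by simp

text \<open>A zero of the perturbed polynomial in the closed disk has to approach \<open>\<zeta>\<close>, and after
  rescaling the gap \<open>\<zeta> * cis \<epsilon> - \<zeta>\<close> to unit length it approaches the position \<open>d1 / (d1 + d2)\<close>,
  which lies on the outer side of the circle.\<close>

proposition res_poly_split_node:
  assumes nz: "\<And>z. norm z \<le> 1 \<Longrightarrow> res_poly (xs @ (\<zeta>, d1 + d2) # ys) z \<noteq> 0"
    and \<zeta>: "norm \<zeta> = 1" and neg: "Im (d1 / (d1 + d2)) < 0"
  shows "\<forall>\<^sub>F \<epsilon> in at_right 0. \<forall>z. norm z \<le> 1 \<longrightarrow>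
           res_poly (xs @ (\<zeta>, d1) # (\<zeta> * cis \<epsilon>, d2) # ys) z \<noteq> 0"
proof (rule sequentially_imp_eventually_at_right[of 0 1])
  define Q where "Q = node_poly (xs @ ys)"
  define R where "R = res_poly (xs @ ys)"
  define p where "p = res_poly (xs @ (\<zeta>, d1 + d2) # ys)"
  \<comment> \<open>At a zero of the perturbed polynomial,
    \<open>(z - \<zeta>) * p z = (\<xi> - \<zeta>) * u z\<close>, by \<open>split_eq\<close> below.
    At \<open>\<zeta>\<close> itself the quotient \<open>u / p\<close> equals
    \<open>d1 / (d1 + d2)\<close>, the predicted position of the zero in units of the gap.\<close>
  define u where "u = (\<lambda>z. Q z * d1 + (z - \<zeta>) * R z)"
  have p_eq: "p z = Q z * (d1 + d2) + (z - \<zeta>) * R z" for z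
    by (simp add: p_def Q_def R_def res_poly_append node_poly_append algebra_simps)
  have split_eq: "res_poly (xs @ (\<zeta>, d1) # (\<xi>, d2) # ys) z = (z - \<zeta>) * p z - (\<xi> - \<zeta>) * u z" for \<xi> z
    by (simp add: p_eq u_def Q_def R_def res_poly_append node_poly_append algebra_simps)
  have cont: "isCont p z" "isCont u z" for z
    unfolding p_def u_def Q_def R_def
    by (intro isCont_res_poly continuous_intros isCont_node_poly)+
  have "p \<zeta> \<noteq> 0" using nz \<zeta> by (simp add: p_def)
  fix e :: "nat \<Rightarrow> real"
  assume e: "\<And>n. 0 < e n" "e \<longlonglongrightarrow> 0"
  show "\<forall>\<^sub>F n in sequentially. \<forall>z. norm z \<le> 1 \<longrightarrow>
           res_poly (xs @ (\<zeta>, d1) # (\<zeta> * cis (e n), d2) # ys) z \<noteq> 0"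
  proof (rule ccontr)
    assume "\<not> ?thesis"
    from not_eventually_sequentiallyD[OF this] obtain r :: "nat \<Rightarrow> nat" where r: "strict_mono r"
      and ex: "\<And>n. \<exists>z. norm z \<le> 1 \<and> res_poly (xs @ (\<zeta>, d1) # (\<zeta> * cis (e (r n)), d2) # ys) z = 0"
      by blast
    from ex obtain Z where Z: "\<And>n. norm (Z n) \<le> 1"
      "\<And>n. res_poly (xs @ (\<zeta>, d1) # (\<zeta> * cis (e (r n)), d2) # ys) (Z n) = 0"
      by metis
    have "\<forall>n. Z n \<in> cball 0 1" using Z(1) by simp
    then obtain z s where z: "z \<in> cball 0 1" "strict_mono (s::nat\<Rightarrow>nat)" "(Z \<circ> s) \<longlonglongrightarrow> z"
      using compact_cball[of "0::complex" 1] unfolding compact_def by metis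
    define \<epsilon> where "\<epsilon> = (\<lambda>n. e (r (s n)))"
    define Y where "Y = (\<lambda>n. Z (s n))"
    have \<epsilon>: "\<epsilon> \<longlonglongrightarrow> 0" "\<And>n. \<epsilon> n > 0"
      using LIMSEQ_subseq_LIMSEQ[OF LIMSEQ_subseq_LIMSEQ[OF e(2) r] z(2)] e(1)
      by (auto simp: \<epsilon>_def o_def)
    have Yz: "Y \<longlonglongrightarrow> z" using z(3) by (simp add: Y_def o_def)
    have Yn: "norm (Y n) \<le> 1" for n using Z(1) by (simp add: Y_def)
    have eq: "(Y n - \<zeta>) * p (Y n) = (\<zeta> * cis (\<epsilon> n) - \<zeta>) * u (Y n)" for n
      using Z(2)[of "s n"] by (simp add: split_eq \<epsilon>_def Y_def)
    have "(\<lambda>n. (Y n - \<zeta>) * p (Y n)) \<longlonglongrightarrow> (z - \<zeta>) * p z"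
      by (intro tendsto_intros Yz isCont_tendsto_compose[OF cont(1)])
    moreover have "(\<lambda>n. (\<zeta> * cis (\<epsilon> n) - \<zeta>) * u (Y n)) \<longlonglongrightarrow> (\<zeta> * cis 0 - \<zeta>) * u z"
      by (intro tendsto_intros Yz isCont_tendsto_compose[OF cont(2)] \<epsilon>)
    ultimately have "(z - \<zeta>) * p z = (\<zeta> * cis 0 - \<zeta>) * u z"
      unfolding eq by (rule LIMSEQ_unique)
    then have z\<zeta>: "z = \<zeta>" using nz z(1) by (auto simp: p_def)
    \<comment> \<open>The location of the zero \<open>Y n\<close> when the gap is rescaled to unit
      length: \<open>Y n = \<zeta> * (1 + w n * (cis (\<epsilon> n) - 1))\<close>.\<close>
    define w where "w = (\<lambda>n. u (Y n) / p (Y n))"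
    have "w \<longlonglongrightarrow> u z / p z"
      unfolding w_def
      by (intro tendsto_intros Yz isCont_tendsto_compose[OF cont(1)] isCont_tendsto_compose[OF cont(2)])
         (use \<open>p \<zeta> \<noteq> 0\<close> z\<zeta> in auto)
    moreover have "u z / p z = d1 / (d1 + d2)"
      using \<open>p \<zeta> \<noteq> 0\<close> by (simp add: z\<zeta> p_eq u_def)
    ultimately have w: "w \<longlonglongrightarrow> d1 / (d1 + d2)" by simp
    have "filterlim (\<lambda>n. \<i> * of_real (\<epsilon> n)) (at 0) sequentially"
      unfolding filterlim_at
    proof
      show "\<forall>\<^sub>F n in sequentially. \<i> * of_real (\<epsilon> n) \<in> UNIV \<and> \<i> * of_real (\<epsilon> n) \<noteq> 0"
        using \<epsilon>(2) by (auto simp: less_imp_neq[symmetric])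
      show "(\<lambda>n. \<i> * of_real (\<epsilon> n)) \<longlonglongrightarrow> 0"
        using tendsto_mult[OF tendsto_const tendsto_of_real[OF \<epsilon>(1)], of \<i>] by simp
    qed
    from filterlim_compose[OF lim_exp_minus_1 this]
    have "(\<lambda>n. \<i> * ((exp (\<i> * of_real (\<epsilon> n)) - 1) / (\<i> * of_real (\<epsilon> n)))) \<longlonglongrightarrow> \<i> * 1"
      by (intro tendsto_intros)
    then have der: "(\<lambda>n. (cis (\<epsilon> n) - 1) / of_real (\<epsilon> n)) \<longlonglongrightarrow> \<i>"
      by (simp add: cis_conv_exp)
    \<comment> \<open>First-order test for leaving the disk: a zero in the disk forces
      \<open>Re (w n * (cis (\<epsilon> n) - 1)) \<le> 0\<close>. Divided by
      \<open>\<epsilon> n\<close>, the left side tends to \<open>Re (q * \<i>) = - Im q\<close> with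
      \<open>q = d1 / (d1 + d2)\<close>, which is positive by \<open>neg\<close>.\<close>
    have lim: "(\<lambda>n. Re (w n * ((cis (\<epsilon> n) - 1) / of_real (\<epsilon> n)))) \<longlonglongrightarrow> Re (d1 / (d1 + d2) * \<i>)"
      by (intro tendsto_intros w der)
    have "Re (w n * ((cis (\<epsilon> n) - 1) / of_real (\<epsilon> n))) \<le> 0" for n
    proof -
      have pn: "p (Y n) \<noteq> 0" using nz Yn by (simp add: p_def)
      have \<zeta>0: "\<zeta> \<noteq> 0" using \<zeta> by auto
      have "Y n = \<zeta> * (1 + w n * (cis (\<epsilon> n) - 1))"
        using eq[of n] pn by (simp add: w_def field_simps)
      then have "norm (1 + w n * (cis (\<epsilon> n) - 1)) \<le> 1"
        using Yn[of n] \<zeta> by (simp add: norm_mult)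
      then have "Re (w n * (cis (\<epsilon> n) - 1)) \<le> 0"
        by (rule Re_nonpos_if_norm_one_plus_le)
      then have "Re ((w n * (cis (\<epsilon> n) - 1)) / of_real (\<epsilon> n)) \<le> 0"
        unfolding Re_divide_of_real using \<epsilon>(2)[of n] by (simp add: divide_nonpos_pos)
      then show ?thesis by (simp only: times_divide_eq_right)
    qed
    then have "Re (d1 / (d1 + d2) * \<i>) \<le> 0"
      using lim by (intro LIMSEQ_le_const2[OF lim]) auto
    moreover have "Re (q * \<i>) = - Im q" for q by simp
    ultimately show False using neg by (metis neg_le_0_iff_le not_le)
  qed
qed auto

section \<open>Ear fillings and admissible angles\<close>

text \<open>\<open>Im ((y - a) / (b - a)) < 0\<close> says that the triangle \<open>a, y, b\<close> is positively oriented; it fails for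
  \<open>a = b\<close>, as the quotient is then \<open>0\<close>.\<close>

inductive ear_fill :: "complex \<Rightarrow> complex list \<Rightarrow> complex \<Rightarrow> bool" where
  ear_fill_Nil: "ear_fill a [] b"
| ear_fill_insert: "\<lbrakk>Im ((y - a) / (b - a)) < 0; ear_fill a xs y; ear_fill y ys b\<rbrakk>
    \<Longrightarrow> ear_fill a (xs @ y # ys) b"

text \<open>The vertex list is meant to be closed up (first vertex repeated at the end); the value \<open>cs ! k\<close> is
  taken on the arc that ends at \<open>ts ! k\<close>.\<close>

fun jumps :: "complex list \<Rightarrow> real list \<Rightarrow> (complex \<times> complex) list" where
  "jumps (a # b # cs) (t # ts) = (cis t, a - b) # jumps (b # cs) ts"
| "jumps _ _ = []"

lemma jumps_append:
  "length ts = length xs \<Longrightarrow> jumps (xs @ a # ys) (ts @ us) = jumps (xs @ [a]) ts @ jumps (a # ys) us"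
proof (induction xs arbitrary: ts)
  case (Cons x xs)
  then obtain t ts' where "ts = t # ts'" by (cases ts) auto
  with Cons show ?case by (cases xs) auto
qed simp

text \<open>The list \<open>ts\<close> holds the ends of the arcs, and the start angle 0 is only
  implicit in \<open>0 # ts\<close>; hence the closed-up vertex list is one longer. The final angle
  is left free here and followed through the insertions as \<open>last ts\<close>.\<close>

definition admissible :: "complex list \<Rightarrow> real list \<Rightarrow> bool" where
  "admissible cs ts \<longleftrightarrow> length cs = Suc (length ts) \<and> sorted_wrt (<) (0 # ts) \<and>
     (\<forall>z. norm z \<le> 1 \<longrightarrow> res_poly (jumps cs ts) z \<noteq> 0)"

text \<open>The jump \<open>a - b\<close> at angle \<open>t\<close> is split into
  \<open>a - v\<close>, left at \<open>t\<close>, and \<open>v - b\<close>, placed at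
  \<open>t + \<epsilon>\<close>, so \<open>v\<close> takes over the beginning of the arc of
  \<open>b\<close>. By \<open>ys \<noteq> []\<close> there is an angle \<open>t'\<close> at which
  that arc ends; this leaves room for \<open>\<epsilon>\<close> and keeps the last angle
  fixed.\<close>

lemma admissible_insert:
  assumes adm: "admissible (xs @ a # b # ys) ts" and "ys \<noteq> []" and neg: "Im ((v - a) / (b - a)) < 0"
  shows "\<exists>ts'. admissible (xs @ a # v # b # ys) ts' \<and> last ts' = last ts"
proof -
  define T1 where "T1 = take (length xs) ts"
  obtain t T2 where ts: "ts = T1 @ t # T2" and len: "length T1 = length xs" "length T2 = length ys"
  proof -
    have l: "length ts = Suc (length xs + length ys)" using adm by (simp add: admissible_def)
    then have "ts = T1 @ ts ! length xs # drop (Suc (length xs)) ts"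
      unfolding T1_def by (simp add: id_take_nth_drop)
    then show ?thesis using l by (intro that[of "ts ! length xs"]) (auto simp: T1_def)
  qed
  obtain t' T2' where T2: "T2 = t' # T2'" using len \<open>ys \<noteq> []\<close> by (cases T2) auto
  have jumps: "jumps (xs @ a # b # ys) ts = jumps (xs @ [a]) T1 @ (cis t, (a - v) + (v - b)) # jumps (b # ys) T2"
    using len by (simp add: ts jumps_append)
  have "(a - v) / ((a - v) + (v - b)) = (v - a) / (b - a)"
    using minus_divide_divide[of "v - a" "b - a"] by simp
  then have "\<forall>\<^sub>F \<epsilon> in at_right 0. \<forall>z. norm z \<le> 1 \<longrightarrow>
       res_poly (jumps (xs @ [a]) T1 @ (cis t, a - v) # (cis t * cis \<epsilon>, v - b) # jumps (b # ys) T2) z \<noteq> 0"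
    using adm neg by (intro res_poly_split_node) (auto simp: admissible_def jumps)
  moreover have "t < t'" using adm by (simp add: admissible_def ts T2 sorted_wrt_append)
  then have "\<forall>\<^sub>F \<epsilon> in at_right 0. \<epsilon> < t' - t \<and> 0 < \<epsilon>"
    by (intro eventually_conj) (auto simp: eventually_at_right_less intro!: eventually_at_rightI[of 0 "t' - t"])
  ultimately have "\<forall>\<^sub>F \<epsilon> in at_right (0::real). (\<forall>z. norm z \<le> 1 \<longrightarrow>
       res_poly (jumps (xs @ [a]) T1 @ (cis t, a - v) # (cis t * cis \<epsilon>, v - b) # jumps (b # ys) T2) z \<noteq> 0) \<and>
       \<epsilon> < t' - t \<and> 0 < \<epsilon>"
    by (rule eventually_conj)
  then obtain \<epsilon> where \<epsilon>: "\<And>z. norm z \<le> 1 \<Longrightarrow>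
       res_poly (jumps (xs @ [a]) T1 @ (cis t, a - v) # (cis t * cis \<epsilon>, v - b) # jumps (b # ys) T2) z \<noteq> 0"
       "\<epsilon> < t' - t" "0 < \<epsilon>"
    using eventually_happens'[OF trivial_limit_at_right_real] by blast
  have "admissible (xs @ a # v # b # ys) (T1 @ t # (t + \<epsilon>) # T2)"
    unfolding admissible_def
  proof (intro conjI allI impI)
    show "length (xs @ a # v # b # ys) = Suc (length (T1 @ t # (t + \<epsilon>) # T2))" using len by simp
    show "sorted_wrt (<) (0 # T1 @ t # (t + \<epsilon>) # T2)"
      using adm \<epsilon>(2,3) by (auto simp: admissible_def ts T2 sorted_wrt_append)
    show "res_poly (jumps (xs @ a # v # b # ys) (T1 @ t # (t + \<epsilon>) # T2)) z \<noteq> 0" if "norm z \<le> 1" for z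
      using \<epsilon>(1)[OF that] len by (simp add: jumps_append cis_mult)
  qed
  then show ?thesis by (auto simp: ts T2)
qed

text \<open>Each insertion changes the numerator of the whole list, so the filling has to be carried
  out inside arbitrary surroundings \<open>xs\<close> and \<open>ys\<close>. The apex is inserted
  first, which creates the two edges that the two subfillings then refine.\<close>

lemma admissible_fill:
  assumes "ear_fill a L b"
  shows "admissible (xs @ a # b # ys) ts \<Longrightarrow> ys \<noteq> [] \<Longrightarrow>
    \<exists>ts'. admissible (xs @ a # L @ b # ys) ts' \<and> last ts' = last ts"
  using assms
proof (induction arbitrary: xs ys ts rule: ear_fill.induct)
  case (ear_fill_insert y a b L1 L2)
  obtain t1 where t1: "admissible (xs @ a # y # b # ys) t1" "last t1 = last ts"
    using admissible_insert[OF ear_fill_insert.prems ear_fill_insert.hyps(1)] by blast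
  obtain t2 where t2: "admissible (xs @ a # L1 @ y # b # ys) t2" "last t2 = last t1"
    using ear_fill_insert.IH(1)[OF t1(1)] by blast
  obtain t3 where t3: "admissible ((xs @ a # L1) @ y # L2 @ b # ys) t3" "last t3 = last t2"
    using ear_fill_insert.IH(2)[of "xs @ a # L1" ys t2] t2(1) ear_fill_insert.prems(2) by auto
  show ?case using t1 t2 t3 by auto
qed auto

lemma admissible_ear_fill:
  assumes "ear_fill a L b" "a \<noteq> b"
  shows "\<exists>ts. admissible (a # L @ [b, a]) ts \<and> last ts = 2 * pi"
proof -
  \<comment> \<open>Two opposite jumps, at \<open>-1\<close> and at \<open>1\<close>: the numerator
    is the constant \<open>2 * (b - a)\<close>.\<close>
  have "admissible [a, b, a] [pi, 2 * pi]"
  proof -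
    have "cis (2 * pi) = 1" by (simp add: complex_eq_iff)
    then show ?thesis
      using assms(2) by (auto simp: admissible_def algebra_simps)
  qed
  then show ?thesis
    using admissible_fill[OF assms(1), of "[]" "[a]"] by fastforce
qed

section \<open>The dilatation\<close>

abbreviation cnj_jumps :: "(complex \<times> complex) list \<Rightarrow> (complex \<times> complex) list" where
  "cnj_jumps \<equiv> map (\<lambda>(\<zeta>, d). (\<zeta>, cnj d))"

text \<open>On the circle \<open>cnj z = 1 / z\<close>, so
  \<open>cnj (z - \<zeta>) = - (z - \<zeta>) / (z * \<zeta>)\<close>, and \<open>\<kappa>\<close> is
  the product of the unimodular numbers \<open>- 1 / (z * \<zeta>)\<close>. The second identity
  conjugates the sum of fractions by
  \<open>cnj (1 / (z - \<zeta>)) = z - z\<^sup>2 / (z - \<zeta>)\<close>, cleared of denominators so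
  that it also holds at the nodes.\<close>

lemma cnj_node_res_poly:
  assumes z: "norm z = 1" and js: "\<And>\<zeta> d. (\<zeta>, d) \<in> set js \<Longrightarrow> norm \<zeta> = 1"
  shows "\<exists>\<kappa>. norm \<kappa> = 1 \<and> cnj (node_poly js z) = \<kappa> * node_poly js z \<and>
    cnj (res_poly js z) = \<kappa> * (z * cnj (\<Sum>j\<leftarrow>js. snd j) * node_poly js z - z\<^sup>2 * res_poly (cnj_jumps js) z)"
  using js
proof (induction js)
  case Nil
  then show ?case by (intro exI[of _ 1]) simp
next
  case (Cons j js)
  obtain \<zeta> d where j: "j = (\<zeta>, d)" by force
  have \<zeta>: "norm \<zeta> = 1" using Cons.prems j by auto
  obtain \<kappa> where \<kappa>: "norm \<kappa> = 1" "cnj (node_poly js z) = \<kappa> * node_poly js z"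
    "cnj (res_poly js z) = \<kappa> * (z * cnj (\<Sum>j\<leftarrow>js. snd j) * node_poly js z - z\<^sup>2 * res_poly (cnj_jumps js) z)"
    using Cons by auto
  have nz: "z \<noteq> 0" "\<zeta> \<noteq> 0" using z \<zeta> by auto
  have cnj: "cnj z = 1 / z" "cnj \<zeta> = 1 / \<zeta>"
    using z \<zeta> nz complex_norm_square[of z] complex_norm_square[of \<zeta>]
    by (auto simp: field_simps)
  have nodes: "node_poly (cnj_jumps js) z = node_poly js z"
    by (induction js) auto
  show ?case
  proof (intro exI conjI)
    let ?\<kappa> = "- \<kappa> / (z * \<zeta>)"
    show "norm ?\<kappa> = 1" using \<kappa>(1) z \<zeta> by (simp add: norm_divide norm_mult)
    show "cnj (node_poly (j # js) z) = ?\<kappa> * node_poly (j # js) z"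
      using nz by (simp add: j \<kappa>(2) cnj field_simps)
    show "cnj (res_poly (j # js) z) = ?\<kappa> * (z * cnj (\<Sum>j\<leftarrow>j # js. snd j) * node_poly (j # js) z -
        z\<^sup>2 * res_poly (cnj_jumps (j # js)) z)"
      using nz by (simp add: j \<kappa>(2,3) cnj nodes field_simps power2_eq_square)
  qed
qed

lemma norm_res_poly_cnj_jumps:
  assumes "norm z = 1" "\<And>\<zeta> d. (\<zeta>, d) \<in> set js \<Longrightarrow> norm \<zeta> = 1" "(\<Sum>j\<leftarrow>js. snd j) = 0"
  shows "norm (res_poly (cnj_jumps js) z) = norm (res_poly js z)"
proof -
  obtain \<kappa> where "norm \<kappa> = 1" "cnj (res_poly js z) = \<kappa> * - (z\<^sup>2 * res_poly (cnj_jumps js) z)"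
    using cnj_node_res_poly[OF assms(1,2)] assms(3) by force
  then have "norm (cnj (res_poly js z)) = norm (res_poly (cnj_jumps js) z)"
    using assms(1) by (simp add: norm_mult norm_power)
  then show ?thesis by simp
qed

text \<open>The point is the equality case. If the quotient \<open>q\<close> attains modulus 1
  inside, it is a constant \<open>c\<close> up to the circle; at a node only the summand of that
  node survives in either numerator, so \<open>cnj d = c * d\<close> for every jump. This means that
  all jumps are parallel, which \<open>nonpar\<close> excludes.\<close>

proposition norm_res_poly_cnj_jumps_less:
  assumes nodes: "\<And>\<zeta> d. (\<zeta>, d) \<in> set js \<Longrightarrow> norm \<zeta> = 1" and sum: "(\<Sum>j\<leftarrow>js. snd j) = 0"
    and nz: "\<And>z. norm z \<le> 1 \<Longrightarrow> res_poly js z \<noteq> 0"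
    and nonpar: "\<And>c. \<exists>(\<zeta>, d) \<in> set js. cnj d \<noteq> c * d"
    and z: "norm z < 1"
  shows "norm (res_poly (cnj_jumps js) z) < norm (res_poly js z)"
proof -
  define q where "q = (\<lambda>z. res_poly (cnj_jumps js) z / res_poly js z)"
  have hol: "q holomorphic_on ball 0 1"
    unfolding q_def using nz by (intro holomorphic_intros) auto
  have cont: "continuous_on (cball 0 1) q"
    unfolding q_def using nz
    by (intro continuous_intros holomorphic_on_imp_continuous_on holomorphic_res_poly) auto
  have circle: "norm (q w) = 1" if "norm w = 1" for w
    using norm_res_poly_cnj_jumps[OF that nodes sum] nz[of w] that by (simp add: q_def norm_divide)
  have le: "norm (q w) \<le> 1" if "norm w < 1" for w
    by (rule maximum_modulus_frontier[of q "ball 0 1"])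
       (use hol cont circle that in \<open>auto simp: frontier_def\<close>)
  have "norm (q z) \<noteq> 1"
  proof
    assume q1: "norm (q z) = 1"
    have "q constant_on ball 0 1"
      by (rule maximum_modulus_principle[of q _ "ball 0 1" z]) (use hol z le q1 in auto)
    then obtain c where c: "\<And>w. norm w < 1 \<Longrightarrow> q w = c"
      by (auto simp: constant_on_def)
    have cc: "q w = c" if "norm w \<le> 1" for w
    proof (rule continuous_constant_on_closure[of "ball 0 1" q])
      show "continuous_on (closure (ball 0 1)) q" using cont by simp
    qed (use c that in auto)
    have "cnj d = c * d" if "(\<zeta>, d) \<in> set js" for \<zeta> d
    proof -
      obtain xs ys where js: "js = xs @ (\<zeta>, d) # ys" using \<open>(\<zeta>, d) \<in> set js\<close> split_list by metis
      have \<zeta>: "norm \<zeta> \<le> 1" using nodes that by simp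
      have eq: "node_poly (cnj_jumps xs @ cnj_jumps ys) \<zeta> = node_poly (xs @ ys) \<zeta>"
      proof -
        have "node_poly (cnj_jumps l) w = node_poly l w" for l w by (induction l) auto
        then show ?thesis by (simp add: node_poly_append)
      qed
      have R: "res_poly js \<zeta> = d * node_poly (xs @ ys) \<zeta>" "res_poly (cnj_jumps js) \<zeta> = cnj d * node_poly (xs @ ys) \<zeta>"
        using eq by (simp_all add: js res_poly_at_node)
      show ?thesis
        using cc[OF \<zeta>] nz[OF \<zeta>] by (simp add: q_def R field_simps)
    qed
    then show False using nonpar[of c] by auto
  qed
  then have "norm (q z) < 1" using le[OF z] by simp
  then show ?thesis using nz[of z] z by (simp add: q_def norm_divide)
qed

lemma sum_list_jumps:
  "length cs = Suc (length ts) \<Longrightarrow> (\<Sum>j\<leftarrow>jumps cs ts. snd j) = hd cs - last cs"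
  by (induction cs ts rule: jumps.induct) (auto simp: length_Suc_conv)

lemma jumps_parallel:
  assumes "length cs = Suc (length ts)" "\<And>\<zeta> d. (\<zeta>, d) \<in> set (jumps cs ts) \<Longrightarrow> cnj d = c * d"
  shows "x \<in> set cs \<Longrightarrow> cnj (hd cs - x) = c * (hd cs - x)"
  using assms
proof (induction cs ts rule: jumps.induct)
  case (1 a b cs t ts)
  have ab: "cnj (a - b) = c * (a - b)" using "1.prems"(3)[of "cis t" "a - b"] by simp
  show ?case
  proof (cases "x = a")
    case False
    then have "cnj (b - x) = c * (b - x)"
      using "1.IH" "1.prems" by auto
    then have "cnj ((a - b) + (b - x)) = c * ((a - b) + (b - x))"
      using ab by (simp only: complex_cnj_add distrib_left)
    then show ?thesis by simp
  qed simp
qed (auto simp: length_Suc_conv)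

text \<open>If every jump satisfied \<open>cnj d = c * d\<close>, summing jumps would give the same
  relation for all differences \<open>a - x\<close> of vertices. Ratios of such differences are
  real, whereas the first apex \<open>y\<close> of the filling has a non-real ratio
  \<open>(y - a) / (b - a)\<close>.\<close>

lemma ear_fill_not_parallel:
  assumes "ear_fill a L b" "L \<noteq> []" "set L \<subseteq> set cs" "b \<in> set cs" "hd cs = a"
    "length cs = Suc (length ts)"
  shows "\<exists>(\<zeta>, d) \<in> set (jumps cs ts). cnj d \<noteq> c * d"
proof (rule ccontr)
  assume "\<not> ?thesis"
  then have par: "cnj (a - x) = c * (a - x)" if "x \<in> set cs" for x
    using jumps_parallel[OF assms(6), of c x] that assms(5) by auto
  obtain y where y: "y \<in> set L" "Im ((y - a) / (b - a)) < 0"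
    using assms(1,2) by (cases rule: ear_fill.cases) auto
  then have "b \<noteq> a" by auto
  have yb: "cnj (a - y) = c * (a - y)" "cnj (a - b) = c * (a - b)"
    using par y(1) assms(3,4) by auto
  then have "c \<noteq> 0" using \<open>b \<noteq> a\<close> by auto
  have "cnj ((a - y) / (a - b)) = (a - y) / (a - b)"
    using \<open>c \<noteq> 0\<close> unfolding complex_cnj_divide yb by simp
  moreover have "(a - y) / (a - b) = (y - a) / (b - a)"
    using minus_divide_divide[of "y - a" "b - a"] by simp
  ultimately have "cnj ((y - a) / (b - a)) = (y - a) / (b - a)" by metis
  then have "Im (cnj ((y - a) / (b - a))) = Im ((y - a) / (b - a))" by metis
  then show False using y(2) unfolding cnj.sel by linarith
qed

section \<open>Poisson integrals of step functions\<close>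

lemma harmonic_real_on_Re_holomorphic:
  assumes S: "open S" and hol: "F holomorphic_on S" and u: "\<And>z. z \<in> S \<Longrightarrow> u z = Re (F z)"
  shows "harmonic_real_on S u"
proof -
  have d1: "(F has_field_derivative deriv F z) (at z)" if "z \<in> S" for z
    using hol S that by (rule holomorphic_derivI)
  have hol1: "deriv F holomorphic_on S" using hol S by (rule holomorphic_deriv)
  have d2: "(deriv F has_field_derivative deriv (deriv F) z) (at z)" if "z \<in> S" for z
    using hol1 S that by (rule holomorphic_derivI)
  have hol2: "deriv (deriv F) holomorphic_on S" using hol1 S by (rule holomorphic_deriv)
  \<comment> \<open>One rule for all six partial derivatives: \<open>e\<close> is the direction of
    the derivative being taken (1 or \<open>\<i>\<close>), and \<open>k\<close> that of a derivative
    already taken (1 if there is none).\<close>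
  have dir: "((\<lambda>s. Re (k * G (z + e * of_real s))) has_real_derivative Re (k * (G' * e))) (at 0)"
    if "(G has_field_derivative G') (at z)" for G G' z k e
  proof -
    have "((\<lambda>w. k * G (z + e * w)) has_field_derivative k * (G' * e)) (at (of_real 0))"
      by (rule DERIV_cmult, rule DERIV_chain2[of G]) (use that in \<open>auto intro!: derivative_eq_intros\<close>)
    then have "((\<lambda>s. k * G (z + e * of_real s)) has_vector_derivative k * (G' * e)) (at 0)"
      by (rule has_vector_derivative_real_field)
    then have "((\<lambda>s. Re (k * G (z + e * of_real s))) has_vector_derivative Re (k * (G' * e))) (at 0)"
      by (rule bounded_linear.has_vector_derivative[OF bounded_linear_Re])
    then show ?thesis by (simp add: has_real_derivative_iff_has_vector_derivative)
  qed
  have cont: "continuous_on S F" "continuous_on S (deriv F)" "continuous_on S (deriv (deriv F))"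
    using hol hol1 hol2 by (auto intro: holomorphic_on_imp_continuous_on)
  have ev: "((\<lambda>s. u (z + e * of_real s)) has_real_derivative D) (at 0)"
    if "((\<lambda>s. Re (F (z + e * of_real s))) has_real_derivative D) (at 0)" "z \<in> S" for z e D
  proof -
    have "((\<lambda>s::real. z + e * of_real s) \<longlongrightarrow> z + e * of_real 0) (nhds 0)"
      by (intro tendsto_intros filterlim_ident)
    then have "\<forall>\<^sub>F s::real in nhds 0. z + e * of_real s \<in> S"
      using S that(2) by (intro topological_tendstoD) auto
    then have "\<forall>\<^sub>F s in nhds 0. Re (F (z + e * of_real s)) = u (z + e * of_real s)"
      by eventually_elim (simp add: u)
    then show ?thesis using that(1) by (subst (asm) DERIV_cong_ev[OF refl _ refl])
  qed
  have contu: "continuous_on S u"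
    using cont(1) by (subst continuous_on_cong[OF refl u]) (auto intro: continuous_intros)
  show ?thesis
    unfolding harmonic_real_on_def
  proof (intro conjI exI ballI)
    fix z assume z: "z \<in> S"
    show "((\<lambda>s. u (z + of_real s)) has_real_derivative Re (deriv F z)) (at 0)"
      using ev[OF _ z, of 1] dir[OF d1[OF z], of 1 1] by simp
    show "((\<lambda>s. u (z + \<i> * of_real s)) has_real_derivative Re (\<i> * deriv F z)) (at 0)"
      using ev[OF _ z, of \<i>] dir[OF d1[OF z], of 1 \<i>] by (simp add: mult.commute)
    show "((\<lambda>s. Re (deriv F (z + of_real s))) has_real_derivative Re (deriv (deriv F) z)) (at 0)"
      using dir[OF d2[OF z], of 1 1] by simp
    show "((\<lambda>s. Re (deriv F (z + \<i> * of_real s))) has_real_derivative Re (\<i> * deriv (deriv F) z)) (at 0)"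
      using dir[OF d2[OF z], of 1 \<i>] by (simp add: mult.commute)
    show "((\<lambda>s. Re (\<i> * deriv F (z + of_real s))) has_real_derivative Re (\<i> * deriv (deriv F) z)) (at 0)"
      using dir[OF d2[OF z], of \<i> 1] by simp
    show "((\<lambda>s. Re (\<i> * deriv F (z + \<i> * of_real s))) has_real_derivative Re (- deriv (deriv F) z)) (at 0)"
      using dir[OF d2[OF z], of \<i> \<i>] by (simp add: mult.commute)
    show "Re (deriv (deriv F) z) + Re (- deriv (deriv F) z) = 0" by simp
  qed (use S cont contu in \<open>auto intro!: continuous_intros\<close>)
qed

section \<open>The Poisson kernel and the harmonic measure of arcs\<close>

text \<open>With \<open>w = z * cis (- \<theta>)\<close> the kernel is
  \<open>Re ((1 + w) / (1 - w)) = 1 + 2 * Re (w / (1 - w))\<close>. The real part is written as an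
  imaginary part because \<open>\<i> * w / (1 - w)\<close> is the derivative of
  \<open>Ln (1 - w)\<close> with respect to \<open>\<theta>\<close>.\<close>

lemma poisson_kernel_eq:
  assumes "norm z < 1"
  shows "poisson_kernel z \<theta> = 1 + 2 * Im (\<i> * z * cis (- \<theta>) / (1 - z * cis (- \<theta>)))"
proof -
  define w where "w = z * cis (- \<theta>)"
  have nw: "norm w = norm z" by (simp add: w_def norm_mult)
  have "cis \<theta> - z = cis \<theta> * (1 - w)"
    by (simp add: w_def algebra_simps flip: cis_mult)
       (metis cis_inverse cis_neq_zero mult.left_commute mult.right_neutral right_inverse)
  then have n: "norm (cis \<theta> - z) = norm (1 - w)" by (simp add: norm_mult)
  have "w \<noteq> 1" using nw assms by auto
  then have pos: "(norm (1 - w))\<^sup>2 \<noteq> 0" by simp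
  have "Im (\<i> * w / (1 - w)) = Re (w / (1 - w))"
    by (metis Im_i_times times_divide_eq_right)
  also have "\<dots> = Re (w * cnj (1 - w)) / (norm (1 - w))\<^sup>2"
    by (simp add: complex_div_cnj[of w])
  finally have "1 + 2 * Im (\<i> * w / (1 - w)) = ((norm (1 - w))\<^sup>2 + 2 * Re (w * cnj (1 - w))) / (norm (1 - w))\<^sup>2"
    using pos by (simp add: field_simps)
  also have "(norm (1 - w))\<^sup>2 + 2 * Re (w * cnj (1 - w)) = 1 - (norm w)\<^sup>2"
    unfolding cmod_power2 by (simp add: power2_eq_square algebra_simps)
  finally have "poisson_kernel z \<theta> = 1 + 2 * Im (\<i> * w / (1 - w))"
    by (simp only: poisson_kernel_def n nw)
  then show ?thesis by (simp only: w_def mult.assoc)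
qed

lemma one_minus_notin_nonpos_Reals:
  fixes w :: complex
  assumes "norm w < 1"
  shows "1 - w \<notin> \<real>\<^sub>\<le>\<^sub>0"
  using complex_Re_le_cmod[of w] assms by (auto simp: complex_nonpos_Reals_iff)

text \<open>Since \<open>1 - z * cis (- \<theta>)\<close> avoids the nonpositive reals, the
  principal logarithm gives an antiderivative on the whole interval, with no branch
  correction.\<close>

lemma has_integral_poisson_kernel:
  assumes z: "norm z < 1" and "a \<le> b"
  shows "(poisson_kernel z has_integral
     (b - a) + 2 * (Im (Ln (1 - z * cis (- b))) - Im (Ln (1 - z * cis (- a))))) {a..b}"
proof -
  have "((\<lambda>\<theta>. \<theta> + 2 * Im (Ln (1 - z * cis (- \<theta>)))) has_vector_derivative poisson_kernel z \<theta>) (at \<theta>)" for \<theta>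
  proof -
    have "norm (z * exp (- \<i> * of_real \<theta>)) < 1"
      using z by (simp add: norm_mult norm_exp_eq_Re)
    then have "((\<lambda>x. Ln (1 - z * exp (- \<i> * x))) has_field_derivative
        \<i> * z * exp (- \<i> * of_real \<theta>) / (1 - z * exp (- \<i> * of_real \<theta>))) (at (of_real \<theta>))"
      using one_minus_notin_nonpos_Reals
      by (auto intro!: derivative_eq_intros simp: field_simps)
    then have "((\<lambda>x. Ln (1 - z * exp (- \<i> * of_real x))) has_vector_derivative
        \<i> * z * exp (- \<i> * of_real \<theta>) / (1 - z * exp (- \<i> * of_real \<theta>))) (at \<theta>)"
      by (rule has_vector_derivative_real_field)
    then have "((\<lambda>x. Im (Ln (1 - z * exp (- \<i> * of_real x)))) has_vector_derivative
        Im (\<i> * z * exp (- \<i> * of_real \<theta>) / (1 - z * exp (- \<i> * of_real \<theta>)))) (at \<theta>)"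
      by (rule bounded_linear.has_vector_derivative[OF bounded_linear_Im])
    moreover have "exp (- \<i> * of_real x) = cis (- x)" for x by (simp add: cis_conv_exp)
    ultimately have "((\<lambda>x. Im (Ln (1 - z * cis (- x)))) has_vector_derivative
        Im (\<i> * z * cis (- \<theta>) / (1 - z * cis (- \<theta>)))) (at \<theta>)" by simp
    then have "((\<lambda>x. x + 2 * Im (Ln (1 - z * cis (- x)))) has_real_derivative
        1 + 2 * Im (\<i> * z * cis (- \<theta>) / (1 - z * cis (- \<theta>)))) (at \<theta>)"
      unfolding has_real_derivative_iff_has_vector_derivative[symmetric]
      by (intro DERIV_add DERIV_ident DERIV_cmult)
    then show ?thesis
      by (simp add: poisson_kernel_eq[OF z] has_real_derivative_iff_has_vector_derivative)
  qed
  then have "(poisson_kernel z has_integral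
     (b + 2 * Im (Ln (1 - z * cis (- b)))) - (a + 2 * Im (Ln (1 - z * cis (- a))))) {a..b}"
    by (intro fundamental_theorem_of_calculus assms(2)) (blast intro: has_vector_derivative_at_within)
  then show ?thesis by (simp add: algebra_simps)
qed

text \<open>Harmonic measure at \<open>z\<close> of the arc from angle \<open>a\<close> to angle
  \<open>b\<close>. The closed form exhibits it as the real part of a holomorphic function and makes
  consecutive arcs telescope.\<close>

definition arc_measure :: "real \<Rightarrow> real \<Rightarrow> complex \<Rightarrow> real" where
  "arc_measure a b z = ((b - a) + 2 * (Im (Ln (1 - z * cis (- b))) - Im (Ln (1 - z * cis (- a))))) / (2 * pi)"

lemma has_integral_arc_measure:
  assumes "norm z < 1" "a \<le> b"
  shows "(poisson_kernel z has_integral 2 * pi * arc_measure a b z) {a..b}"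
  using has_integral_poisson_kernel[OF assms] by (simp add: arc_measure_def)

lemma poisson_integral_step_fun:
  assumes z: "norm z < 1" and t: "t 0 = 0" "t (length cs) = 2 * pi" "\<And>k. k < length cs \<Longrightarrow> t k < t (Suc k)"
  shows "poisson_integral (step_fun t cs) z = (\<Sum>k<length cs. of_real (arc_measure (t k) (t (Suc k)) z) * cs ! k)"
proof -
  have mono: "t i \<le> t j" if "i \<le> j" "j \<le> length cs" for i j
    using that
  proof (induction j rule: dec_induct)
    case (step m)
    then show ?case using t(3)[of m] by auto
  qed simp
  have "((\<lambda>\<theta>. of_real (poisson_kernel z \<theta>) * (if t k < \<theta> \<and> \<theta> < t (Suc k) then cs ! k else 0))
      has_integral of_real (2 * pi * arc_measure (t k) (t (Suc k)) z) * cs ! k) {0..2 * pi}"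
    if k: "k < length cs" for k
  proof -
    have "((\<lambda>\<theta>. of_real (poisson_kernel z \<theta>) * cs ! k) has_integral
        of_real (2 * pi * arc_measure (t k) (t (Suc k)) z) * cs ! k) {t k..t (Suc k)}"
      using has_integral_arc_measure[OF z] t(3)[OF k]
      by (intro has_integral_mult_left has_integral_of_real) auto
    \<comment> \<open>The step function vanishes at its breakpoints, so the integrand is matched on
      the open arc.\<close>
    then have "((\<lambda>\<theta>. of_real (poisson_kernel z \<theta>) * cs ! k) has_integral
        of_real (2 * pi * arc_measure (t k) (t (Suc k)) z) * cs ! k) {t k<..<t (Suc k)}"
      by (simp only: has_integral_Icc_iff_Ioo)
    moreover have "{t k<..<t (Suc k)} \<subseteq> {0..2 * pi}"
      using mono[of 0 k] mono[of "Suc k" "length cs"] k t(1,2) by auto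
    ultimately have "((\<lambda>\<theta>. if \<theta> \<in> {t k<..<t (Suc k)} then of_real (poisson_kernel z \<theta>) * cs ! k else 0) has_integral
        of_real (2 * pi * arc_measure (t k) (t (Suc k)) z) * cs ! k) {0..2 * pi}"
      by (simp only: has_integral_restrict)
    then show ?thesis
      by (rule has_integral_eq[rotated]) auto
  qed
  then have "((\<lambda>\<theta>. \<Sum>k<length cs. of_real (poisson_kernel z \<theta>) * (if t k < \<theta> \<and> \<theta> < t (Suc k) then cs ! k else 0))
      has_integral (\<Sum>k<length cs. of_real (2 * pi * arc_measure (t k) (t (Suc k)) z) * cs ! k)) {0..2 * pi}"
    by (intro has_integral_sum) auto
  then have "((\<lambda>\<theta>. of_real (poisson_kernel z \<theta>) * step_fun t cs \<theta>) has_integral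
      (\<Sum>k<length cs. of_real (2 * pi * arc_measure (t k) (t (Suc k)) z) * cs ! k)) {0..2 * pi}"
    by (simp add: step_fun_def sum_distrib_left)
  then have "poisson_integral (step_fun t cs) z =
      of_real (1 / (2 * pi)) * (\<Sum>k<length cs. of_real (2 * pi * arc_measure (t k) (t (Suc k)) z) * cs ! k)"
    unfolding poisson_integral_def by (subst integral_unique, assumption) (rule refl)
  then show ?thesis by (simp add: sum_distrib_left)
qed

lemma holomorphic_Ln_disk:
  "(\<lambda>z. Ln (1 - z * cis s)) holomorphic_on ball 0 1"
  by (intro holomorphic_intros one_minus_notin_nonpos_Reals) (auto simp: norm_mult)

lemma arc_measure_eq_Re:
  "arc_measure a b z = Re ((of_real (b - a) - 2 * \<i> * (Ln (1 - z * cis (- b)) - Ln (1 - z * cis (- a)))) / of_real (2 * pi))"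
  unfolding Re_divide_of_real arc_measure_def by simp

lemma harmonic_on_arc_measure_sum:
  assumes "\<And>z. norm z < 1 \<Longrightarrow> f z = (\<Sum>k<n. of_real (arc_measure (t k) (t (Suc k)) z) * c k)"
  shows "harmonic_on (ball 0 1) f"
proof -
  \<comment> \<open>A holomorphic function with real part \<open>arc_measure a b\<close>. Only real
    coefficients preserve this relation, so the real and imaginary parts of the values
    \<open>c k\<close> are treated separately.\<close>
  define H where "H = (\<lambda>a b z. (of_real (b - a) - 2 * \<i> * (Ln (1 - z * cis (- b)) - Ln (1 - z * cis (- a)))) / of_real (2 * pi))"
  have hol: "H a b holomorphic_on ball 0 1" for a b
    unfolding H_def by (intro holomorphic_intros holomorphic_Ln_disk) auto
  have arc: "arc_measure a b z = Re (H a b z)" for a b z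
    unfolding H_def by (rule arc_measure_eq_Re)
  show ?thesis
    unfolding harmonic_on_def
  proof
    show "harmonic_real_on (ball 0 1) (\<lambda>z. Re (f z))"
      by (rule harmonic_real_on_Re_holomorphic[where F = "\<lambda>z. \<Sum>k<n. H (t k) (t (Suc k)) z * of_real (Re (c k))"])
         (auto intro!: holomorphic_intros hol simp: assms arc)
    show "harmonic_real_on (ball 0 1) (\<lambda>z. Im (f z))"
      by (rule harmonic_real_on_Re_holomorphic[where F = "\<lambda>z. \<Sum>k<n. H (t k) (t (Suc k)) z * of_real (Im (c k))"])
         (auto intro!: holomorphic_intros hol simp: assms arc)
  qed
qed

section \<open>Boundary behaviour of the extension\<close>

lemma poisson_kernel_nonneg: "norm z < 1 \<Longrightarrow> poisson_kernel z \<theta> \<ge> 0"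
  by (simp add: poisson_kernel_def power_le_one)

lemma arc_measure_nonneg:
  assumes "norm z < 1" "a \<le> b"
  shows "arc_measure a b z \<ge> 0"
proof -
  have "2 * pi * arc_measure a b z \<ge> 0"
    using has_integral_arc_measure[OF assms] by (rule has_integral_nonneg) (simp add: poisson_kernel_nonneg assms)
  then show ?thesis using pi_gt_zero by (auto simp: zero_le_mult_iff)
qed

lemma sum_arc_measure:
  assumes "t 0 = 0" "t n = 2 * pi"
  shows "(\<Sum>k<n. arc_measure (t k) (t (Suc k)) z) = 1"
proof -
  define G where "G = (\<lambda>k. (t k + 2 * Im (Ln (1 - z * cis (- t k)))) / (2 * pi))"
  have "arc_measure (t k) (t (Suc k)) z = G (Suc k) - G k" for k
    by (simp add: arc_measure_def G_def field_simps)
  then have "(\<Sum>k<n. arc_measure (t k) (t (Suc k)) z) = G n - G 0"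
    by (simp add: sum_lessThan_telescope)
  also have "cis (- (2 * pi)) = 1" by (simp add: complex_eq_iff)
  then have "G n - G 0 = 1" by (simp add: G_def assms field_simps)
  finally show ?thesis .
qed

text \<open>Near \<open>x\<close> the points of the arc are at distance at least
  \<open>\<delta> / 2\<close>, so the kernel is at most
  \<open>(1 - (norm z)\<^sup>2) / (\<delta> / 2)\<^sup>2\<close>, whose numerator tends to 0 at the
  circle.\<close>

lemma arc_measure_tendsto_0:
  assumes X: "\<And>n. norm (X n) < 1" "X \<longlonglongrightarrow> x" and x: "norm x = 1" "x \<notin> cis ` {a..b}" and "a \<le> b"
  shows "(\<lambda>n. arc_measure a b (X n)) \<longlonglongrightarrow> 0"
proof -
  have "closed (cis ` {a..b})"
    by (intro compact_imp_closed compact_continuous_image continuous_intros) auto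
  then obtain \<delta> where \<delta>: "\<delta> > 0" "\<And>\<theta>. \<theta> \<in> {a..b} \<Longrightarrow> \<delta> \<le> dist x (cis \<theta>)"
    using separate_point_closed[OF _ x(2)] by auto
  define g where "g = (\<lambda>n. (1 - (norm (X n))\<^sup>2) / (\<delta> / 2)\<^sup>2 * (b - a) / (2 * pi))"
  have "g \<longlonglongrightarrow> (1 - (norm x)\<^sup>2) / (\<delta> / 2)\<^sup>2 * (b - a) / (2 * pi)"
    unfolding g_def using \<delta>(1) by (intro tendsto_intros X(2)) auto
  then have g: "g \<longlonglongrightarrow> 0" by (simp add: x)
  have "\<forall>\<^sub>F n in sequentially. dist (X n) x < \<delta> / 2"
    using X(2) \<delta>(1) by (intro tendstoD) auto
  then have up: "\<forall>\<^sub>F n in sequentially. arc_measure a b (X n) \<le> g n"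
  proof eventually_elim
    case (elim n)
    have "poisson_kernel (X n) \<theta> \<le> (1 - (norm (X n))\<^sup>2) / (\<delta> / 2)\<^sup>2" if "\<theta> \<in> {a..b}" for \<theta>
    proof -
      have "\<delta> \<le> dist x (X n) + dist (X n) (cis \<theta>)"
        using \<delta>(2)[OF that] dist_triangle[of x "cis \<theta>" "X n"] by linarith
      then have "\<delta> / 2 \<le> norm (cis \<theta> - X n)"
        using elim by (simp add: dist_norm norm_minus_commute)
      then have "(\<delta> / 2)\<^sup>2 \<le> (norm (cis \<theta> - X n))\<^sup>2"
        using \<delta>(1) by (intro power_mono) auto
      then show ?thesis
        unfolding poisson_kernel_def using X(1)[of n] \<delta>(1)
        by (intro divide_left_mono) (auto simp: power_le_one intro!: mult_pos_pos zero_less_power)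
    qed
    moreover have "((\<lambda>_. (1 - (norm (X n))\<^sup>2) / (\<delta> / 2)\<^sup>2) has_integral
        (b - a) *\<^sub>R ((1 - (norm (X n))\<^sup>2) / (\<delta> / 2)\<^sup>2)) {a..b}"
      using has_integral_const_real[of "(1 - (norm (X n))\<^sup>2) / (\<delta> / 2)\<^sup>2" a b] \<open>a \<le> b\<close> by (simp only: content_real)
    ultimately have "2 * pi * arc_measure a b (X n) \<le> (b - a) *\<^sub>R ((1 - (norm (X n))\<^sup>2) / (\<delta> / 2)\<^sup>2)"
      by (intro has_integral_le[OF has_integral_arc_measure[OF X(1) \<open>a \<le> b\<close>]])
    then have "arc_measure a b (X n) \<le> ((b - a) *\<^sub>R ((1 - (norm (X n))\<^sup>2) / (\<delta> / 2)\<^sup>2)) / (2 * pi)"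
      by (subst pos_le_divide_eq) (auto simp: mult.commute)
    then show ?case by (simp add: g_def mult.commute)
  qed
  have "\<forall>\<^sub>F n in sequentially. 0 \<le> arc_measure a b (X n)"
    using arc_measure_nonneg[OF X(1) \<open>a \<le> b\<close>] by simp
  then show ?thesis
    by (rule tendsto_sandwich[OF _ up tendsto_const g])
qed

lemma strict_mono_steps:
  fixes t :: "nat \<Rightarrow> real"
  assumes "\<And>k. k < n \<Longrightarrow> t k < t (Suc k)" "i < j" "j \<le> n"
  shows "t i < t j"
  using assms(2,3)
proof (induction j)
  case (Suc j)
  then show ?case using assms(1)[of j] by (cases "i = j") auto
qed simp

lemma cis_eq_range_2pi:
  assumes "cis s = cis \<theta>" "0 < s" "s \<le> 2 * pi" "0 \<le> \<theta>" "\<theta> \<le> 2 * pi"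
  shows "\<theta> = s \<or> \<theta> = 0 \<and> s = 2 * pi"
proof -
  have "sin s = sin \<theta> \<and> cos s = cos \<theta>" using assms(1) by (metis cis.sel)
  then obtain n :: int where n: "s = \<theta> + 2 * pi * of_int n" using sin_cos_eq_iff[of s \<theta>] by metis
  have "2 * pi * of_int n \<le> 2 * pi * 1" "2 * pi * -1 < 2 * pi * of_int n"
    using n assms(2-5) by linarith+
  then have "of_int n \<le> (1::real)" "(-1::real) < of_int n"
    unfolding mult_le_cancel_left mult_less_cancel_left by auto
  then have "n = 0 \<or> n = 1" by linarith
  then show ?thesis using n assms by auto
qed

text \<open>In the limit only closed arcs containing \<open>x\<close> keep harmonic measure. They
  are among arc \<open>j\<close> and its successor \<open>j'\<close>, and the measures add up to 1,
  so the sum approaches convex combinations of \<open>c j\<close> and \<open>c (Suc j)\<close>, that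
  is, points of one edge.\<close>

lemma arc_measure_sum_boundary:
  fixes c :: "nat \<Rightarrow> complex"
  assumes t: "t 0 = 0" "t n = 2 * pi" "\<And>k. k < n \<Longrightarrow> t k < t (Suc k)" and n: "2 \<le> n" and c: "c n = c 0"
    and X: "\<And>i. norm (X i) < 1" "X \<longlonglongrightarrow> x" "norm x = 1"
    and y: "(\<lambda>i. \<Sum>k<n. of_real (arc_measure (t k) (t (Suc k)) (X i)) * c k) \<longlonglongrightarrow> y"
  shows "\<exists>j<n. y \<in> closed_segment (c j) (c (Suc j))"
proof -
  have mono: "t i < t j" if "i < j" "j \<le> n" for i j
    using strict_mono_steps[of n t i j] t(3) that by blast
  \<comment> \<open>The range is (0, 2 pi] rather than [0, 2 pi), so that \<open>s\<close> falls
    into exactly one of the arcs from \<open>t j\<close> (excluded) to \<open>t (Suc j)\<close>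
    (included); the point 1 belongs to the last one.\<close>
  obtain s where s: "x = cis s" "0 < s" "s \<le> 2 * pi"
  proof -
    have "x \<noteq> 0" using X(3) by auto
    have xa: "x = cis (Arg2pi x)" using Arg2pi_eq[of x] X(3) by (simp add: cis_conv_exp)
    show ?thesis
    proof (cases "Arg2pi x = 0")
      case True
      then have "x = cis (2 * pi)" using xa by (simp add: complex_eq_iff)
      then show ?thesis using that[of "2 * pi"] by simp
    next
      case False
      then have "0 < Arg2pi x" using Arg2pi_ge_0[of x] by linarith
      then show ?thesis using that[of "Arg2pi x"] xa Arg2pi_lt_2pi[of x] by simp
    qed
  qed
  define i where "i = (LEAST i. s \<le> t i)"
  have sn: "s \<le> t n" using s(3) t(2) by simp
  have i: "s \<le> t i" "\<And>k. k < i \<Longrightarrow> t k < s" "i \<le> n"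
  proof -
    show "s \<le> t i" unfolding i_def using sn by (rule LeastI)
    show "i \<le> n" unfolding i_def using sn by (rule Least_le)
    show "t k < s" if "k < i" for k
      using not_less_Least[of k "\<lambda>i. s \<le> t i"] that by (simp add: i_def not_le)
  qed
  have "i \<noteq> 0" using i(1) t(1) s(2) by (metis not_le)
  then obtain j where ij: "i = Suc j" by (cases i) auto
  have j: "j < n" "t j < s" "s \<le> t (Suc j)" using i ij by auto
  \<comment> \<open>The arc after the last one is arc 0, and \<open>c n = c 0\<close> keeps
    \<open>c j' = c (Suc j)\<close>.\<close>
  define j' where "j' = (if Suc j = n then 0 else Suc j)"
  have j': "j' < n" "j' \<noteq> j" "c j' = c (Suc j)" using j(1) n c by (auto simp: j'_def)
  have far: "x \<notin> cis ` {t k..t (Suc k)}" if k: "k < n" "k \<noteq> j" "k \<noteq> j'" for k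
  proof
    assume "x \<in> cis ` {t k..t (Suc k)}"
    then obtain \<theta> where \<theta>: "cis s = cis \<theta>" "t k \<le> \<theta>" "\<theta> \<le> t (Suc k)" using s(1) by auto
    have t0: "0 \<le> t k" "t (Suc k) \<le> 2 * pi"
      using mono[of 0 k] mono[of "Suc k" n] k(1) t(1,2)
      by (cases "k = 0"; cases "Suc k = n"; auto)+
    have "\<theta> = s \<or> \<theta> = 0 \<and> s = 2 * pi"
      using cis_eq_range_2pi[OF \<theta>(1) s(2,3)] t0 \<theta> by linarith
    then show False
    proof
      assume "\<theta> = s"
      then have "\<not> k < j" using mono[of "Suc k" j] j \<theta>(3) by (cases "Suc k = j") auto
      then have "Suc j < k" using k j j'_def by (cases "Suc j = k") auto
      then show False using mono[of "Suc j" k] k(1) \<theta>(2) \<open>\<theta> = s\<close> j(3) by auto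
    next
      assume *: "\<theta> = 0 \<and> s = 2 * pi"
      then have "k = 0" using mono[of 0 k] k(1) t(1) \<theta>(2) by (cases k) auto
      moreover have "Suc j = n" using * j mono[of "Suc j" n] t(2) by (cases "Suc j = n") auto
      ultimately show False using k(3) by (simp add: j'_def)
    qed
  qed
  define m where "m = (\<lambda>k i. arc_measure (t k) (t (Suc k)) (X i))"
  have m0: "m k i \<ge> 0" if "k < n" for k i
    unfolding m_def using X(1) t(3)[OF that] by (intro arc_measure_nonneg) auto
  have m1: "(\<Sum>k<n. m k i) = 1" for i
    unfolding m_def by (rule sum_arc_measure[OF t(1,2)])
  have mle: "m k i \<le> 1" if "k < n" for k i
    using member_le_sum[of k "{..<n}" "\<lambda>k. m k i"] m0 m1[of i] that by auto
  have mlim: "(\<lambda>i. m k i) \<longlonglongrightarrow> 0" if "k < n" "k \<noteq> j" "k \<noteq> j'" for k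
    unfolding m_def by (rule arc_measure_tendsto_0[OF X]) (use far that t(3)[OF that(1)] in auto)
  \<comment> \<open>All measure not on arc \<open>j'\<close> is assigned to \<open>c j\<close>. Thus
    \<open>q i\<close> lies exactly on the edge, and it differs from the sum only by terms with
    vanishing measures.\<close>
  define q where "q = (\<lambda>i. (1 - m j' i) *\<^sub>R c j + m j' i *\<^sub>R c (Suc j))"
  have split: "(\<Sum>k<n. g k) = g j + g j' + (\<Sum>k\<in>{..<n} - {j, j'}. g k)" for g :: "nat \<Rightarrow> complex"
    using sum.subset_diff[of "{j, j'}" "{..<n}" g] j(1) j' by (simp add: add.commute)
  have split': "(\<Sum>k<n. g k) = g j + g j' + (\<Sum>k\<in>{..<n} - {j, j'}. g k)" for g :: "nat \<Rightarrow> real"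
    using sum.subset_diff[of "{j, j'}" "{..<n}" g] j(1) j' by (simp add: add.commute)
  have "q = (\<lambda>i. (\<Sum>k<n. of_real (m k i) * c k) - (\<Sum>k\<in>{..<n} - {j, j'}. of_real (m k i) * (c k - c j)))"
  proof
    fix i
    have mj: "m j i = 1 - m j' i - (\<Sum>k\<in>{..<n} - {j, j'}. m k i)"
      using m1[of i] split'[of "\<lambda>k. m k i"] by linarith
    show "q i = (\<Sum>k<n. of_real (m k i) * c k) - (\<Sum>k\<in>{..<n} - {j, j'}. of_real (m k i) * (c k - c j))"
      unfolding split mj q_def j'(3)
      by (simp add: scaleR_conv_of_real algebra_simps sum_subtractf sum_distrib_left)
  qed
  moreover have "(\<lambda>i. (\<Sum>k<n. of_real (m k i) * c k) - (\<Sum>k\<in>{..<n} - {j, j'}. of_real (m k i) * (c k - c j)))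
      \<longlonglongrightarrow> y - (\<Sum>k\<in>{..<n} - {j, j'}. of_real 0 * (c k - c j))"
    using y by (intro tendsto_intros mlim) (auto simp: m_def)
  ultimately have "q \<longlonglongrightarrow> y" by simp
  moreover have "q i \<in> closed_segment (c j) (c (Suc j))" for i
    using m0[OF j'(1), of i] mle[OF j'(1), of i] by (auto simp: q_def closed_segment_def)
  ultimately have "y \<in> closed_segment (c j) (c (Suc j))"
    using closed_sequentially[OF closed_segment] by blast
  then show ?thesis using j(1) by blast
qed

lemma norm_arc_measure_sum_le:
  fixes c :: "nat \<Rightarrow> complex"
  assumes t: "t 0 = 0" "t n = 2 * pi" "\<And>k. k < n \<Longrightarrow> t k < t (Suc k)" and z: "norm z < 1"
  shows "norm (\<Sum>k<n. of_real (arc_measure (t k) (t (Suc k)) z) * c k) \<le> (\<Sum>k<n. norm (c k))"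
proof (rule sum_norm_le)
  fix k assume k: "k \<in> {..<n}"
  have nn: "arc_measure (t k) (t (Suc k)) z \<ge> 0" if "k < n" for k
    using t(3)[OF that] z by (intro arc_measure_nonneg) auto
  then have "arc_measure (t k) (t (Suc k)) z \<le> 1"
    using member_le_sum[of k "{..<n}" "\<lambda>k. arc_measure (t k) (t (Suc k)) z"] k sum_arc_measure[OF t(1,2), of z] by auto
  then show "norm (of_real (arc_measure (t k) (t (Suc k)) z) * c k) \<le> norm (c k)"
    using nn k by (simp add: norm_mult mult_left_le_one_le)
qed

section \<open>The differential of the extension and univalence\<close>

text \<open>The determinant of the real-linear map with coefficients \<open>P\<close> and
  \<open>Q\<close> is the difference of their squared moduli. It is positive here, so the inverse
  function theorem applies.\<close>

lemma local_homeomorphism_complex: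
  fixes P Q :: "complex \<Rightarrow> complex"
  assumes S: "open S" and der: "\<And>z. z \<in> S \<Longrightarrow> (f has_derivative (\<lambda>v. P z * v + Q z * cnj v)) (at z)"
    and cont: "continuous_on S P" "continuous_on S Q" and less: "\<And>z. z \<in> S \<Longrightarrow> norm (Q z) < norm (P z)"
    and x: "x \<in> S"
  shows "\<exists>U V g. open U \<and> x \<in> U \<and> U \<subseteq> S \<and> open V \<and> homeomorphism U V f g"
proof -
  have bl: "bounded_linear (\<lambda>v. P z * v + Q z * cnj v)" for z
    by (intro bounded_linear_intros bounded_linear_compose[OF bounded_linear_mult_right bounded_linear_cnj])
  define f' where "f' = (\<lambda>z. Blinfun (\<lambda>v. P z * v + Q z * cnj v))"
  have f': "blinfun_apply (f' z) = (\<lambda>v. P z * v + Q z * cnj v)" for z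
    unfolding f'_def using bl by (rule bounded_linear_Blinfun_apply)
  have inj: "inj (\<lambda>v. P x * v + Q x * cnj v)"
  proof (subst linear_injective_0[OF bounded_linear.linear[OF bl]], intro allI impI)
    fix v assume "P x * v + Q x * cnj v = 0"
    then have "norm (P x * v) = norm (Q x * cnj v)" by (metis add_eq_0_iff norm_minus_cancel)
    then show "v = 0" using less[OF x] by (auto simp: norm_mult)
  qed
  obtain g where g: "linear g" "g \<circ> (\<lambda>v. P x * v + Q x * cnj v) = id"
    using linear_injective_left_inverse[OF bounded_linear.linear[OF bl] inj] by blast
  have inv: "Blinfun g o\<^sub>L f' x = id_blinfun"
  proof (rule blinfun_eqI)
    fix v
    have "blinfun_apply (Blinfun g) = g"
      using g(1) by (intro bounded_linear_Blinfun_apply) (simp add: linear_conv_bounded_linear)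
    then show "blinfun_apply (Blinfun g o\<^sub>L f' x) v = blinfun_apply id_blinfun v"
      using g(2) by (simp add: f' fun_eq_iff)
  qed
  have cont': "continuous_on S f'"
    by (rule continuous_on_blinfun_componentwise) (auto simp: f' intro!: continuous_intros cont)
  have der': "(f has_derivative blinfun_apply (f' z)) (at z)" if "z \<in> S" for z
    using der[OF that] by (simp add: f')
  show ?thesis
  proof (rule inverse_function_theorem[OF S der' cont' x inv])
    fix U V g
    assume "open U" "U \<subseteq> S" "x \<in> U" "open V" "homeomorphism U V f g"
    then show ?thesis by blast
  qed
qed

lemma sum_by_parts_cyclic:
  fixes c G :: "nat \<Rightarrow> complex"
  shows "(\<Sum>k<n. (G (Suc k) - G k) * c k) = (\<Sum>k<n. (c k - c (Suc k)) * G (Suc k)) + c n * G n - c 0 * G 0"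
  by (induction n) (auto simp: algebra_simps)

text \<open>Summation by parts moves the differences from the logarithms to the values
  \<open>c\<close>, leaving one logarithm per jump; the boundary terms cancel because values and
  nodes close up. The function \<open>Ln (1 - z * cis (- t))\<close> has derivative
  \<open>1 / (z - cis t)\<close>, and writing the imaginary part of its differential as
  \<open>(w - cnj w) / (2 * \<i>)\<close> separates the part linear in \<open>v\<close> (giving
  \<open>A\<close>) from the part linear in \<open>cnj v\<close> (giving \<open>B\<close>).\<close>

lemma has_derivative_arc_measure_sum:
  fixes c :: "nat \<Rightarrow> complex"
  assumes t: "cis (t n) = cis (t 0)" and c: "c n = c 0" and z: "norm z < 1"
  defines "A \<equiv> \<lambda>z. \<Sum>k<n. (c k - c (Suc k)) / (z - cis (t (Suc k)))"
    and "B \<equiv> \<lambda>z. \<Sum>k<n. cnj (c k - c (Suc k)) / (z - cis (t (Suc k)))"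
  shows "((\<lambda>z. \<Sum>k<n. of_real (arc_measure (t k) (t (Suc k)) z) * c k) has_derivative
    (\<lambda>v. A z / (2 * pi * \<i>) * v + cnj (B z) / - (2 * pi * \<i>) * cnj v)) (at z)"
proof -
  define L where "L = (\<lambda>k z. of_real (Im (Ln (1 - z * cis (- t k)))) :: complex)"
  have Ln: "L n z = L 0 z" for z
    using t by (simp add: L_def flip: cis_cnj)
  have f_eq: "(\<Sum>k<n. of_real (arc_measure (t k) (t (Suc k)) z) * c k) =
      (\<Sum>k<n. of_real ((t (Suc k) - t k) / (2 * pi)) * c k) + (\<Sum>k<n. (c k - c (Suc k)) * L (Suc k) z) / pi" for z
  proof -
    have "(\<Sum>k<n. of_real (arc_measure (t k) (t (Suc k)) z) * c k) =
        (\<Sum>k<n. of_real ((t (Suc k) - t k) / (2 * pi)) * c k + (L (Suc k) z - L k z) * c k / pi)"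
      by (intro sum.cong refl) (simp add: arc_measure_def L_def add_divide_distrib diff_divide_distrib algebra_simps)
    also have "\<dots> = (\<Sum>k<n. of_real ((t (Suc k) - t k) / (2 * pi)) * c k) + (\<Sum>k<n. (L (Suc k) z - L k z) * c k) / pi"
      by (simp only: sum.distrib sum_divide_distrib)
    also have "(\<Sum>k<n. (L (Suc k) z - L k z) * c k) = (\<Sum>k<n. (c k - c (Suc k)) * L (Suc k) z)"
      using sum_by_parts_cyclic[of "\<lambda>k. L k z" c n] Ln c by simp
    finally show ?thesis .
  qed
  have nz: "z \<noteq> cis s" for s using z by (metis norm_cis less_irrefl)
  have dL: "(L k has_derivative (\<lambda>v. of_real (Im (v / (z - cis (t k)))))) (at z)" for k
  proof -
    have n: "norm (z * cis (- t k)) < 1" using z by (simp add: norm_mult)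
    have "- cis (- t k) / (1 - z * cis (- t k)) = 1 / (z - cis (t k))"
    proof -
      have "cis (t k) * (1 - z * cis (- t k)) = cis (t k) - z"
        by (simp add: algebra_simps cis_mult)
      then have "- cis (- t k) / (1 - z * cis (- t k)) = - (cis (t k) * cis (- t k)) / (cis (t k) - z)"
        by (metis cis_neq_zero mult_divide_mult_cancel_left mult_minus_right)
      also have "\<dots> = 1 / (z - cis (t k))"
        by (simp add: cis_mult) (metis minus_diff_eq minus_divide_left minus_divide_right)
      finally show ?thesis .
    qed
    then have "((\<lambda>z. Ln (1 - z * cis (- t k))) has_field_derivative 1 / (z - cis (t k))) (at z)"
      using one_minus_notin_nonpos_Reals[OF n]
      by (auto intro!: derivative_eq_intros simp: divide_inverse mult.commute)
    then have "((\<lambda>z. Ln (1 - z * cis (- t k))) has_derivative (\<lambda>v. 1 / (z - cis (t k)) * v)) (at z)"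
      unfolding has_field_derivative_def .
    from bounded_linear.has_derivative[OF bounded_linear_of_real bounded_linear.has_derivative[OF bounded_linear_Im this]]
    show ?thesis by (simp add: L_def)
  qed
  have "((\<lambda>z. \<Sum>k<n. of_real (arc_measure (t k) (t (Suc k)) z) * c k) has_derivative
    (\<lambda>v. 0 + (\<Sum>k<n. (c k - c (Suc k)) * of_real (Im (v / (z - cis (t (Suc k)))))) / pi)) (at z)"
    unfolding f_eq
    by (intro has_derivative_add has_derivative_const bounded_linear.has_derivative[OF bounded_linear_divide]
        has_derivative_sum has_derivative_mult_right dL)
  moreover have "0 + (\<Sum>k<n. (c k - c (Suc k)) * of_real (Im (v / (z - cis (t (Suc k)))))) / pi =
      A z / (2 * pi * \<i>) * v + cnj (B z) / - (2 * pi * \<i>) * cnj v" for v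
  proof -
    have im: "complex_of_real (Im w) = (w - cnj w) / (2 * \<i>)" for w
      by (simp add: complex_eq_iff)
    have tm: "d * of_real (Im (v / w)) = (d / w * v - cnj (cnj d / w) * cnj v) / (2 * \<i>)" for d w
      by (simp only: im complex_cnj_divide complex_cnj_cnj times_divide_eq_right times_divide_eq_left right_diff_distrib)
    have "(\<Sum>k<n. (c k - c (Suc k)) * of_real (Im (v / (z - cis (t (Suc k)))))) =
      (\<Sum>k<n. ((c k - c (Suc k)) / (z - cis (t (Suc k))) * v - cnj (cnj (c k - c (Suc k)) / (z - cis (t (Suc k)))) * cnj v) / (2 * \<i>))"
      by (simp only: tm)
    also have "\<dots> = (A z * v - cnj (B z) * cnj v) / (2 * \<i>)"
      unfolding A_def B_def cnj_sum
      by (simp only: sum_divide_distrib[symmetric] sum_subtractf sum_distrib_right)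
    finally show ?thesis by (simp add: field_simps)
  qed
  ultimately show ?thesis by simp
qed

lemma res_poly_divide_node_poly:
  assumes "\<And>\<zeta> d. (\<zeta>, d) \<in> set js \<Longrightarrow> z \<noteq> \<zeta>"
  shows "(\<Sum>(\<zeta>, d)\<leftarrow>js. d / (z - \<zeta>)) = res_poly js z / node_poly js z"
  using assms
proof (induction js)
  case (Cons j js)
  obtain \<zeta> d where j: "j = (\<zeta>, d)" by force
  have "node_poly js z \<noteq> 0" using Cons.prems by (force simp: node_poly_eq_0_iff)
  moreover have "z \<noteq> \<zeta>" using Cons.prems j by auto
  moreover have "(\<Sum>(\<zeta>, d)\<leftarrow>js. d / (z - \<zeta>)) = res_poly js z / node_poly js z"
    using Cons by auto
  ultimately show ?case by (simp add: j add_divide_distrib)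
qed simp

lemma length_jumps: "length cs = Suc (length ts) \<Longrightarrow> length (jumps cs ts) = length ts"
  by (induction cs ts rule: jumps.induct) auto

lemma nth_jumps:
  "length cs = Suc (length ts) \<Longrightarrow> k < length ts \<Longrightarrow> jumps cs ts ! k = (cis (ts ! k), cs ! k - cs ! Suc k)"
proof (induction cs ts arbitrary: k rule: jumps.induct)
  case (1 a b cs t ts)
  then show ?case by (cases k) auto
qed auto

lemma sum_jumps:
  assumes "length cs = Suc (length ts)"
  shows "(\<Sum>j\<leftarrow>jumps cs ts. g j) = (\<Sum>k<length ts. g (cis (ts ! k), cs ! k - cs ! Suc k))"
  using assms by (simp add: sum_list_sum_nth length_jumps nth_jumps atLeast0LessThan)

text \<open>The analytic half of the proof. The polygon enters through a simple closed curve
  \<open>p\<close> containing its edges, where the cluster values must lie; the zero-free numerator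
  and the non-parallel jumps supply the local homeomorphism.\<close>

proposition poisson_integral_step_fun_univalent:
  assumes cs: "cs \<noteq> []" and n: "2 \<le> length cs"
    and adm: "admissible (cs @ [hd cs]) ts" and last: "last ts = 2 * pi"
    and nonpar: "\<And>c. \<exists>(\<zeta>, d) \<in> set (jumps (cs @ [hd cs]) ts). cnj d \<noteq> c * d"
    and p: "simple_path p" "pathfinish p = pathstart p"
    and seg: "\<And>k. k < length cs \<Longrightarrow> closed_segment (cs ! k) ((cs @ [hd cs]) ! Suc k) \<subseteq> path_image p"
  shows "\<exists>t :: nat \<Rightarrow> real. t 0 = 0 \<and> t (length cs) = 2 * pi \<and> (\<forall>k < length cs. t k < t (Suc k)) \<and>
     harmonic_on (ball 0 1) (poisson_integral (step_fun t cs)) \<and>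
     inj_on (poisson_integral (step_fun t cs)) (ball 0 1) \<and>
     poisson_integral (step_fun t cs) ` ball 0 1 = inside (path_image p)"
proof -
  let ?n = "length cs"
  define c where "c = (\<lambda>k. (cs @ [hd cs]) ! k)"
  \<comment> \<open>Prepending 0 shifts the index: the jump \<open>c k - c (Suc k)\<close> sits at
    the end \<open>t (Suc k) = ts ! k\<close> of arc \<open>k\<close>.\<close>
  define t where "t = (\<lambda>k. (0 # ts) ! k)"
  define f where "f = poisson_integral (step_fun t cs)"
  define js where "js = jumps (cs @ [hd cs]) ts"
  have len: "length ts = ?n" "length (cs @ [hd cs]) = Suc (length ts)" and sorted: "sorted_wrt (<) (0 # ts)"
    and nz: "\<And>z. norm z \<le> 1 \<Longrightarrow> res_poly js z \<noteq> 0"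
    using adm by (auto simp: admissible_def js_def)
  have t0: "t 0 = 0" by (simp add: t_def)
  have tn: "t ?n = 2 * pi" 
  proof -
    obtain m where m: "?n = Suc m" using cs by (cases cs) auto
    then have "ts \<noteq> []" using len(1) by auto
    then show ?thesis using last_conv_nth[of ts] last len(1) m by (simp add: t_def)
  qed
  have tk: "t k < t (Suc k)" if "k < ?n" for k
    unfolding t_def using sorted_wrt_nth_less[OF sorted, of k "Suc k"] that len by simp
  have c: "c ?n = c 0" "\<And>k. k < ?n \<Longrightarrow> c k = cs ! k"
    using cs by (auto simp: c_def nth_append hd_conv_nth)
  have f_eq: "f z = (\<Sum>k<?n. of_real (arc_measure (t k) (t (Suc k)) z) * c k)" if "norm z < 1" for z
    using poisson_integral_step_fun[OF that t0 tn tk] by (simp add: f_def c(2))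
  define A where "A = (\<lambda>z. \<Sum>k<?n. (c k - c (Suc k)) / (z - cis (t (Suc k))))"
  define B where "B = (\<lambda>z. \<Sum>k<?n. cnj (c k - c (Suc k)) / (z - cis (t (Suc k))))"
  have ne: "z \<noteq> cis s" if "norm z < 1" for z s using that by (metis norm_cis less_irrefl)
  have nodes: "norm \<zeta> = 1" if "(\<zeta>, d) \<in> set js" for \<zeta> d
    using that len by (auto simp: in_set_conv_nth js_def length_jumps nth_jumps)
  have ts_t: "ts ! k = t (Suc k)" for k by (simp add: t_def)
  have A_eq: "A z = res_poly js z / node_poly js z" if "norm z < 1" for z
  proof -
    have "(\<Sum>(\<zeta>, d)\<leftarrow>js. d / (z - \<zeta>)) = A z"
      unfolding js_def sum_jumps[OF len(2)] using len by (simp add: A_def c_def ts_t)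
    moreover have "z \<noteq> \<zeta>" if "(\<zeta>, d) \<in> set js" for \<zeta> d using nodes[OF that] \<open>norm z < 1\<close> by auto
    ultimately show ?thesis using res_poly_divide_node_poly[of js z] by metis
  qed
  have B_eq: "B z = res_poly (cnj_jumps js) z / node_poly js z" if "norm z < 1" for z
  proof -
    have "(\<Sum>(\<zeta>, d)\<leftarrow>cnj_jumps js. d / (z - \<zeta>)) = (\<Sum>j\<leftarrow>js. cnj (snd j) / (z - fst j))"
      by (induction js) auto
    also have "\<dots> = B z"
      unfolding js_def sum_jumps[OF len(2)] using len by (simp add: B_def c_def ts_t)
    finally have "(\<Sum>(\<zeta>, d)\<leftarrow>cnj_jumps js. d / (z - \<zeta>)) = B z" .
    moreover have "z \<noteq> \<zeta>" if "(\<zeta>, d) \<in> set (cnj_jumps js)" for \<zeta> d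
      using nodes that \<open>norm z < 1\<close> by fastforce
    moreover have "node_poly (cnj_jumps js) z = node_poly js z" by (induction js) auto
    ultimately show ?thesis using res_poly_divide_node_poly[of "cnj_jumps js" z] by metis
  qed
  have "(\<Sum>j\<leftarrow>js. snd j) = 0"
    unfolding js_def using sum_list_jumps[OF len(2)] cs by (simp add: hd_append)
  then have less: "norm (B z) < norm (A z)" if z: "norm z < 1" for z
  proof -
    have "node_poly js z \<noteq> 0" using nodes z by (force simp: node_poly_eq_0_iff)
    moreover have "norm (res_poly (cnj_jumps js) z) < norm (res_poly js z)"
      using \<open>(\<Sum>j\<leftarrow>js. snd j) = 0\<close> nodes nz nonpar z
      by (intro norm_res_poly_cnj_jumps_less) (auto simp: js_def)
    ultimately show ?thesis
      unfolding A_eq[OF z] B_eq[OF z] by (simp add: norm_divide divide_strict_right_mono)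
  qed
  define P where "P = (\<lambda>z. A z / (2 * pi * \<i>))"
  define Q where "Q = (\<lambda>z. cnj (B z) / - (2 * pi * \<i>))"
  have der: "(f has_derivative (\<lambda>v. P z * v + Q z * cnj v)) (at z)" if z: "z \<in> ball 0 1" for z
  proof (rule has_derivative_transform_within_open[OF _ open_ball z])
    have "cis (t ?n) = cis (t 0)" by (simp add: tn t0 complex_eq_iff)
    then show "((\<lambda>z. \<Sum>k<?n. of_real (arc_measure (t k) (t (Suc k)) z) * c k) has_derivative (\<lambda>v. P z * v + Q z * cnj v)) (at z)"
      unfolding P_def Q_def A_def B_def using has_derivative_arc_measure_sum[of t ?n c z] c(1) z by simp
  qed (simp add: f_eq)
  have contAB: "continuous_on (ball 0 1) A" "continuous_on (ball 0 1) B"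
    unfolding A_def B_def using ne by (auto intro!: continuous_intros)
  have "inj_on f (ball 0 1) \<and> f ` ball 0 1 = inside (path_image p)"
  proof (rule local_homeomorphism_onto_inside[OF p])
    show "continuous_on (ball 0 1) f"
      using der has_derivative_continuous by (intro continuous_at_imp_continuous_on) blast
    show "bounded (f ` ball 0 1)"
      unfolding bounded_iff using norm_arc_measure_sum_le[OF t0 tn tk, of _ c]
      by (intro exI[of _ "\<Sum>k<?n. norm (c k)"]) (auto simp: f_eq)
    show "\<exists>U V g. open U \<and> x \<in> U \<and> U \<subseteq> ball 0 1 \<and> open V \<and> homeomorphism U V f g" if "x \<in> ball 0 1" for x
    proof (rule local_homeomorphism_complex[OF open_ball der _ _ _ that])
      show "continuous_on (ball 0 1) P" "continuous_on (ball 0 1) Q"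
        unfolding P_def Q_def by (intro continuous_intros contAB; simp)+
      show "norm (Q z) < norm (P z)" if "z \<in> ball 0 1" for z
        using less[of z] that by (simp add: P_def Q_def norm_divide norm_mult divide_strict_right_mono)
    qed auto
    fix X x y
    assume X: "\<And>n. X n \<in> ball 0 1" "X \<longlonglongrightarrow> x" "x \<notin> ball 0 1" "(\<lambda>n. f (X n)) \<longlonglongrightarrow> y"
    have "norm x \<le> 1"
      using X(1) by (intro LIMSEQ_le_const2[OF tendsto_norm[OF X(2)]]) (auto intro: less_imp_le)
    then have "norm x = 1" using X(3) by simp
    moreover have "(\<lambda>i. \<Sum>k<?n. of_real (arc_measure (t k) (t (Suc k)) (X i)) * c k) \<longlonglongrightarrow> y"
      using X(4) X(1) by (simp add: f_eq)
    ultimately obtain j where "j < ?n" "y \<in> closed_segment (c j) (c (Suc j))"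
      using arc_measure_sum_boundary[OF t0 tn tk n c(1), of X x y] X(1,2) by auto
    then show "y \<in> path_image p" using seg[of j] c(2) by (auto simp: c_def)
  qed auto
  moreover have "harmonic_on (ball 0 1) f"
    using f_eq by (rule harmonic_on_arc_measure_sum)
  ultimately show ?thesis
    using t0 tn tk unfolding f_def by (intro exI[of _ t]) auto
qed

section \<open>Polygonal paths\<close>

lemma pathstart_polypath [simp]: "xs \<noteq> [] \<Longrightarrow> pathstart (polypath xs) = hd xs"
  by (cases xs rule: polypath.cases) auto

lemma pathfinish_polypath [simp]: "xs \<noteq> [] \<Longrightarrow> pathfinish (polypath xs) = last xs"
  by (induction xs rule: polypath.induct) auto

lemma valid_path_polypath: "valid_path (polypath xs)"
proof (induction xs rule: polypath.induct)
  case 1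
  show ?case unfolding polypath.simps by (rule valid_path_linepath)
next
  case (2 a)
  show ?case unfolding polypath.simps by (rule valid_path_linepath)
qed auto

lemma path_polypath [simp]: "path (polypath xs)"
  by (simp add: valid_path_polypath valid_path_imp_path)

definition edges :: "complex list \<Rightarrow> (complex \<times> complex) set" where
  "edges xs = set (zip xs (tl xs))"

lemma edges_simps [simp]: "edges [] = {}" "edges [a] = {}" "edges (a # b # cs) = insert (a, b) (edges (b # cs))"
  by (auto simp: edges_def)

lemma edges_append: "edges (xs @ b # ys) = edges (xs @ [b]) \<union> edges (b # ys)"
proof (induction xs)
  case (Cons x xs)
  then show ?case by (cases xs) auto
qed simp

lemma edges_subset: "(p, q) \<in> edges xs \<Longrightarrow> p \<in> set xs \<and> q \<in> set xs"
  by (induction xs rule: polypath.induct) auto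

lemma path_image_polypath:
  "2 \<le> length xs \<Longrightarrow> path_image (polypath xs) = (\<Union>(p, q)\<in>edges xs. closed_segment p q)"
  by (induction xs rule: polypath.induct) (auto simp: path_image_join)

lemma path_image_polypath_append:
  assumes "xs \<noteq> []" "ys \<noteq> []"
  shows "path_image (polypath (xs @ b # ys)) = path_image (polypath (xs @ [b])) \<union> path_image (polypath (b # ys))"
proof -
  have l: "2 \<le> length (xs @ b # ys)" "2 \<le> length (xs @ [b])" "2 \<le> length (b # ys)"
    using assms by (cases xs; cases ys; simp)+
  show ?thesis
    unfolding path_image_polypath[OF l(1)] path_image_polypath[OF l(2)] path_image_polypath[OF l(3)]
    by (subst edges_append) blast
qed

lemma vertices_subset_path_image: "set xs \<subseteq> path_image (polypath xs)"
  by (induction xs rule: polypath.induct) (auto simp: path_image_join)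

lemma polypath_Cons: "2 \<le> length xs \<Longrightarrow> polypath (a # xs) = linepath a (hd xs) +++ polypath xs"
  by (cases xs rule: polypath.cases) auto

text \<open>\<open>polypath\<close> nests its joins to the right, so cutting at \<open>b\<close>
  yields a differently parametrised path. Being an arc is insensitive to this, hence an equivalence
  instead of an equation of paths.\<close>

lemma arc_polypath_append:
  assumes "xs \<noteq> []" "ys \<noteq> []"
  shows "arc (polypath (xs @ b # ys)) \<longleftrightarrow> arc (polypath (xs @ [b]) +++ polypath (b # ys))"
  using assms(1)
proof (induction xs)
  case (Cons a xs)
  show ?case
  proof (cases xs)
    case Nil
    then show ?thesis using assms(2) by (cases ys) auto
  next
    case (Cons a' xs')
    then have IH: "arc (polypath (xs @ b # ys)) \<longleftrightarrow> arc (polypath (xs @ [b]) +++ polypath (b # ys))"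
      using Cons.IH by simp
    have 1: "polypath ((a # xs) @ b # ys) = linepath a a' +++ polypath (xs @ b # ys)"
      "polypath ((a # xs) @ [b]) = linepath a a' +++ polypath (xs @ [b])"
      using Cons polypath_Cons[of "xs @ b # ys" a] polypath_Cons[of "xs @ [b]" a] by auto
    have 2: "path_image (polypath (xs @ b # ys)) = path_image (polypath (xs @ [b]) +++ polypath (b # ys))"
      using path_image_polypath_append[of xs ys b] Cons assms(2) by (simp add: path_image_join)
    have "arc (polypath ((a # xs) @ b # ys)) \<longleftrightarrow> arc (linepath a a' +++ (polypath (xs @ [b]) +++ polypath (b # ys)))"
    proof -
      have "arc (p +++ q) \<longleftrightarrow> arc (p +++ q')"
        if "pathfinish p = pathstart q" "pathstart q' = pathstart q" "path_image q = path_image q'" "arc q \<longleftrightarrow> arc q'"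
        for p q q' :: "real \<Rightarrow> complex"
        using that by (simp add: arc_join_eq)
      then show ?thesis unfolding 1 using Cons IH 2 by auto
    qed
    also have "\<dots> \<longleftrightarrow> arc ((linepath a a' +++ polypath (xs @ [b])) +++ polypath (b # ys))"
      by (rule arc_assoc) (use Cons in auto)
    finally show ?thesis using 1 by simp
  qed
qed simp

lemma arc_polypath_append_iff:
  assumes "xs \<noteq> []" "ys \<noteq> []"
  shows "arc (polypath (xs @ b # ys)) \<longleftrightarrow> arc (polypath (xs @ [b])) \<and> arc (polypath (b # ys)) \<and>
    path_image (polypath (xs @ [b])) \<inter> path_image (polypath (b # ys)) \<subseteq> {b}"
  unfolding arc_polypath_append[OF assms] by (subst arc_join_eq) auto

lemma simple_path_polypath_append_iff:
  assumes "xs \<noteq> []" "ys \<noteq> []" "last ys = hd xs"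
  shows "simple_path (polypath (xs @ b # ys)) \<longleftrightarrow> arc (polypath (xs @ [b])) \<and> arc (polypath (b # ys)) \<and>
    path_image (polypath (xs @ [b])) \<inter> path_image (polypath (b # ys)) \<subseteq> {hd xs, b}"
proof (cases "tl xs")
  case Nil
  then obtain a where a: "xs = [a]" using assms(1) by (cases xs) auto
  obtain y ys' where "ys = y # ys'" using assms(2) by (cases ys) auto
  then show ?thesis
    using assms(3) by (auto simp: a simple_path_join_loop_eq)
next
  case (Cons a' xs'')
  then obtain a xs' where xs: "xs = a # xs'" "xs' \<noteq> []" using assms(1) by (cases xs) auto
  let ?p = "linepath a (hd xs')"
  have 1: "polypath (xs @ b # ys) = ?p +++ polypath (xs' @ b # ys)" "polypath (xs @ [b]) = ?p +++ polypath (xs' @ [b])"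
    using xs polypath_Cons[of "xs' @ b # ys" a] polypath_Cons[of "xs' @ [b]" a] by (auto simp: Suc_le_eq)
  have im: "path_image (polypath (xs' @ b # ys)) = path_image (polypath (xs' @ [b])) \<union> path_image (polypath (b # ys))"
    using xs assms by (intro path_image_polypath_append)
  have "simple_path (polypath (xs @ b # ys)) \<longleftrightarrow> arc ?p \<and> arc (polypath (xs' @ b # ys)) \<and>
     path_image ?p \<inter> path_image (polypath (xs' @ b # ys)) \<subseteq> {a, hd xs'}"
    unfolding 1 using xs assms by (subst simple_path_join_loop_eq) auto
  \<comment> \<open>The loop criterion sees its second path only through its image, its ends and
    whether it is an arc, so the right-nested path may be replaced by the cut one and then
    regrouped.\<close>
  also have "\<dots> \<longleftrightarrow> simple_path (?p +++ (polypath (xs' @ [b]) +++ polypath (b # ys)))"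
    using xs assms im by (subst simple_path_join_loop_eq) (auto simp: arc_polypath_append path_image_join)
  also have "\<dots> \<longleftrightarrow> simple_path ((?p +++ polypath (xs' @ [b])) +++ polypath (b # ys))"
    using xs by (intro simple_path_assoc) auto
  also have "\<dots> \<longleftrightarrow> arc (polypath (xs @ [b])) \<and> arc (polypath (b # ys)) \<and>
    path_image (polypath (xs @ [b])) \<inter> path_image (polypath (b # ys)) \<subseteq> {hd xs, b}"
    unfolding 1(2)[symmetric] using assms by (subst simple_path_join_loop_eq) auto
  finally show ?thesis .
qed

lemma winding_number_polypath_append:
  assumes "xs \<noteq> []" "ys \<noteq> []" "z \<notin> path_image (polypath (xs @ b # ys))"
  shows "winding_number (polypath (xs @ b # ys)) z =
    winding_number (polypath (xs @ [b])) z + winding_number (polypath (b # ys)) z"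
  using assms(1,3)
proof (induction xs)
  case (Cons a xs)
  show ?case
  proof (cases xs)
    case Nil
    obtain y ys' where "ys = y # ys'" using assms(2) by (cases ys) auto
    then show ?thesis
      using Nil Cons.prems by (auto simp: path_image_join intro!: winding_number_join)
  next
    case (Cons a' xs')
    have 1: "polypath ((a # xs) @ b # ys) = linepath a a' +++ polypath (xs @ b # ys)"
      "polypath ((a # xs) @ [b]) = linepath a a' +++ polypath (xs @ [b])"
      using Cons polypath_Cons[of "xs @ b # ys" a] polypath_Cons[of "xs @ [b]" a] by auto
    have z: "z \<notin> path_image (linepath a a')" "z \<notin> path_image (polypath (xs @ b # ys))"
      using Cons.prems(2) Cons unfolding 1 by (auto simp: path_image_join)
    have z2: "z \<notin> path_image (polypath (xs @ [b]))"
      using z(2) path_image_polypath_append[of xs ys b] Cons assms(2) by auto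
    have IH: "winding_number (polypath (xs @ b # ys)) z = winding_number (polypath (xs @ [b])) z + winding_number (polypath (b # ys)) z"
      using Cons.IH Cons z by simp
    show ?thesis
      unfolding 1 using Cons z z2 IH by (subst winding_number_join; simp)+
  qed
qed simp

text \<open>Cut the list at \<open>p\<close> and at \<open>q\<close>: any other vertex lies on one
  of the two remaining pieces, and these meet the edge at most in \<open>p\<close> or in
  \<open>q\<close>.\<close>

lemma arc_polypath_vertex_on_edge:
  assumes "arc (polypath xs)" "(p, q) \<in> edges xs" "c \<in> set xs" "c \<in> closed_segment p q"
  shows "c = p \<or> c = q"
proof -
  have "\<exists>X Y. xs = X @ p # q # Y"
    using assms(2)
  proof (induction xs rule: polypath.induct)
    case (4 a b c cs)
    then show ?case
    proof (cases "(p, q) = (a, b)")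
      case True
      then show ?thesis by (intro exI[of _ "[]"] exI[of _ "c # cs"]) auto
    next
      case False
      then obtain X Y where "b # c # cs = X @ p # q # Y" using 4 by auto
      then show ?thesis by (intro exI[of _ "a # X"] exI[of _ Y]) auto
    qed
  qed (auto intro: exI[of _ "[]"])
  then obtain X Y where xs: "xs = X @ p # q # Y" by blast
  have pq: "closed_segment p q \<subseteq> path_image (polypath (p # q # Y))" "arc (polypath (p # q # Y)) \<Longrightarrow> Y \<noteq> [] \<Longrightarrow>
     closed_segment p q \<inter> path_image (polypath (q # Y)) \<subseteq> {q}"
    using arc_polypath_append_iff[of "[p]" Y q] path_image_polypath_append[of "[p]" Y q] by (cases Y; auto)+
  have arc: "arc (polypath (p # q # Y))"
    using assms(1) arc_polypath_append_iff[of X "q # Y" p] by (cases X) (auto simp: xs)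
  consider "c \<in> set X" | "c = p \<or> c = q" | "c \<in> set Y" using assms(3) xs by auto
  then show ?thesis
  proof cases
    case 1
    then have "X \<noteq> []" by auto
    then have "path_image (polypath (X @ [p])) \<inter> path_image (polypath (p # q # Y)) \<subseteq> {p}"
      using assms(1) arc_polypath_append_iff[of X "q # Y" p] by (simp add: xs)
    moreover have "c \<in> path_image (polypath (X @ [p]))" using vertices_subset_path_image[of "X @ [p]"] 1 by auto
    ultimately show ?thesis using pq(1) assms(4) by blast
  next
    case 3
    then have "c \<in> path_image (polypath (q # Y))" "Y \<noteq> []" using vertices_subset_path_image[of "q # Y"] by auto
    then show ?thesis using pq(2)[OF arc] assms(4) by blast
  qed
qed

text \<open>The cut runs through the first vertex of each part, so that both pieces are treated
  alike. Rotation becomes the symmetry of these formulas, and a diagonal between the two heads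
  replaces one piece by a segment.\<close>

lemma closed_polygon_append:
  assumes "xs \<noteq> []" "ys \<noteq> []"
  shows "path_image (closed_polygon (xs @ ys)) = path_image (polypath (xs @ [hd ys])) \<union> path_image (polypath (ys @ [hd xs]))"
    and "simple_path (closed_polygon (xs @ ys)) \<longleftrightarrow> arc (polypath (xs @ [hd ys])) \<and> arc (polypath (ys @ [hd xs])) \<and>
      path_image (polypath (xs @ [hd ys])) \<inter> path_image (polypath (ys @ [hd xs])) \<subseteq> {hd xs, hd ys}"
    and "z \<notin> path_image (closed_polygon (xs @ ys)) \<Longrightarrow> winding_number (closed_polygon (xs @ ys)) z =
      winding_number (polypath (xs @ [hd ys])) z + winding_number (polypath (ys @ [hd xs])) z"
proof -
  have eq: "closed_polygon (xs @ ys) = polypath (xs @ hd ys # (tl ys @ [hd xs]))"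
    and ys: "ys @ [hd xs] = hd ys # (tl ys @ [hd xs])"
    using assms by (cases ys; auto simp: closed_polygon_def)+
  show "path_image (closed_polygon (xs @ ys)) = path_image (polypath (xs @ [hd ys])) \<union> path_image (polypath (ys @ [hd xs]))"
    unfolding eq ys using assms by (intro path_image_polypath_append) auto
  show "simple_path (closed_polygon (xs @ ys)) \<longleftrightarrow> arc (polypath (xs @ [hd ys])) \<and> arc (polypath (ys @ [hd xs])) \<and>
      path_image (polypath (xs @ [hd ys])) \<inter> path_image (polypath (ys @ [hd xs])) \<subseteq> {hd xs, hd ys}"
    unfolding eq ys using assms by (intro simple_path_polypath_append_iff) auto
  show "winding_number (closed_polygon (xs @ ys)) z =
      winding_number (polypath (xs @ [hd ys])) z + winding_number (polypath (ys @ [hd xs])) z"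
    if "z \<notin> path_image (closed_polygon (xs @ ys))"
    using that unfolding eq ys using assms by (intro winding_number_polypath_append) auto
qed

section \<open>Oriented polygons and cutting along a diagonal\<close>

lemma closed_polygon_loop: "cs \<noteq> [] \<Longrightarrow> pathfinish (closed_polygon cs) = pathstart (closed_polygon cs)"
  by (simp add: closed_polygon_def)

text \<open>Orientation is recorded by the winding number because that is additive under cutting and
  so passes to the two parts; a pointwise left-side condition would have to be re-established along
  each diagonal.\<close>

definition pos_polygon :: "complex list \<Rightarrow> bool" where
  "pos_polygon cs \<longleftrightarrow> 3 \<le> length cs \<and> distinct cs \<and> simple_path (closed_polygon cs) \<and>
     (\<forall>z\<in>inside (path_image (closed_polygon cs)). winding_number (closed_polygon cs) z = 1)"

lemma pos_polygon_rotate: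
  assumes "pos_polygon (xs @ ys)"
  shows "path_image (closed_polygon (ys @ xs)) = path_image (closed_polygon (xs @ ys))" "pos_polygon (ys @ xs)"
proof -
  have "path_image (closed_polygon (ys @ xs)) = path_image (closed_polygon (xs @ ys)) \<and> pos_polygon (ys @ xs)"
  proof (cases "xs = [] \<or> ys = []")
    case True
    then show ?thesis using assms by auto
  next
    case False
    then have ne: "xs \<noteq> []" "ys \<noteq> []" by auto
    have im: "path_image (closed_polygon (ys @ xs)) = path_image (closed_polygon (xs @ ys))"
      using closed_polygon_append(1)[OF ne] closed_polygon_append(1)[OF ne(2,1)] by auto
    moreover have "simple_path (closed_polygon (ys @ xs))"
      using assms closed_polygon_append(2)[OF ne] closed_polygon_append(2)[OF ne(2,1)] by (auto simp: pos_polygon_def)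
    moreover have "winding_number (closed_polygon (ys @ xs)) z = 1" if "z \<in> inside (path_image (closed_polygon (ys @ xs)))" for z
    proof -
      have "z \<notin> path_image (closed_polygon (ys @ xs))" using that inside_no_overlap by blast
      then show ?thesis
        using assms that closed_polygon_append(3)[OF ne, of z] closed_polygon_append(3)[OF ne(2,1), of z] im
        by (auto simp: pos_polygon_def add.commute)
    qed
    ultimately show ?thesis using assms by (auto simp: pos_polygon_def)
  qed
  then show "path_image (closed_polygon (ys @ xs)) = path_image (closed_polygon (xs @ ys))" "pos_polygon (ys @ xs)"
    by auto
qed

text \<open>The two parts run through the diagonal in opposite directions, so their winding numbers
  add up to that of the whole polygon, which is 1 inside. A point inside one part is outside the
  other, whose winding number there is 0, so the first part carries all of the 1.\<close>

lemma pos_polygon_split: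
  assumes pos: "pos_polygon (xs @ ys)" and len: "2 \<le> length xs" "2 \<le> length ys"
    and diag: "open_segment (hd xs) (hd ys) \<subseteq> inside (path_image (closed_polygon (xs @ ys)))"
  shows "pos_polygon (xs @ [hd ys])" "pos_polygon (ys @ [hd xs])"
proof -
  have ne: "xs \<noteq> []" "ys \<noteq> []" using len by auto
  define p q where "p = hd xs" and "q = hd ys"
  have pq: "p \<in> set xs" "q \<in> set ys" "p \<noteq> q"
  proof -
    show "p \<in> set xs" "q \<in> set ys" using ne by (auto simp: p_def q_def)
    then show "p \<noteq> q" using pos by (auto simp: pos_polygon_def)
  qed
  define P1 where "P1 = polypath (xs @ [q])"
  define P2 where "P2 = polypath (ys @ [p])"
  let ?K = "path_image (closed_polygon (xs @ ys))"
  let ?S = "closed_segment p q"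
  have K: "?K = path_image P1 \<union> path_image P2"
    unfolding P1_def P2_def p_def q_def using closed_polygon_append(1)[OF ne] .
  have arcs: "arc P1" "arc P2" "path_image P1 \<inter> path_image P2 \<subseteq> {p, q}"
    using pos closed_polygon_append(2)[OF ne] by (auto simp: pos_polygon_def P1_def P2_def p_def q_def)
  have ends: "pathstart P1 = p" "pathfinish P1 = q" "pathstart P2 = q" "pathfinish P2 = p"
    using ne by (simp_all add: P1_def P2_def p_def q_def)
  have endpts: "p \<in> path_image P1" "q \<in> path_image P1" "p \<in> path_image P2" "q \<in> path_image P2"
    using ends pathstart_in_path_image[of P1] pathfinish_in_path_image[of P1]
      pathstart_in_path_image[of P2] pathfinish_in_path_image[of P2] by auto
  have SK: "?S \<inter> ?K = {p, q}"
  proof -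
    have "?S = open_segment p q \<union> {p, q}" by (auto simp: closed_segment_eq_open)
    moreover have "open_segment p q \<inter> ?K = {}" using diag inside_no_overlap p_def q_def by blast
    ultimately show ?thesis using endpts K by blast
  qed
  obtain m where "m \<in> open_segment p q" using pq(3) by (metis ex_in_conv open_segment_eq_empty)
  then have m: "m \<in> ?S" "m \<in> inside ?K" using diag segment_open_subset_closed p_def q_def by blast+
  have inter: "path_image P1 \<inter> path_image P2 = {p, q}" "path_image P1 \<inter> ?S = {p, q}" "path_image P2 \<inter> ?S = {p, q}"
    using arcs(3) endpts SK K by auto
  \<comment> \<open>The theta-curve theorem: the diagonal divides the inside into the insides of the
    two parts. \<open>P2\<close> is reversed because all three paths have to run from
    \<open>p\<close> to \<open>q\<close>.\<close>
  obtain disj: "inside (path_image P1 \<union> ?S) \<inter> inside (path_image P2 \<union> ?S) = {}"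
    and un: "inside (path_image P1 \<union> ?S) \<union> inside (path_image P2 \<union> ?S) \<union> (?S - {p, q}) = inside ?K"
  proof (rule split_inside_simple_closed_curve[of P1 p q "reversepath P2" "linepath p q"])
    show "simple_path P1" "simple_path (reversepath P2)" "simple_path (linepath p q)"
      using arcs pq(3) by (auto simp: arc_imp_simple_path simple_path_reversepath)
    show "path_image (linepath p q) \<inter> inside (path_image P1 \<union> path_image (reversepath P2)) \<noteq> {}"
      using m K by auto
  qed (use ends pq(3) inter K in auto)
  have one: "path_image (closed_polygon (xs @ [q])) = path_image P1 \<union> ?S"
    "simple_path (closed_polygon (xs @ [q]))"
    "z \<notin> path_image P1 \<union> ?S \<Longrightarrow> winding_number (closed_polygon (xs @ [q])) z = winding_number P1 z + winding_number (linepath q p) z" for z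
    using closed_polygon_append(1,2)[of xs "[q]"] closed_polygon_append(3)[of xs "[q]" z] ne arcs inter pq(3)
    by (auto simp: P1_def p_def closed_segment_commute)
  have two: "path_image (closed_polygon (ys @ [p])) = path_image P2 \<union> ?S"
    "simple_path (closed_polygon (ys @ [p]))"
    "z \<notin> path_image P2 \<union> ?S \<Longrightarrow> winding_number (closed_polygon (ys @ [p])) z = winding_number P2 z + winding_number (linepath p q) z" for z
    using closed_polygon_append(1,2)[of ys "[p]"] closed_polygon_append(3)[of ys "[p]" z] ne arcs inter pq(3)
    by (auto simp: P2_def q_def)
  have rev: "winding_number (linepath q p) z = - winding_number (linepath p q) z" if "z \<notin> ?S" for z
    using winding_number_reversepath[of "linepath p q" z] that by simp
  have tot: "winding_number P1 z + winding_number P2 z = 1" if "z \<in> inside ?K" for z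
  proof -
    have "z \<notin> ?K" using that inside_no_overlap by blast
    then show ?thesis
      using pos that closed_polygon_append(3)[OF ne, of z] by (auto simp: pos_polygon_def P1_def P2_def p_def q_def)
  qed
  have zero1: "winding_number (closed_polygon (xs @ [q])) z = 0" if "z \<in> outside (path_image P1 \<union> ?S)" for z
    using that one(1,2) closed_polygon_loop[of "xs @ [q]"] winding_number_zero_in_outside[of "closed_polygon (xs @ [q])" z]
    by (simp add: simple_path_imp_path)
  have zero2: "winding_number (closed_polygon (ys @ [p])) z = 0" if "z \<in> outside (path_image P2 \<union> ?S)" for z
    using that two(1,2) closed_polygon_loop[of "ys @ [p]"] winding_number_zero_in_outside[of "closed_polygon (ys @ [p])" z]
    by (simp add: simple_path_imp_path)
  have io: "z \<in> inside A \<or> z \<in> outside A \<or> z \<in> A" for z and A :: "complex set"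
    using inside_Un_outside[of A] by blast
  have "winding_number (closed_polygon (xs @ [q])) z = 1" if z: "z \<in> inside (path_image P1 \<union> ?S)" for z
  proof -
    have zi: "z \<in> inside ?K" "z \<notin> inside (path_image P2 \<union> ?S)" using z un disj by auto
    have zn: "z \<notin> path_image P1 \<union> ?S" "z \<notin> ?K" using z zi(1) inside_no_overlap by blast+
    then have "z \<notin> path_image P2 \<union> ?S" using K by blast
    moreover from this have "winding_number (closed_polygon (ys @ [p])) z = 0"
      using io[of z "path_image P2 \<union> ?S"] zi(2) zero2 by blast
    ultimately show ?thesis
      using one(3)[OF zn(1)] two(3)[of z] rev[of z] tot[OF zi(1)] zn(1) by (simp add: add_eq_0_iff2)
  qed
  moreover have "winding_number (closed_polygon (ys @ [p])) z = 1" if z: "z \<in> inside (path_image P2 \<union> ?S)" for z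
  proof -
    have zi: "z \<in> inside ?K" "z \<notin> inside (path_image P1 \<union> ?S)" using z un disj by auto
    have zn: "z \<notin> path_image P2 \<union> ?S" "z \<notin> ?K" using z zi(1) inside_no_overlap by blast+
    then have "z \<notin> path_image P1 \<union> ?S" using K by blast
    moreover from this have "winding_number (closed_polygon (xs @ [q])) z = 0"
      using io[of z "path_image P1 \<union> ?S"] zi(2) zero1 by blast
    ultimately show ?thesis
      using two(3)[OF zn(1)] one(3)[of z] rev[of z] tot[OF zi(1)] zn(1) by (simp add: algebra_simps)
  qed
  moreover have "distinct (xs @ [q])" "distinct (ys @ [p])"
    using pos pq by (auto simp: pos_polygon_def)
  ultimately have "pos_polygon (xs @ [q])" "pos_polygon (ys @ [p])"
    using one(1,2) two(1,2) len by (auto simp: pos_polygon_def)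
  then show "pos_polygon (xs @ [hd ys])" "pos_polygon (ys @ [hd xs])"
    by (simp_all add: p_def q_def)
qed

section \<open>Diagonals of simple polygons\<close>

text \<open>Cramer's rule for the basis \<open>u - v\<close>, \<open>w - v\<close>; here
  \<open>Im (cnj x * y)\<close> is the determinant of \<open>x\<close> and \<open>y\<close>.\<close>

lemma affine_coordinates:
  fixes u v w :: complex
  assumes "Im (cnj (u - v) * (w - v)) \<noteq> 0"
  obtains \<alpha> \<beta> :: "complex \<Rightarrow> real"
  where "\<And>z. z = v + \<alpha> z *\<^sub>R (u - v) + \<beta> z *\<^sub>R (w - v)"
    and "\<And>a b. \<alpha> (v + a *\<^sub>R (u - v) + b *\<^sub>R (w - v)) = a"
    and "\<And>a b. \<beta> (v + a *\<^sub>R (u - v) + b *\<^sub>R (w - v)) = b"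
    and "\<And>p q s. \<alpha> ((1 - s) *\<^sub>R p + s *\<^sub>R q) = (1 - s) * \<alpha> p + s * \<alpha> q"
    and "\<And>p q s. \<beta> ((1 - s) *\<^sub>R p + s *\<^sub>R q) = (1 - s) * \<beta> p + s * \<beta> q"
    and "continuous_on UNIV \<alpha>" and "continuous_on UNIV \<beta>"
proof -
  define D where "D = Im (cnj (u - v) * (w - v))"
  define \<alpha> where "\<alpha> = (\<lambda>z. Im (cnj (z - v) * (w - v)) / D)"
  define \<beta> where "\<beta> = (\<lambda>z. Im (cnj (u - v) * (z - v)) / D)"
  have D: "D \<noteq> 0" using assms by (simp add: D_def)
  have 2: "\<alpha> (v + a *\<^sub>R (u - v) + b *\<^sub>R (w - v)) = a" "\<beta> (v + a *\<^sub>R (u - v) + b *\<^sub>R (w - v)) = b" for a b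
  proof -
    have "Im (cnj (v + a *\<^sub>R (u - v) + b *\<^sub>R (w - v) - v) * (w - v)) = a * D"
      "Im (cnj (u - v) * (v + a *\<^sub>R (u - v) + b *\<^sub>R (w - v) - v)) = b * D"
      by (simp_all add: D_def algebra_simps)
    then show "\<alpha> (v + a *\<^sub>R (u - v) + b *\<^sub>R (w - v)) = a" "\<beta> (v + a *\<^sub>R (u - v) + b *\<^sub>R (w - v)) = b"
      unfolding \<alpha>_def \<beta>_def using D by (metis nonzero_mult_div_cancel_right)+
  qed
  have 1: "z = v + \<alpha> z *\<^sub>R (u - v) + \<beta> z *\<^sub>R (w - v)" for z
  proof -
    have "D *\<^sub>R (z - v) = Im (cnj (z - v) * (w - v)) *\<^sub>R (u - v) + Im (cnj (u - v) * (z - v)) *\<^sub>R (w - v)"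
      by (simp add: D_def complex_eq_iff algebra_simps)
    then have "(1 / D) *\<^sub>R (D *\<^sub>R (z - v)) = (1 / D) *\<^sub>R (Im (cnj (z - v) * (w - v)) *\<^sub>R (u - v) + Im (cnj (u - v) * (z - v)) *\<^sub>R (w - v))"
      by (rule arg_cong)
    then have "z - v = \<alpha> z *\<^sub>R (u - v) + \<beta> z *\<^sub>R (w - v)"
      using D by (simp add: \<alpha>_def \<beta>_def scaleR_add_right)
    then show ?thesis by (simp add: algebra_simps)
  qed
  show ?thesis
  proof (rule that[of \<alpha> \<beta>])
    show "\<alpha> ((1 - s) *\<^sub>R p + s *\<^sub>R q) = (1 - s) * \<alpha> p + s * \<alpha> q" for p q s
      using D by (simp add: \<alpha>_def field_simps)
    show "\<beta> ((1 - s) *\<^sub>R p + s *\<^sub>R q) = (1 - s) * \<beta> p + s * \<beta> q" for p q s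
      using D by (simp add: \<beta>_def field_simps)
    show "continuous_on UNIV \<alpha>" "continuous_on UNIV \<beta>"
      unfolding \<alpha>_def \<beta>_def using D by (auto intro!: continuous_intros)
  qed (use 1 2 in auto)
qed

text \<open>At a point \<open>v\<close> of largest modulus, the line through \<open>v\<close>
  perpendicular to the vector \<open>v\<close> is a strict support line.\<close>

lemma Re_cnj_diff_neg:
  fixes v c :: complex
  assumes "norm c \<le> norm v" "c \<noteq> v"
  shows "Re (cnj v * (c - v)) < 0"
proof -
  have "(norm c)\<^sup>2 = (norm v)\<^sup>2 + 2 * Re (cnj v * (c - v)) + (norm (c - v))\<^sup>2"
    unfolding cmod_power2 by (simp add: power2_eq_square algebra_simps)
  moreover have "(norm c)\<^sup>2 \<le> (norm v)\<^sup>2" using assms(1) by (simp add: power_mono)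
  moreover have "(norm (c - v))\<^sup>2 > 0" using assms(2) by simp
  ultimately show ?thesis by linarith
qed

text \<open>If the edges at \<open>v\<close> were collinear, then
  \<open>w - v = l *\<^sub>R (u - v)\<close> with \<open>l > 0\<close>, because \<open>u\<close> and
  \<open>w\<close> lie strictly on the same side of the support line at \<open>v\<close>. The end of
  the shorter edge would then lie on the longer one, against \<open>inter\<close>.\<close>

lemma corner_not_collinear:
  fixes u v w :: complex
  assumes "norm u \<le> norm v" "norm w \<le> norm v" "u \<noteq> v" "w \<noteq> v"
    and inter: "closed_segment v w \<inter> closed_segment u v \<subseteq> {v}"
  shows "Im (cnj (u - v) * (w - v)) \<noteq> 0"
proof
  assume im: "Im (cnj (u - v) * (w - v)) = 0"
  define l where "l = Re (cnj (u - v) * (w - v)) / (norm (u - v))\<^sup>2"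
  have "cnj (u - v) * (w - v) = of_real (l * (norm (u - v))\<^sup>2)"
    using im \<open>u \<noteq> v\<close> by (simp add: l_def complex_eq_iff)
  also have "\<dots> = cnj (u - v) * (l *\<^sub>R (u - v))"
    using complex_norm_square[of "u - v"] by (simp add: scaleR_conv_of_real)
  finally have "cnj (u - v) * (w - v) = cnj (u - v) * (l *\<^sub>R (u - v))" .
  moreover have "cnj (u - v) \<noteq> 0" using \<open>u \<noteq> v\<close> by simp
  ultimately have wv: "w - v = l *\<^sub>R (u - v)" using mult_left_cancel by blast
  have "Re (cnj v * (w - v)) = l * Re (cnj v * (u - v))"
    unfolding wv by (simp add: algebra_simps)
  then have "l > 0"
    using Re_cnj_diff_neg[OF assms(1,3)] Re_cnj_diff_neg[OF assms(2,4)] by (metis mult_less_0_iff less_asym)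
  show False
  proof (cases "l \<le> 1")
    case True
    have "w = (1 - (1 - l)) *\<^sub>R u + (1 - l) *\<^sub>R v"
      using wv by (simp add: algebra_simps)
    then have "w \<in> closed_segment u v"
      using True \<open>l > 0\<close> unfolding closed_segment_def by (intro CollectI exI[of _ "1 - l"]) auto
    then show False using inter \<open>w \<noteq> v\<close> by auto
  next
    case False
    have "u - v = (1 / l) *\<^sub>R (w - v)" using wv \<open>l > 0\<close> by simp
    then have "u = (1 - 1 / l) *\<^sub>R v + (1 / l) *\<^sub>R w"
      by (simp add: algebra_simps)
    then have "u \<in> closed_segment v w"
      using False unfolding closed_segment_def by (intro CollectI exI[of _ "1 / l"]) auto
    then show False using inter \<open>u \<noteq> v\<close> by auto
  qed
qed

lemma connected_subset_inside:
  fixes K :: "complex set"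
  assumes "connected S" "S \<inter> K = {}" "S \<inter> inside K \<noteq> {}" "closed K"
  shows "S \<subseteq> inside K"
proof -
  have "S \<subseteq> inside K \<union> outside K" using assms(2) inside_Un_outside[of K] by blast
  moreover have "inside K \<inter> outside K = {}" by (rule inside_Int_outside)
  ultimately have "outside K \<inter> S = {}"
    using connectedD[OF assms(1) open_inside[OF assms(4)] open_outside[OF assms(4)]] assms(3) by blast
  then show ?thesis using \<open>S \<subseteq> inside K \<union> outside K\<close> by blast
qed

text \<open>Here \<open>v\<close> is a vertex of largest modulus, \<open>u\<close> and
  \<open>w\<close> are its neighbours and \<open>R\<close> is the rest of the curve. A line parallel
  to \<open>u w\<close> sweeps the triangle from \<open>v\<close> towards \<open>u w\<close>. Either
  it meets a first vertex \<open>x\<close>, and \<open>v x\<close> is a diagonal, or it meets none,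
  and \<open>u w\<close> is one. The region \<open>W\<close> swept before that avoids the curve and
  contains inside points near \<open>v\<close>, so it lies inside.\<close>

lemma corner_diagonal:
  fixes u v w :: complex and R K :: "complex set"
  assumes R: "R = (\<Union>(p, q)\<in>Es. closed_segment p q)" "compact R"
    and Es: "\<And>p q. (p, q) \<in> Es \<Longrightarrow> p \<in> insert u (insert w Vs) \<and> q \<in> insert u (insert w Vs)"
    and Vs: "finite Vs" "Vs \<subseteq> R" "u \<notin> Vs" "w \<notin> Vs"
    and neq: "u \<noteq> v" "w \<noteq> v" "v \<notin> R"
    and vw: "closed_segment v w \<inter> R \<subseteq> {w}" and uv: "closed_segment u v \<inter> R \<subseteq> {u}"
    and vwu: "closed_segment v w \<inter> closed_segment u v \<subseteq> {v}"
    and norms: "\<And>c. c \<in> insert u (insert w Vs) \<Longrightarrow> norm c \<le> norm v"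
    and K: "K = closed_segment v w \<union> closed_segment u v \<union> R"
    and fr: "frontier (inside K) = K"
    and onu: "\<And>p q. (p, q) \<in> Es \<Longrightarrow> u \<in> closed_segment p q \<Longrightarrow> u = p \<or> u = q"
    and onw: "\<And>p q. (p, q) \<in> Es \<Longrightarrow> w \<in> closed_segment p q \<Longrightarrow> w = p \<or> w = q"
    and nuw: "(u, w) \<notin> Es" "(w, u) \<notin> Es"
  shows "open_segment u w \<subseteq> inside K \<or> (\<exists>x\<in>Vs. open_segment v x \<subseteq> inside K)"
proof -
  have clK: "closed K" unfolding K using compact_imp_closed[OF R(2)] by (intro closed_Un closed_segment)
  obtain \<alpha> \<beta> where co: "\<And>z. z = v + \<alpha> z *\<^sub>R (u - v) + \<beta> z *\<^sub>R (w - v)"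
    and \<alpha>: "\<And>a b. \<alpha> (v + a *\<^sub>R (u - v) + b *\<^sub>R (w - v)) = a"
    and \<beta>: "\<And>a b. \<beta> (v + a *\<^sub>R (u - v) + b *\<^sub>R (w - v)) = b"
    and \<alpha>_aff: "\<And>p q s. \<alpha> ((1 - s) *\<^sub>R p + s *\<^sub>R q) = (1 - s) * \<alpha> p + s * \<alpha> q"
    and \<beta>_aff: "\<And>p q s. \<beta> ((1 - s) *\<^sub>R p + s *\<^sub>R q) = (1 - s) * \<beta> p + s * \<beta> q"
    and cont: "continuous_on UNIV \<alpha>" "continuous_on UNIV \<beta>"
    using affine_coordinates[OF corner_not_collinear[of u v w]] norms neq vwu by blast
  \<comment> \<open>The height of the sweep line: 0 at \<open>v\<close> and 1 on the line through
    \<open>u\<close> and \<open>w\<close>.\<close>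
  define h where "h = (\<lambda>z. \<alpha> z + \<beta> z)"
  have h_aff: "h ((1 - s) *\<^sub>R p + s *\<^sub>R q) = (1 - s) * h p + s * h q" for p q s
    unfolding h_def \<alpha>_aff \<beta>_aff by (simp add: algebra_simps)
  have vals: "\<alpha> v = 0" "\<beta> v = 0" "\<alpha> u = 1" "\<beta> u = 0" "\<alpha> w = 0" "\<beta> w = 1" "h u = 1" "h w = 1" "h v = 0"
    using \<alpha>[of 0 0] \<beta>[of 0 0] \<alpha>[of 1 0] \<beta>[of 1 0] \<alpha>[of 0 1] \<beta>[of 0 1] by (auto simp: h_def)
  have on_vw: "z \<in> closed_segment v w" if "\<alpha> z = 0" "0 \<le> \<beta> z" "\<beta> z \<le> 1" for z
    using co[of z] that unfolding closed_segment_def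
    by (intro CollectI exI[of _ "\<beta> z"]) (auto simp: algebra_simps)
  have on_uv: "z \<in> closed_segment u v" if "\<beta> z = 0" "0 \<le> \<alpha> z" "\<alpha> z \<le> 1" for z
    using co[of z] that unfolding closed_segment_def
    by (intro CollectI exI[of _ "1 - \<alpha> z"]) (auto simp: algebra_simps)
  have off_vw: "\<alpha> z = 0" if "z \<in> closed_segment v w" for z
    using that unfolding closed_segment_def by (auto simp: \<alpha>_aff vals)
  have off_uv: "\<beta> z = 0" if "z \<in> closed_segment u v" for z
    using that unfolding closed_segment_def by (auto simp: \<beta>_aff vals)
  text \<open>An edge of \<open>R\<close> leaving the wedge would have to cross one of the two edges at \<open>v\<close>.\<close>
  have exit: "\<exists>y'\<in>closed_segment y p. (y' = u \<or> y' = w) \<and> (h p < h y \<longrightarrow> y' = y)"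
    if seg: "closed_segment y p \<subseteq> R" and y: "0 \<le> \<alpha> y" "0 \<le> \<beta> y" "h y \<le> 1" and p: "h p \<le> h y" "\<alpha> p < 0 \<or> \<beta> p < 0"
    for y p
  proof -
    define g where "g = (\<lambda>s. min (\<alpha> ((1 - s) *\<^sub>R y + s *\<^sub>R p)) (\<beta> ((1 - s) *\<^sub>R y + s *\<^sub>R p)))"
    have "continuous_on {0..1} g"
      unfolding g_def \<alpha>_aff \<beta>_aff by (intro continuous_intros)
    moreover have "g 1 \<le> 0" "0 \<le> g 0" using y p by (auto simp: g_def min_def)
    ultimately obtain s where s: "0 \<le> s" "s \<le> 1" "g s = 0"
      using IVT2'[of g 1 0 0] by auto
    define y' where "y' = (1 - s) *\<^sub>R y + s *\<^sub>R p"
    have y'seg: "y' \<in> closed_segment y p" using s by (auto simp: y'_def closed_segment_def)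
    have hy': "h y' = h y - s * (h y - h p)" unfolding y'_def h_aff by (simp add: algebra_simps)
    then have hle: "h y' \<le> h y" using s(1) p(1) by simp
    have "min (\<alpha> y') (\<beta> y') = 0" using s(3) by (simp add: g_def y'_def)
    then have "\<alpha> y' = 0 \<and> 0 \<le> \<beta> y' \<or> \<beta> y' = 0 \<and> 0 \<le> \<alpha> y'" by (auto simp: min_def split: if_splits)
    then have uw: "y' = u \<or> y' = w"
    proof
      assume "\<alpha> y' = 0 \<and> 0 \<le> \<beta> y'"
      then have "y' \<in> closed_segment v w" using hle y(3) by (intro on_vw) (auto simp: h_def)
      then show ?thesis using vw y'seg seg by blast
    next
      assume "\<beta> y' = 0 \<and> 0 \<le> \<alpha> y'"
      then have "y' \<in> closed_segment u v" using hle y(3) by (intro on_uv) (auto simp: h_def)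
      then show ?thesis using uv y'seg seg by blast
    qed
    have "y' = y" if "h p < h y"
    proof -
      have "h y' = 1" using uw vals by auto
      then have "s * (h y - h p) \<le> 0" using hy' y(3) by linarith
      then have "s = 0" using that s(1) by (simp add: mult_le_0_iff)
      then show ?thesis by (simp add: y'_def)
    qed
    then show ?thesis using uw y'seg by blast
  qed
  have sub: "closed_segment y p \<subseteq> R" "closed_segment y q \<subseteq> R" if "(p, q) \<in> Es" "y \<in> closed_segment p q" for y p q
  proof -
    have "closed_segment p q \<subseteq> R" using R(1) that(1) by blast
    moreover have "closed_segment y p \<subseteq> closed_segment p q" "closed_segment y q \<subseteq> closed_segment p q"
      using that(2) by (auto simp: closed_segment_subset)
    ultimately show "closed_segment y p \<subseteq> R" "closed_segment y q \<subseteq> R" by auto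
  qed
  have low: "h p \<le> h y \<or> h q \<le> h y" if y: "y \<in> closed_segment p q" for y p q
  proof (rule ccontr)
    assume "\<not> ?thesis"
    then have less: "h y < h p" "h y < h q" by auto
    obtain s where s: "0 \<le> s" "s \<le> 1" "y = (1 - s) *\<^sub>R p + s *\<^sub>R q" using y by (auto simp: closed_segment_def)
    then have "h y = (1 - s) * h p + s * h q" using h_aff by simp
    moreover have "(1 - s) * h p + s * h q > (1 - s) * h y + s * h y"
      using s less by (cases "s = 0") (auto intro!: add_le_less_mono mult_left_mono)
    ultimately show False by (simp add: algebra_simps)
  qed
  define N where "N = {x \<in> Vs. 0 \<le> \<alpha> x \<and> 0 \<le> \<beta> x \<and> h x \<le> 1}"
  \<comment> \<open>The height at which the sweep first meets a vertex; the inserted 1 stops it at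
    \<open>u w\<close> if there is none.\<close>
  define \<eta> where "\<eta> = Min (insert 1 (h ` N))"
  have finN: "finite N" using Vs(1) by (simp add: N_def)
  have \<eta>1: "\<eta> \<le> 1" and \<eta>N: "\<And>x. x \<in> N \<Longrightarrow> \<eta> \<le> h x"
    using finN by (auto simp: \<eta>_def)
  \<comment> \<open>An edge through such a point has an end of no greater height, hence below
    \<open>\<eta>\<close>. That end is no vertex of the triangle, so it lies off the wedge, and by
    \<open>exit\<close> the way to it passes through \<open>u\<close> or \<open>w\<close>; but these
    have height 1.\<close>
  have clear: "y \<notin> R" if y: "0 \<le> \<alpha> y" "0 \<le> \<beta> y" "h y < \<eta>" for y
  proof
    assume "y \<in> R"
    then obtain p q where pq: "(p, q) \<in> Es" "y \<in> closed_segment p q" using R(1) by auto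
    have "\<exists>p'. closed_segment y p' \<subseteq> R \<and> h p' \<le> h y \<and> p' \<in> insert u (insert w Vs)"
      using low[OF pq(2)] sub[OF pq] Es[OF pq(1)] by blast
    then obtain p' where p': "closed_segment y p' \<subseteq> R" "h p' \<le> h y" "p' \<in> insert u (insert w Vs)" by blast
    have "p' \<noteq> u" "p' \<noteq> w" using p'(2) y(3) \<eta>1 vals by auto
    then have "p' \<in> Vs" using p'(3) by simp
    moreover have "p' \<notin> N" using \<eta>N[of p'] p'(2) y(3) by linarith
    ultimately have "\<alpha> p' < 0 \<or> \<beta> p' < 0" using p'(2) y(3) \<eta>1 by (auto simp: N_def not_le)
    then obtain y' where y': "y' \<in> closed_segment y p'" "y' = u \<or> y' = w"
      using exit[OF p'(1)] y \<eta>1 p'(2) by fastforce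
    then obtain s where s: "0 \<le> s" "s \<le> 1" "y' = (1 - s) *\<^sub>R y + s *\<^sub>R p'" by (auto simp: closed_segment_def)
    have "h y' = h y - s * (h y - h p')" unfolding s(3) h_aff by (simp add: algebra_simps)
    then have "h y' \<le> h y" using s(1) p'(2) by simp
    then show False using y'(2) vals y(3) \<eta>1 by auto
  qed
  have \<eta>0: "0 < \<eta>"
  proof -
    have "0 < h x" if "x \<in> N" for x
    proof (rule ccontr)
      assume "\<not> 0 < h x"
      then have "\<alpha> x = 0" "\<beta> x = 0" using that by (auto simp: N_def h_def)
      then have "x = v" using co[of x] by simp
      then show False using that Vs(2) neq(3) by (auto simp: N_def)
    qed
    then show ?thesis using finN by (simp add: \<eta>_def)
  qed
  define W where "W = {z. 0 < \<alpha> z \<and> 0 < \<beta> z \<and> h z < \<eta>}"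
  have "convex W"
    unfolding convex_alt W_def
  proof (intro ballI allI impI CollectI)
    fix x y and s :: real
    assume xy: "x \<in> {z. 0 < \<alpha> z \<and> 0 < \<beta> z \<and> h z < \<eta>}" "y \<in> {z. 0 < \<alpha> z \<and> 0 < \<beta> z \<and> h z < \<eta>}" and s: "0 \<le> s \<and> s \<le> 1"
    have "0 < (1 - s) * \<alpha> x + s * \<alpha> y" "0 < (1 - s) * \<beta> x + s * \<beta> y"
      using xy s by (cases "s = 0"; auto intro!: add_nonneg_pos)+
    moreover have "(1 - s) * h x + s * h y < \<eta>"
      using xy s by (intro convex_bound_lt) auto
    ultimately show "0 < \<alpha> ((1 - s) *\<^sub>R x + s *\<^sub>R y) \<and> 0 < \<beta> ((1 - s) *\<^sub>R x + s *\<^sub>R y) \<and> h ((1 - s) *\<^sub>R x + s *\<^sub>R y) < \<eta>"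
      by (simp add: \<alpha>_aff \<beta>_aff h_aff)
  qed
  then have connW: "connected W" by (rule convex_connected)
  have WK: "W \<inter> K = {}"
    using clear off_vw off_uv unfolding K W_def by fastforce
  text \<open>Points of the inside close to \<open>v\<close> lie in the wedge, because moving them in the direction
    \<open>v - u\<close> leads out of the convex hull of the polygon.\<close>
  have "\<exists>q. q \<in> inside K \<and> q \<in> W"
  proof -
    define \<kappa> where "\<kappa> = v \<bullet> (v - u)"
    have inner: "v \<bullet> (c - v) < 0" if "norm c \<le> norm v" "c \<noteq> v" for c
      using Re_cnj_diff_neg[OF that] by (simp add: inner_complex_def)
    have \<kappa>: "\<kappa> > 0" using inner[of u] norms[of u] neq(1) by (simp add: \<kappa>_def inner_diff_right)
    have "closed R" using R(2) compact_imp_closed by blast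
    then obtain \<rho> where \<rho>: "\<rho> > 0" "\<And>x. x \<in> R \<Longrightarrow> \<rho> \<le> dist v x"
      using separate_point_closed neq(3) by metis
    define r where "r = \<rho> / (2 * norm (u - v))"
    have r: "r > 0" "r * norm (u - v) = \<rho> / 2" using \<rho>(1) neq(1) by (auto simp: r_def)
    \<comment> \<open>Conditions on the point \<open>q\<close>: so close to \<open>v\<close> that a
      shift by \<open>r\<close> times \<open>v - u\<close> stays away from \<open>R\<close>; below
      the sweep height; and so near the support line at \<open>v\<close> that this shift, which
      gains \<open>r * \<kappa>\<close> in the direction of \<open>v\<close>, crosses it.\<close>
    define O1 where "O1 = {z. norm (z - v) < \<rho> / 2} \<inter> {z. h z < \<eta>} \<inter> {z. v \<bullet> v < v \<bullet> z + r * \<kappa>}"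
    have "open O1"
      unfolding O1_def h_def
      by (intro open_Int open_Collect_less continuous_intros) (use cont in auto)
    moreover have "v \<in> O1" using \<rho>(1) \<eta>0 r \<kappa> by (auto simp: O1_def vals)
    moreover have "v \<in> closure (inside K)" using fr by (auto simp: K frontier_def)
    ultimately obtain q where q: "q \<in> inside K" "q \<in> O1" using open_Int_closure_eq_empty[of O1 "inside K"] by blast
    have nqK: "q \<notin> K" using q(1) inside_no_overlap by blast
    define e where "e = q - r *\<^sub>R (u - v)"
    have half: "K \<subseteq> {z. v \<bullet> z \<le> v \<bullet> v}"
    proof -
      have c: "c \<in> {z. v \<bullet> z \<le> v \<bullet> v}" if "c \<in> insert v (insert u (insert w Vs))" for c
        using inner[of c] norms[of c] that by (cases "c = v") (auto simp: inner_diff_right)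
      have sg: "closed_segment c d \<subseteq> {z. v \<bullet> z \<le> v \<bullet> v}"
        if "c \<in> insert v (insert u (insert w Vs))" "d \<in> insert v (insert u (insert w Vs))" for c d
        using c that by (intro closed_segment_subset convex_halfspace_le)
      then have "R \<subseteq> {z. v \<bullet> z \<le> v \<bullet> v}" using R(1) Es by blast
      then show ?thesis using sg K by auto
    qed
    have "e \<in> outside K"
    proof -
      have "v \<bullet> e = v \<bullet> q + r * \<kappa>"
        by (simp add: e_def \<kappa>_def inner_diff_right algebra_simps)
      then have "e \<notin> {z. v \<bullet> z \<le> v \<bullet> v}" using q(2) by (simp add: O1_def)
      then show ?thesis using outside_subset_convex[OF convex_halfspace_le half] by blast
    qed
    then have "\<not> closed_segment q e \<subseteq> inside K"
      using inside_Int_outside[of K] ends_in_segment(2)[of e q] by blast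
    then have "closed_segment q e \<inter> K \<noteq> {}"
      using connected_subset_inside[OF connected_segment _ _ clK, of q e] q(1) by auto
    then obtain y where y: "y \<in> closed_segment q e" "y \<in> K" by blast
    then obtain s' where s': "0 \<le> s'" "s' \<le> 1" "y = (1 - s') *\<^sub>R q + s' *\<^sub>R e" by (auto simp: closed_segment_def)
    define s where "s = s' * r"
    have s: "0 \<le> s" "s \<le> r" using s' r(1) by (auto simp: s_def mult_left_le_one_le)
    have y_eq: "y = q - s *\<^sub>R (u - v)" unfolding s'(3) e_def s_def by (simp add: algebra_simps)
    have "norm (y - v) \<le> norm (q - v) + s * norm (u - v)"
    proof -
      have "y - v = (q - v) - s *\<^sub>R (u - v)" by (simp add: y_eq)
      then have "norm (y - v) \<le> norm (q - v) + norm (s *\<^sub>R (u - v))" by (metis norm_triangle_ineq4)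
      then show ?thesis using s(1) by (simp only: norm_scaleR abs_of_nonneg)
    qed
    also have "\<dots> < \<rho> / 2 + \<rho> / 2"
      using q(2) s(2) r(2) mult_right_mono[OF s(2), of "norm (u - v)"] by (intro add_less_le_mono) (auto simp: O1_def)
    finally have "dist v y < \<rho>" by (simp add: dist_norm norm_minus_commute)
    then have "y \<notin> R" using \<rho>(2)[of y] by force
    then have yv: "y \<in> closed_segment v w \<or> y \<in> closed_segment u v" using y(2) K by blast
    \<comment> \<open>Going back from \<open>y\<close>, on one of the edges at \<open>v\<close>, to
      \<open>q\<close> changes only the coordinate \<open>\<alpha>\<close> and does not decrease it.
      So \<open>q\<close> is in the closed wedge, and in the open one because it is off the
      curve.\<close>
    have q_eq: "q = y + s *\<^sub>R (u - v)" using y_eq by simp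
    have q_co: "q = v + (\<alpha> y + s) *\<^sub>R (u - v) + \<beta> y *\<^sub>R (w - v)"
    proof -
      have "q = (v + \<alpha> y *\<^sub>R (u - v) + \<beta> y *\<^sub>R (w - v)) + s *\<^sub>R (u - v)"
        unfolding co[of y, symmetric] by (rule q_eq)
      then show ?thesis by (simp only: scaleR_add_left add_ac)
    qed
    have \<alpha>q: "\<alpha> q = \<alpha> y + s" using \<alpha>[of "\<alpha> y + s" "\<beta> y"] q_co by metis
    have \<beta>q: "\<beta> q = \<beta> y" using \<beta>[of "\<alpha> y + s" "\<beta> y"] q_co by metis
    have pos: "0 \<le> \<alpha> y" "0 \<le> \<beta> y"
      using yv unfolding closed_segment_def by (auto simp: \<alpha>_aff \<beta>_aff vals)
    have hq: "h q < \<eta>" using q(2) by (simp add: O1_def)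
    have "0 \<le> \<alpha> q" "0 \<le> \<beta> q" using pos s(1) by (auto simp: \<alpha>q \<beta>q)
    moreover from this have "\<alpha> q \<noteq> 0" "\<beta> q \<noteq> 0"
      using on_vw[of q] on_uv[of q] nqK hq \<eta>1 by (auto simp: K h_def)
    ultimately show ?thesis using q(1) hq by (auto simp: W_def)
  qed
  then have Win: "W \<subseteq> inside K"
    using connected_subset_inside[OF connW WK _ clK] by blast
  show ?thesis
  proof (cases "N = {}")
    case False
    then have "Min (h ` N) \<in> h ` N" using finN by (intro Min_in) auto
    then obtain x where x: "x \<in> N" "h x = Min (h ` N)" by auto
    then have hx: "h x = \<eta>"
    proof -
      have "\<eta> = min 1 (Min (h ` N))" unfolding \<eta>_def using finN False by (intro Min_insert) auto
      moreover have "h x \<le> 1" using x(1) by (simp add: N_def)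
      ultimately show ?thesis using x(2) by simp
    qed
    have xR: "x \<in> R" "x \<in> Vs" using x(1) Vs(2) by (auto simp: N_def)
    have "\<alpha> x \<noteq> 0"
    proof
      assume "\<alpha> x = 0"
      then have "x \<in> closed_segment v w" using x(1) by (intro on_vw) (auto simp: N_def h_def)
      then show False using vw xR Vs(4) by auto
    qed
    moreover have "\<beta> x \<noteq> 0"
    proof
      assume "\<beta> x = 0"
      then have "x \<in> closed_segment u v" using x(1) by (intro on_uv) (auto simp: N_def h_def)
      then show False using uv xR Vs(3) by auto
    qed
    ultimately have pos: "0 < \<alpha> x" "0 < \<beta> x" using x(1) by (auto simp: N_def)
    have "open_segment v x \<subseteq> W"
    proof
      fix z assume "z \<in> open_segment v x"
      then obtain s where s: "0 < s" "s < 1" "z = (1 - s) *\<^sub>R v + s *\<^sub>R x" by (auto simp: in_segment)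
      then show "z \<in> W" using pos \<eta>0 hx by (auto simp: W_def \<alpha>_aff \<beta>_aff h_aff vals)
    qed
    then show ?thesis using Win xR(2) by blast
  next
    case True
    then have "\<eta> = 1" by (simp add: \<eta>_def)
    have "open_segment u w \<subseteq> inside K"
    proof
      fix y assume "y \<in> open_segment u w"
      then obtain s where s: "0 < s" "s < 1" "y = (1 - s) *\<^sub>R u + s *\<^sub>R w" by (auto simp: in_segment)
      have ya: "\<alpha> y = 1 - s" "\<beta> y = s" "h y = 1" by (auto simp: s(3) \<alpha>_aff \<beta>_aff h_aff vals)
      \<comment> \<open>An edge through \<open>y\<close> has both ends on the line through
        \<open>u\<close> and \<open>w\<close>, since by \<open>exit\<close> an end of smaller height
        would make \<open>y\<close> equal to \<open>u\<close> or \<open>w\<close>. No vertex lies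
        strictly between \<open>u\<close> and \<open>w\<close>, so the edge contains both and has
        them as its ends, which \<open>nuw\<close> excludes.\<close>
      have "y \<notin> R"
      proof
        assume "y \<in> R"
        then obtain p q where pq: "(p, q) \<in> Es" "y \<in> closed_segment p q" using R(1) by auto
        have side: "h p' = 1" if p': "closed_segment y p' \<subseteq> R" "h p' \<le> h y" "p' \<in> insert u (insert w Vs)" for p'
        proof (rule ccontr)
          assume "h p' \<noteq> 1"
          then have less: "h p' < h y" using p'(2) ya(3) by simp
          then have "p' \<in> Vs" using p'(3) vals ya(3) by auto
          then have "\<alpha> p' < 0 \<or> \<beta> p' < 0" using True p'(2) ya(3) by (auto simp: N_def not_le)
          then have "y = u \<or> y = w" using exit[OF p'(1)] ya s less by fastforce
          then show False using ya s vals by auto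
        qed
        obtain l where l: "0 \<le> l" "l \<le> 1" "y = (1 - l) *\<^sub>R p + l *\<^sub>R q" using pq(2) by (auto simp: closed_segment_def)
        have hl: "1 = (1 - l) * h p + l * h q" using ya(3) unfolding l(3) h_aff by simp
        have vert: "\<not> (0 < \<beta> p' \<and> \<beta> p' < 1)" if "h p' = 1" "p' \<in> insert u (insert w Vs)" for p'
        proof
          assume "0 < \<beta> p' \<and> \<beta> p' < 1"
          then have "p' \<in> N" using that vals by (auto simp: N_def h_def)
          then show False using True by simp
        qed
        have ne: "y \<noteq> p'" if "p' \<in> insert u (insert w Vs)" for p'
          using vert[of y] ya s that by auto
        have l01: "0 < l" "l < 1"
        proof -
          have "l = 0 \<Longrightarrow> y = p" "l = 1 \<Longrightarrow> y = q" using l(3) by auto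
          then have "l \<noteq> 0" "l \<noteq> 1" using ne[of p] ne[of q] Es[OF pq(1)] by blast+
          then show "0 < l" "l < 1" using l(1,2) by auto
        qed
        have "h p = 1 \<or> h q = 1"
          using low[OF pq(2)] side sub[OF pq] Es[OF pq(1)] by blast
        then have hpq: "h p = 1" "h q = 1" 
        proof -
          have "(1 - l) * (h p - 1) + l * (h q - 1) = 0" using hl by (simp add: algebra_simps)
          then show "h p = 1" "h q = 1" using \<open>h p = 1 \<or> h q = 1\<close> l01 by auto
        qed
        have bl: "s = (1 - l) * \<beta> p + l * \<beta> q" using ya(2) unfolding l(3) \<beta>_aff by simp
        have vp: "\<beta> p \<le> 0 \<or> 1 \<le> \<beta> p" and vq: "\<beta> q \<le> 0 \<or> 1 \<le> \<beta> q"
          using vert hpq Es[OF pq(1)] by fastforce+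
        have span: "u \<in> closed_segment p q \<and> w \<in> closed_segment p q"
        proof -
          have mem: "c \<in> closed_segment p q" if "h c = 1" "0 \<le> m" "m \<le> 1" "\<beta> c = (1 - m) * \<beta> p + m * \<beta> q" for c m
          proof -
            define d where "d = (1 - m) *\<^sub>R p + m *\<^sub>R q"
            have "\<beta> d = \<beta> c" "h d = 1" using that hpq by (auto simp: d_def \<beta>_aff h_aff)
            then have "\<alpha> d = \<alpha> c" using that(1) by (simp add: h_def)
            have "d = v + \<alpha> d *\<^sub>R (u - v) + \<beta> d *\<^sub>R (w - v)" by (rule co)
            also have "\<dots> = c" unfolding \<open>\<alpha> d = \<alpha> c\<close> \<open>\<beta> d = \<beta> c\<close> by (rule co[symmetric])
            finally have "d = c" .
            then show ?thesis using that d_def by (auto simp: closed_segment_def)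
          qed
          have ivt: "\<exists>m. 0 \<le> m \<and> m \<le> 1 \<and> x = (1 - m) * \<beta> p + m * \<beta> q"
            if "x \<in> closed_segment (\<beta> p) (\<beta> q)" for x
            using that by (auto simp: closed_segment_def)
          have not0: "\<not> (\<beta> p \<le> 0 \<and> \<beta> q \<le> 0)"
          proof
            assume "\<beta> p \<le> 0 \<and> \<beta> q \<le> 0"
            then have "(1 - l) * \<beta> p + l * \<beta> q \<le> 0" using l by (intro add_nonpos_nonpos mult_nonneg_nonpos) auto
            then show False using bl s by simp
          qed
          have not1: "\<not> (1 \<le> \<beta> p \<and> 1 \<le> \<beta> q)"
          proof
            assume "1 \<le> \<beta> p \<and> 1 \<le> \<beta> q"
            then have "(1 - l) * 1 + l * 1 \<le> (1 - l) * \<beta> p + l * \<beta> q" using l by (intro add_mono mult_left_mono) auto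
            then show False using bl s by simp
          qed
          have "0 \<in> closed_segment (\<beta> p) (\<beta> q)" "1 \<in> closed_segment (\<beta> p) (\<beta> q)"
            using vp vq not0 not1 by (auto simp: closed_segment_eq_real_ivl)
          then show ?thesis using ivt mem[of u] mem[of w] vals by metis
        qed
        have "u = p \<or> u = q" "w = p \<or> w = q" using span onu[OF pq(1)] onw[OF pq(1)] by auto
        moreover have "u \<noteq> w" using vals by auto
        ultimately show False using pq(1) nuw by auto
      qed
      then have "y \<notin> K" using off_vw[of y] off_uv[of y] ya s by (auto simp: K)
      \<comment> \<open>Points slightly moved from \<open>y\<close> towards \<open>v\<close> lie in
        \<open>W\<close>; the weight of \<open>v\<close> starts at 1/2, because weight 1 would give
        \<open>v\<close> itself.\<close>
      moreover have "y \<in> closure W"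
      proof -
        have "\<forall>n. (1 - 1 / real (Suc (Suc n))) *\<^sub>R y + (1 / real (Suc (Suc n))) *\<^sub>R v \<in> W"
          using ya s \<open>\<eta> = 1\<close> by (auto simp: W_def \<alpha>_aff \<beta>_aff h_aff vals)
        moreover have "(\<lambda>n. (1 - 1 / real (Suc (Suc n))) *\<^sub>R y + (1 / real (Suc (Suc n))) *\<^sub>R v) \<longlonglongrightarrow> (1 - 0) *\<^sub>R y + 0 *\<^sub>R v"
          by (intro tendsto_intros; rule LIMSEQ_Suc[OF lim_1_over_n[THEN LIMSEQ_Suc]])
        ultimately show ?thesis unfolding closure_sequential by fastforce
      qed
      then have "y \<in> closure (inside K)" using closure_mono[OF Win] by blast
      then have "y \<in> inside K \<or> y \<in> K" using fr closure_Un_frontier by blast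
      ultimately show "y \<in> inside K" by blast
    qed
    then show ?thesis by blast
  qed
qed

section \<open>Diagonals in cyclic vertex lists\<close>

lemma edges_closed_append:
  assumes "xs \<noteq> []" "ys \<noteq> []"
  shows "edges (xs @ ys @ [hd xs]) = edges (xs @ [hd ys]) \<union> edges (ys @ [hd xs])"
proof -
  have "xs @ ys @ [hd xs] = xs @ hd ys # (tl ys @ [hd xs])" "ys @ [hd xs] = hd ys # (tl ys @ [hd xs])"
    using assms by (cases ys; simp)+
  then show ?thesis using edges_append[of xs "hd ys" "tl ys @ [hd xs]"] by metis
qed

lemma edges_closed_rotate:
  "edges (xs @ ys @ [hd (xs @ ys)]) = edges (ys @ xs @ [hd (ys @ xs)])"
proof (cases "xs = [] \<or> ys = []")
  case False
  then show ?thesis using edges_closed_append[of xs ys] edges_closed_append[of ys xs] by auto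
qed auto

lemma not_edges_distinct:
  assumes "distinct (w # M @ [u])" "M \<noteq> []"
  shows "(u, w) \<notin> edges (w # M @ [u])" "(w, u) \<notin> edges (w # M @ [u])"
proof -
  obtain m M' where M: "M = m # M'" using assms(2) by (cases M) auto
  have "w \<notin> set (M @ [u])" using assms(1) by auto
  moreover have "edges (w # M @ [u]) = insert (w, m) (edges (M @ [u]))" by (simp add: M)
  ultimately show "(u, w) \<notin> edges (w # M @ [u])" "(w, u) \<notin> edges (w # M @ [u])"
    using edges_subset[of u w "M @ [u]"] edges_subset[of w u "M @ [u]"] assms(1) M by auto
qed

lemma exists_diagonal_at_max:
  assumes simple: "simple_path (closed_polygon (v # w # M @ [u]))" and dist: "distinct (v # w # M @ [u])"
    and M: "M \<noteq> []" and norms: "\<And>c. c \<in> set (v # w # M @ [u]) \<Longrightarrow> norm c \<le> norm v"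
  shows "\<exists>p\<in>set (v # w # M @ [u]). \<exists>q\<in>set (v # w # M @ [u]). p \<noteq> q \<and>
    (p, q) \<notin> edges (v # w # M @ [u, v]) \<and> (q, p) \<notin> edges (v # w # M @ [u, v]) \<and>
    open_segment p q \<subseteq> inside (path_image (closed_polygon (v # w # M @ [u])))"
proof -
  let ?cs = "v # w # M @ [u]"
  let ?K = "path_image (closed_polygon ?cs)"
  define R where "R = path_image (polypath (w # M @ [u]))"
  have s1: "arc (polypath [v, w])" "arc (polypath (w # M @ [u, v]))"
    "path_image (polypath [v, w]) \<inter> path_image (polypath (w # M @ [u, v])) \<subseteq> {v, w}"
    and K1: "?K = closed_segment v w \<union> path_image (polypath (w # M @ [u, v]))"
    using simple closed_polygon_append(1,2)[of "[v]" "w # M @ [u]"] by auto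
  have s2: "arc (polypath (w # M @ [u]))" "R \<inter> closed_segment u v \<subseteq> {u}"
    and K2: "path_image (polypath (w # M @ [u, v])) = R \<union> closed_segment u v"
    using s1(2) arc_polypath_append_iff[of "w # M" "[v]" u] path_image_polypath_append[of "w # M" "[v]" u]
    by (auto simp: R_def)
  have wR: "w \<in> R" "u \<in> R" "set M \<subseteq> R"
    using vertices_subset_path_image[of "w # M @ [u]"] by (auto simp: R_def)
  have neq: "u \<noteq> v" "w \<noteq> v" "u \<noteq> w" using dist by auto
  have vR: "v \<notin> R" using s2(2) neq by auto
  have vwR: "closed_segment v w \<inter> R \<subseteq> {w}" using s1(3) vR K2 by auto
  have uvR: "closed_segment u v \<inter> R \<subseteq> {u}" using s2(2) by auto
  have vwu: "closed_segment v w \<inter> closed_segment u v \<subseteq> {v}"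
  proof -
    have "w \<notin> closed_segment u v" using s2(2) wR neq by auto
    then show ?thesis using s1(3) K2 by auto
  qed
  have J: "frontier (inside ?K) = ?K"
    using Jordan_inside_outside[OF simple] by (simp add: closed_polygon_loop)
  have diag: "open_segment u w \<subseteq> inside ?K \<or> (\<exists>x\<in>set M. open_segment v x \<subseteq> inside ?K)"
  proof (rule corner_diagonal[where R = R and Es = "edges (w # M @ [u])"])
    show "R = (\<Union>(p, q)\<in>edges (w # M @ [u]). closed_segment p q)"
      unfolding R_def by (rule path_image_polypath) simp
    show "compact R" unfolding R_def by (rule compact_path_image) simp
    show "p \<in> insert u (insert w (set M)) \<and> q \<in> insert u (insert w (set M))" if "(p, q) \<in> edges (w # M @ [u])" for p q
      using edges_subset[OF that] by auto
    show "?K = closed_segment v w \<union> closed_segment u v \<union> R" using K1 K2 by auto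
    show "u = p \<or> u = q" if "(p, q) \<in> edges (w # M @ [u])" "u \<in> closed_segment p q" for p q
      using arc_polypath_vertex_on_edge[OF s2(1) that(1) _ that(2)] by simp
    show "w = p \<or> w = q" if "(p, q) \<in> edges (w # M @ [u])" "w \<in> closed_segment p q" for p q
      using arc_polypath_vertex_on_edge[OF s2(1) that(1) _ that(2)] by simp
    show "(u, w) \<notin> edges (w # M @ [u])" "(w, u) \<notin> edges (w # M @ [u])"
      using not_edges_distinct[of w M u] dist M by auto
  qed (use J dist norms wR vR vwR uvR vwu neq in auto)
  have E: "edges (v # w # M @ [u, v]) = insert (v, w) (insert (u, v) (edges (w # M @ [u])))"
    using edges_append[of "w # M" u "[v]"] by auto
  have E': "p \<noteq> v \<and> q \<noteq> v" if "(p, q) \<in> edges (w # M @ [u])" for p q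
    using edges_subset[OF that] dist by auto
  from diag show ?thesis
  proof
    assume *: "open_segment u w \<subseteq> inside ?K"
    show ?thesis
      by (rule bexI[of _ u], rule bexI[of _ w])
         (use * neq E not_edges_distinct[of w M u] dist M in auto)
  next
    assume "\<exists>x\<in>set M. open_segment v x \<subseteq> inside ?K"
    then obtain x where x: "x \<in> set M" "open_segment v x \<subseteq> inside ?K" by blast
    show ?thesis
      by (rule bexI[of _ v], rule bexI[of _ x])
         (use x neq E E' dist in auto)
  qed
qed

text \<open>A vertex of largest modulus is rotated to the front to apply the corner argument. The
  conditions \<open>M \<noteq> []\<close> and \<open>Y @ X \<noteq> []\<close> say that
  \<open>p\<close> and \<open>q\<close> are not neighbours in either direction, so both parts cut
  off by the diagonal have at least three vertices.\<close>

lemma exists_diagonal: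
  assumes pos: "pos_polygon cs" and len: "4 \<le> length cs"
  shows "\<exists>X p M q Y. cs = X @ p # M @ q # Y \<and> M \<noteq> [] \<and> Y @ X \<noteq> [] \<and>
    open_segment p q \<subseteq> inside (path_image (closed_polygon cs))"
proof -
  have dist: "distinct cs" and "cs \<noteq> []" using pos len by (auto simp: pos_polygon_def)
  obtain v where v: "v \<in> set cs" "\<And>c. c \<in> set cs \<Longrightarrow> norm c \<le> norm v"
  proof -
    have "Max (norm ` set cs) \<in> norm ` set cs" using \<open>cs \<noteq> []\<close> by (intro Max_in) auto
    then obtain v where "v \<in> set cs" "norm v = Max (norm ` set cs)" by auto
    then show ?thesis by (intro that[of v]) auto
  qed
  obtain xs ys where cs: "cs = xs @ v # ys" using v(1) split_list by metis
  define rs where "rs = (v # ys) @ xs"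
  have pr: "pos_polygon rs" "path_image (closed_polygon rs) = path_image (closed_polygon cs)"
    using pos_polygon_rotate[of xs "v # ys"] pos by (auto simp: cs rs_def)
  have set: "set rs = set cs" by (auto simp: cs rs_def)
  obtain w M u where rs: "rs = v # w # M @ [u]" "M \<noteq> []"
  proof -
    have l: "length (ys @ xs) \<ge> 3" using len by (simp add: cs)
    then obtain w N where N: "ys @ xs = w # N" "length N \<ge> 2" by (cases "ys @ xs") auto
    then have "N = butlast N @ [last N]" "butlast N \<noteq> []" by (cases N rule: rev_cases; auto)+
    then show ?thesis using N(1) by (intro that[of w "butlast N" "last N"]) (auto simp: rs_def)
  qed
  have E: "edges (v # w # M @ [u, v]) = edges (cs @ [hd cs])"
  proof -
    have "v # w # M @ [u, v] = (v # w # M @ [u]) @ [v]" by simp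
    also have "\<dots> = (v # ys) @ xs @ [hd ((v # ys) @ xs)]" by (simp only: rs(1)[symmetric] rs_def) simp
    finally have "edges (v # w # M @ [u, v]) = edges (xs @ (v # ys) @ [hd (xs @ v # ys)])"
      by (simp only: edges_closed_rotate[of "v # ys" xs])
    then show ?thesis by (simp add: cs)
  qed
  have "\<exists>p\<in>set rs. \<exists>q\<in>set rs. p \<noteq> q \<and> (p, q) \<notin> edges (cs @ [hd cs]) \<and> (q, p) \<notin> edges (cs @ [hd cs]) \<and>
      open_segment p q \<subseteq> inside (path_image (closed_polygon rs))"
    using exists_diagonal_at_max[of v w M u] unfolding E rs(1)[symmetric]
    using pr(1) rs(2) v(2) set by (simp add: pos_polygon_def)
  then obtain p q where pq: "p \<in> set cs" "q \<in> set cs" "p \<noteq> q" "(p, q) \<notin> edges (cs @ [hd cs])" "(q, p) \<notin> edges (cs @ [hd cs])"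
    "open_segment p q \<subseteq> inside (path_image (closed_polygon cs))"
    unfolding pr(2) set by blast
  have "\<exists>X M Y. cs = X @ p' # M @ q' # Y \<and> M \<noteq> [] \<and> Y @ X \<noteq> []"
    if X: "cs = X @ p' # M @ q' # Y" and ne: "(p', q') \<notin> edges (cs @ [hd cs])" "(q', p') \<notin> edges (cs @ [hd cs])"
    for X M Y p' q'
  proof (intro exI conjI)
    show "cs = X @ p' # M @ q' # Y" by (rule X)
    show "M \<noteq> []"
    proof
      assume "M = []"
      then have "(p', q') \<in> edges (cs @ [hd cs])"
        using edges_append[of X p' "q' # Y @ [hd cs]"] by (simp add: X)
      then show False using ne by simp
    qed
    show "Y @ X \<noteq> []"
    proof
      assume "Y @ X = []"
      then have "(q', p') \<in> edges (cs @ [hd cs])"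
        using edges_append[of "p' # M" q' "[p']"] by (simp add: X)
      then show False using ne by simp
    qed
  qed
  note key = this
  obtain X Z where XZ: "cs = X @ p # Z" using pq(1) split_list by metis
  show ?thesis
  proof (cases "q \<in> set Z")
    case True
    then obtain M Y where "Z = M @ q # Y" using split_list by metis
    then show ?thesis using key[of X p M q Y] XZ pq by blast
  next
    case False
    then have "q \<in> set X" using XZ pq(2,3) by auto
    then obtain X' M where "X = X' @ q # M" using split_list by metis
    then have "cs = X' @ q # M @ p # Z" using XZ by simp
    from key[OF this pq(5,4)] pq(6) show ?thesis
      unfolding open_segment_commute[of p q] by blast
  qed
qed

text \<open>Grafts one triangulation onto an edge of another. The apex \<open>y\<close> is a vertex
  of the chain, so the consecutive vertices \<open>p\<close> and \<open>q\<close> lie in the same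
  half of it, with \<open>y\<close> counted to both halves, and the graft takes place in the
  corresponding subfilling. An empty filling is the single edge \<open>p q\<close>, which
  \<open>M\<close> replaces.\<close>

lemma ear_fill_glue:
  assumes "ear_fill a L b" "a # L @ [b] = X @ p # q # Y" "ear_fill p M q"
  shows "\<exists>L'. a # L' @ [b] = X @ p # M @ q # Y \<and> ear_fill a L' b"
  using assms
proof (induction arbitrary: X Y rule: ear_fill.induct)
  case (ear_fill_Nil a b)
  then have "X = []" "Y = []" "a = p" "b = q" by (auto simp: Cons_eq_append_conv)
  then show ?case using ear_fill_Nil by auto
next
  case (ear_fill_insert y a b L1 L2)
  have eq: "(a # L1) @ y # L2 @ [b] = X @ p # q # Y" using ear_fill_insert.prems(1) by simp
  then consider (left) Y1 where "a # L1 @ [y] = X @ p # q # Y1" "Y = Y1 @ L2 @ [b]"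
    | (right) X2 where "y # L2 @ [b] = X2 @ p # q # Y" "X = a # L1 @ X2"
  proof -
    have "(a # L1) @ (y # L2 @ [b]) = X @ (p # q # Y)" using eq by simp
    then consider us where "a # L1 = X @ us" "us @ y # L2 @ [b] = p # q # Y"
      | us where "(a # L1) @ us = X" "y # L2 @ [b] = us @ p # q # Y"
      unfolding append_eq_append_conv2 by blast
    then show thesis
    proof cases
      case 1
      show thesis
      proof (cases us)
        case Nil
        then show ?thesis using 1 right[of "[]"] by auto
      next
        case (Cons u us')
        show ?thesis
        proof (cases us')
          case Nil
          then show ?thesis using 1 Cons left[of "[]"] by auto
        next
          case (Cons u' us'')
          then show ?thesis using 1 \<open>us = u # us'\<close> left[of "us'' @ [y]"] by auto
        qed
      qed
    next
      case 2
      then show thesis using right[of us] by auto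
    qed
  qed
  then show ?case
  proof cases
    case left
    then obtain L' where L': "a # L' @ [y] = X @ p # M @ q # Y1" "ear_fill a L' y"
      using ear_fill_insert.IH(1) ear_fill_insert.prems(2) by blast
    have "a # (L' @ y # L2) @ [b] = (a # L' @ [y]) @ L2 @ [b]" by simp
    also have "\<dots> = X @ p # M @ q # Y" unfolding L'(1) using left by simp
    finally show ?thesis
      using ear_fill.ear_fill_insert[OF ear_fill_insert.hyps(1) L'(2) ear_fill_insert.hyps(3)] by blast
  next
    case right
    then obtain L' where L': "y # L' @ [b] = X2 @ p # M @ q # Y" "ear_fill y L' b"
      using ear_fill_insert.IH(2) ear_fill_insert.prems(2) by blast
    have "a # (L1 @ y # L') @ [b] = (a # L1) @ (y # L' @ [b])" by simp
    also have "\<dots> = X @ p # M @ q # Y" unfolding L'(1) using right by simp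
    finally show ?thesis
      using ear_fill.ear_fill_insert[OF ear_fill_insert.hyps(1,2) L'(2)] by blast
  qed
qed

section \<open>Triangulation and the main theorem\<close>

text \<open>For a triangle, winding number 1 at an inside point \<open>z\<close> means
  \<open>0 < Im ((y - a) * cnj (y - z))\<close>. In barycentric coordinates of \<open>z\<close> this
  is \<open>- t * Im ((y - a) * cnj (b - a))\<close> with \<open>t \<ge> 0\<close>, which determines
  the sign.\<close>

lemma pos_polygon_triangle:
  assumes "pos_polygon [a, y, b]"
  shows "Im ((y - a) / (b - a)) < 0"
proof -
  let ?p = "closed_polygon [a, y, b]"
  have p: "?p = linepath a y +++ linepath y b +++ linepath b a" by (simp add: closed_polygon_def)
  have im: "path_image ?p = closed_segment a y \<union> closed_segment y b \<union> closed_segment b a"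
    unfolding p by (simp add: path_image_join Un_assoc)
  have simple: "simple_path ?p" and wind: "\<And>z. z \<in> inside (path_image ?p) \<Longrightarrow> winding_number ?p z = 1"
    using assms by (auto simp: pos_polygon_def)
  have J: "inside (path_image ?p) \<noteq> {}" "open (inside (path_image ?p))"
    using Jordan_inside_outside[OF simple] by (auto simp: closed_polygon_loop)
  have "path_image ?p \<subseteq> convex hull {a, y, b}"
    unfolding im by (auto simp: segment_convex_hull elim!: hull_mono[THEN subsetD, rotated])
  from outside_subset_convex[OF convex_convex_hull this]
  have "inside (path_image ?p) \<subseteq> convex hull {a, y, b}"
    using inside_Int_outside[of "path_image ?p"] by blast
  then have sub: "inside (path_image ?p) \<subseteq> interior (convex hull {a, y, b})"
    using J(2) interior_maximal by blast
  obtain z where z: "z \<in> inside (path_image ?p)" using J(1) by blast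
  then have "0 < Im ((y - a) * cnj (y - z))"
    using winding_number_triangle[of z a y b] wind[OF z] sub p by (auto split: if_splits)
  moreover obtain r s t where rst: "0 \<le> r" "0 \<le> s" "0 \<le> t" "r + s + t = 1" "z = r *\<^sub>R a + s *\<^sub>R y + t *\<^sub>R b"
    using z sub interior_subset unfolding convex_hull_3 by blast
  have yz: "y - z = r *\<^sub>R (y - a) + t *\<^sub>R (y - b)"
  proof -
    have "y = (r + s + t) *\<^sub>R y" using rst(4) by simp
    then show ?thesis unfolding rst(5) by (simp add: algebra_simps)
  qed
  have "Im ((y - a) * cnj (y - z)) = - t * Im ((y - a) * cnj (b - a))"
    unfolding yz by (simp add: algebra_simps)
  ultimately have neg: "Im ((y - a) * cnj (b - a)) < 0"
    using rst(3) by (simp add: mult_less_0_iff)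
  have "b \<noteq> a" using assms by (auto simp: pos_polygon_def)
  have "(y - a) / (b - a) = (y - a) * cnj (b - a) / of_real ((norm (b - a))\<^sup>2)"
    using complex_div_cnj[of "y - a" "b - a"] by simp
  then have "Im ((y - a) / (b - a)) = Im ((y - a) * cnj (b - a)) / (norm (b - a))\<^sup>2"
    by (simp only: Im_divide_of_real)
  then show ?thesis using neg \<open>b \<noteq> a\<close> by (simp only: divide_neg_pos zero_less_power zero_less_norm_iff right_minus_eq not_False_eq_True)
qed

text \<open>Cut along a diagonal \<open>p q\<close>, read in the linear order of the list. The part
  \<open>X @ p # q # Y\<close> still begins with \<open>a\<close> and ends with \<open>b\<close>, so
  its filling has the same base edge; the part \<open>p # M @ [q]\<close> is a filling over the base
  edge \<open>p q\<close> and is grafted there.\<close>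

proposition ear_fill_pos_polygon:
  "pos_polygon (a # L @ [b]) \<Longrightarrow> ear_fill a L b"
proof (induction "length L" arbitrary: a L b rule: less_induct)
  case less
  have "L \<noteq> []" using less.prems by (auto simp: pos_polygon_def)
  show ?case
  proof (cases "length L = 1")
    case True
    then obtain y where L: "L = [y]" by (auto simp: length_Suc_conv)
    then have "Im ((y - a) / (b - a)) < 0" using less.prems pos_polygon_triangle by simp
    then have "ear_fill a ([] @ y # []) b" by (intro ear_fill_insert ear_fill_Nil)
    then show ?thesis using L by simp
  next
    case False
    then have "4 \<le> length (a # L @ [b])" using \<open>L \<noteq> []\<close> by (cases L) (auto simp: Suc_le_eq)
    then obtain X p M q Y where dec: "a # L @ [b] = X @ p # M @ q # Y" "M \<noteq> []" "Y @ X \<noteq> []"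
      "open_segment p q \<subseteq> inside (path_image (closed_polygon (a # L @ [b])))"
      using exists_diagonal[OF less.prems] by blast
    have rot: "pos_polygon ((p # M) @ (q # Y @ X))"
      "path_image (closed_polygon ((p # M) @ (q # Y @ X))) = path_image (closed_polygon (a # L @ [b]))"
      using pos_polygon_rotate[of X "p # M @ q # Y"] less.prems dec(1) by auto
    have split: "pos_polygon (p # M @ [q])" "pos_polygon ((q # Y @ X) @ [p])"
      using pos_polygon_split[OF rot(1)] dec rot(2) by (auto simp: Suc_le_eq)
    have len: "length L + 2 = length X + length M + length Y + 2"
      using arg_cong[OF dec(1), of length] by simp
    have pMq: "ear_fill p M q"
      using less.hyps[OF _ split(1)] len dec(3) by (cases X; cases Y) auto
    have rest: "pos_polygon (X @ p # q # Y)"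
      using pos_polygon_rotate(2)[of "q # Y" "X @ [p]"] split(2) by simp
    obtain L1 where L1: "X @ p # q # Y = a # L1 @ [b]"
    proof -
      have "hd (X @ p # q # Y) = a" using arg_cong[OF dec(1), of hd] by (cases X) auto
      moreover have "last (X @ p # q # Y) = b"
        using arg_cong[OF dec(1), of last] by (cases Y) auto
      ultimately show ?thesis
        using that by (cases X; cases Y rule: rev_cases) auto
    qed
    have "length L1 < length L"
      using arg_cong[OF L1, of length] len dec(2) by (cases M) auto
    then have "ear_fill a L1 b" using less.hyps[of L1 a b] rest unfolding L1 by blast
    from ear_fill_glue[OF this L1[symmetric] pMq]
    obtain L' where L': "a # L' @ [b] = a # L @ [b]" "ear_fill a L' b" unfolding dec(1) by blast
    then show ?thesis by simp
  qed
qed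

section \<open>Orientation from the left-side condition\<close>

text \<open>The winding number inside is 1 or -1, and crossing the first edge at its midpoint
  \<open>p\<close> decides which. That of the remaining path \<open>Q\<close> is continuous at
  \<open>p\<close>, while the edge contributes a positive real part on its left and a negative one
  on its right. On the right the total is 0, so \<open>Q\<close> contributes at least 0 at
  \<open>p\<close>; a total of -1 on the left would make this at most -1.\<close>

lemma pos_polygon_if_lies_left:
  assumes len: "3 \<le> length cs" and dist: "distinct cs" and simple: "simple_path (closed_polygon cs)"
    and left: "lies_left_of_polygon (inside (path_image (closed_polygon cs))) cs"
  shows "pos_polygon cs"
proof -
  obtain a b cs' where cs: "cs = a # b # cs'" "cs' \<noteq> []"
    using len by (cases cs rule: polypath.cases) auto
  let ?K = "path_image (closed_polygon cs)"
  define L where "L = linepath a b"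
  define Q where "Q = polypath (b # cs' @ [a])"
  have cl: "?K = closed_segment a b \<union> path_image Q" "closed_segment a b \<inter> path_image Q \<subseteq> {a, b}"
    and wn: "\<And>z. z \<notin> ?K \<Longrightarrow> winding_number (closed_polygon cs) z = winding_number L z + winding_number Q z"
    using simple closed_polygon_append[of "[a]" "b # cs'"] by (auto simp: cs L_def Q_def)
  have J: "open (inside ?K)" "open (outside ?K)" "frontier (outside ?K) = ?K"
    using Jordan_inside_outside[OF simple closed_polygon_loop] by (auto simp: cs(1))
  have clK: "closed ?K" using simple by (simp add: closed_path_image simple_path_imp_path)
  have ab: "a \<noteq> b" using dist by (simp add: cs)
  define p where "p = midpoint a b"
  define \<nu> where "\<nu> = \<i> * (b - a)"
  have pK: "p \<in> ?K" using cl(1) by (simp add: p_def)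
  have pQ: "p \<notin> path_image Q"
  proof -
    have "p \<in> closed_segment a b" "p \<noteq> a" "p \<noteq> b" using ab by (auto simp: p_def)
    then show ?thesis using cl(2) by blast
  qed
  have p_eq: "p = (1/2) *\<^sub>R a + (1/2) *\<^sub>R b" by (simp add: p_def midpoint_def scaleR_add_right)
  define z where "z = (\<lambda>e::real. p + of_real e * \<nu>)"
  have zleft: "\<forall>\<^sub>F e in at_right 0. z e \<in> inside ?K"
  proof -
    have "(1 - 1/2) *\<^sub>R a + (1/2) *\<^sub>R b = p" by (simp add: p_eq)
    then show ?thesis
      using left len unfolding lies_left_of_polygon_def
      by (auto simp: cs z_def \<nu>_def Let_def mult.assoc dest!: spec[of _ 0] bspec[of _ _ "1/2"])
  qed
  have "closed (path_image Q)" unfolding Q_def by (intro closed_path_image path_polypath)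
  then obtain d0 where d0: "d0 > 0" "\<And>x. x \<in> path_image Q \<Longrightarrow> d0 \<le> dist p x"
    using separate_point_closed[OF _ pQ] by blast
  \<comment> \<open>In the disk of this radius around \<open>p\<close> the curve is just a diameter
    along the first edge: the other edges stay at distance at least \<open>d0\<close>, and the first
    edge extends by half its length both ways.\<close>
  define d where "d = min d0 (norm (b - a) / 2)"
  have d: "d > 0" "d \<le> d0" "d \<le> norm (b - a) / 2" using d0(1) ab by (auto simp: d_def)
  \<comment> \<open>Tells the sides of the edge apart: positive to the left of the direction from
    \<open>a\<close> to \<open>b\<close>.\<close>
  define s where "s = (\<lambda>x. Im ((x - p) * cnj (b - a)))"
  have s_seg: "s x = 0" if x: "x \<in> closed_segment a b" for x
  proof -
    obtain u where "x = (1 - u) *\<^sub>R a + u *\<^sub>R b" using x by (auto simp: closed_segment_def)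
    then have xp: "x - p = (u - 1/2) *\<^sub>R (b - a)" by (simp add: p_eq complex_eq_iff field_simps)
    show ?thesis unfolding s_def xp by (simp add: algebra_simps)
  qed
  have seg_s: "x \<in> closed_segment a b" if "s x = 0" "dist p x < d" for x
  proof -
    define u where "u = Re ((x - p) * cnj (b - a)) / (norm (b - a))\<^sup>2"
    have "(x - p) * cnj (b - a) = of_real (u * (norm (b - a))\<^sup>2)"
      using that(1) ab by (simp add: u_def complex_eq_iff s_def)
    also have "\<dots> = (u *\<^sub>R (b - a)) * cnj (b - a)"
      using complex_norm_square[of "b - a"] by (simp add: scaleR_conv_of_real)
    finally have "(x - p) * cnj (b - a) = (u *\<^sub>R (b - a)) * cnj (b - a)" .
    moreover have "cnj (b - a) \<noteq> 0" using ab by simp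
    ultimately have xp: "x - p = u *\<^sub>R (b - a)" using mult_right_cancel by blast
    have "dist p x = norm (x - p)" by (simp add: dist_norm norm_minus_commute)
    also have "\<dots> = \<bar>u\<bar> * norm (b - a)" unfolding xp by simp
    finally have "\<bar>u\<bar> * norm (b - a) < norm (b - a) / 2"
      using that(2) d(3) by linarith
    then have "\<bar>u\<bar> * norm (b - a) < (1 / 2) * norm (b - a)" by simp
    then have "\<bar>u\<bar> < 1 / 2" using mult_less_cancel_right_pos[of "norm (b - a)"] ab by simp
    moreover have "x = (1 - (u + 1/2)) *\<^sub>R a + (u + 1/2) *\<^sub>R b"
    proof -
      have "x = p + u *\<^sub>R (b - a)" using xp by (simp add: algebra_simps)
      then show ?thesis by (simp add: p_eq complex_eq_iff field_simps)
    qed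
    ultimately show ?thesis unfolding closed_segment_def by (intro CollectI exI[of _ "u + 1/2"]) auto
  qed
  have half: "convex {x. dist p x < d \<and> s x > 0}" "convex {x. dist p x < d \<and> s x < 0}"
  proof -
    have s_in: "s x = (\<i> * (b - a)) \<bullet> x - (\<i> * (b - a)) \<bullet> p" for x
      by (simp add: s_def inner_complex_def algebra_simps)
    have "{x. dist p x < d \<and> s x > 0} = ball p d \<inter> {x. (\<i> * (b - a)) \<bullet> x > (\<i> * (b - a)) \<bullet> p}"
      "{x. dist p x < d \<and> s x < 0} = ball p d \<inter> {x. (\<i> * (b - a)) \<bullet> x < (\<i> * (b - a)) \<bullet> p}"
      by (auto simp: s_in)
    then show "convex {x. dist p x < d \<and> s x > 0}" "convex {x. dist p x < d \<and> s x < 0}"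
      by (simp_all add: convex_Int convex_halfspace_gt convex_halfspace_lt)
  qed
  have offK: "x \<notin> ?K" if "dist p x < d" "s x \<noteq> 0" for x
    using that cl(1) s_seg d0(2)[of x] d(2) by auto
  have sz: "s (z e) = e * (norm (b - a))\<^sup>2" for e
    unfolding cmod_power2 by (simp add: s_def z_def \<nu>_def power2_eq_square algebra_simps)
  have dz: "dist p (z e) = \<bar>e\<bar> * norm (b - a)" for e
    by (simp add: z_def \<nu>_def dist_norm norm_mult)
  have near: "\<forall>\<^sub>F e in at_right 0. 0 < e \<and> dist p (z e) < d"
    unfolding eventually_at_right_field dz
  proof (intro exI[of _ "d / norm (b - a)"] conjI allI impI)
    show "0 < d / norm (b - a)" using d ab by simp
  qed (use ab in \<open>auto simp: field_simps\<close>)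
  have up: "x \<in> inside ?K" if "dist p x < d" "s x > 0" for x
  proof -
    have "{x. dist p x < d \<and> s x > 0} \<inter> inside ?K \<noteq> {}"
    proof -
      obtain e where "z e \<in> inside ?K" "0 < e" "dist p (z e) < d"
        using eventually_happens'[OF trivial_limit_at_right_real eventually_conj[OF zleft near]] by blast
      then show ?thesis using sz[of e] ab by auto
    qed
    moreover have "{x. dist p x < d \<and> s x > 0} \<inter> ?K = {}" using offK by auto
    ultimately show ?thesis
      using connected_subset_inside[OF convex_connected[OF half(1)] _ _ clK] that by blast
  qed
  \<comment> \<open>Outside points accumulate at \<open>p\<close>, because it lies on the curve. In
    the small disk they can only be in the right half, and this half is connected and off the curve,
    so all of it is outside.\<close>
  have down: "x \<in> outside ?K" if "dist p x < d" "s x < 0" for x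
  proof (rule ccontr)
    assume "x \<notin> outside ?K"
    moreover have "x \<notin> ?K" using offK[of x] that by auto
    ultimately have "x \<in> inside ?K" using inside_Un_outside[of ?K] by blast
    moreover have "{x. dist p x < d \<and> s x < 0} \<inter> ?K = {}" using offK by auto
    ultimately have sub: "{x. dist p x < d \<and> s x < 0} \<subseteq> inside ?K"
      using connected_subset_inside[OF convex_connected[OF half(2)] _ _ clK] that by blast
    have "p \<in> closure (outside ?K)" using pK J(3) by (auto simp: frontier_def)
    then obtain y where y: "y \<in> outside ?K" "dist p y < d"
      using d(1) by (metis closure_approachable dist_commute)
    then have "y \<notin> inside ?K" "y \<notin> ?K"
      using inside_Int_outside[of ?K] outside_no_overlap[of ?K] by blast+
    then show False using up[OF y(2)] sub y(2) seg_s[of y] cl(1) by (cases "s y" "0::real" rule: linorder_cases) auto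
  qed
  have clim: "((\<lambda>e. Re (winding_number Q (p + of_real (k * e) * \<nu>))) \<longlongrightarrow> Re (winding_number Q p)) (at_right 0)" for k :: real
  proof -
    have cont: "isCont (winding_number Q) p"
      unfolding Q_def using pQ by (intro continuous_at_winding_number) (auto simp: Q_def)
    have "((\<lambda>e. p + of_real (k * e) * \<nu>) \<longlongrightarrow> p + of_real (k * 0) * \<nu>) (at_right 0)"
      by (intro tendsto_intros)
    then have "((\<lambda>e. p + of_real (k * e) * \<nu>) \<longlongrightarrow> p) (at_right 0)" by simp
    from isCont_tendsto_compose[OF cont this] have "((\<lambda>e. winding_number Q (p + of_real (k * e) * \<nu>)) \<longlongrightarrow> winding_number Q p) (at_right 0)"
      .
    then show ?thesis by (rule tendsto_Re)
  qed
  have ge: "0 \<le> Re (winding_number Q p)"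
  proof (rule tendsto_lowerbound[OF clim[of "-1"] _ trivial_limit_at_right_real])
    show "\<forall>\<^sub>F e in at_right 0. 0 \<le> Re (winding_number Q (p + of_real (- 1 * e) * \<nu>))"
      using near
    proof eventually_elim
      case (elim e)
      have "dist p (z (- e)) = dist p (z e)" by (simp only: dz abs_minus_cancel)
      then have "dist p (z (- e)) < d" using elim by linarith
      moreover have "s (z (- e)) < 0" using sz[of "- e"] elim ab by simp
      ultimately have out: "z (- e) \<in> outside ?K" by (rule down)
      then have "winding_number (closed_polygon cs) (z (- e)) = 0" "z (- e) \<notin> ?K"
        using winding_number_zero_in_outside[OF simple_path_imp_path[OF simple] closed_polygon_loop out]
          outside_no_overlap[of ?K] by (simp add: cs(1), blast)
      then have sum: "winding_number L (z (- e)) + winding_number Q (z (- e)) = 0" using wn by simp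
      have "Im ((a - b) * cnj (a - z (- e))) = e * (norm (b - a))\<^sup>2"
        unfolding cmod_power2 by (simp add: z_def \<nu>_def p_eq power2_eq_square field_simps)
      then have "Re (winding_number L (z (- e))) < 0"
        unfolding L_def using elim ab by (intro winding_number_linepath_neg_lt) simp
      then have "0 \<le> Re (winding_number Q (z (- e)))" using arg_cong[OF sum, of Re] by simp
      then show ?case by (simp add: z_def)
    qed
  qed
  have le: "Re (winding_number Q p) \<le> -1" if neg: "\<And>x. x \<in> inside ?K \<Longrightarrow> winding_number (closed_polygon cs) x = -1"
  proof (rule tendsto_upperbound[OF clim[of 1] _ trivial_limit_at_right_real])
    show "\<forall>\<^sub>F e in at_right 0. Re (winding_number Q (p + of_real (1 * e) * \<nu>)) \<le> -1"
      using near
    proof eventually_elim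
      case (elim e)
      have "z e \<in> inside ?K" using up[of "z e"] elim sz[of e] ab by simp
      then have "winding_number (closed_polygon cs) (z e) = -1" "z e \<notin> ?K"
        using neg inside_no_overlap[of ?K] by blast+
      then have sum: "winding_number L (z e) + winding_number Q (z e) = -1" using wn by simp
      have "Im ((b - a) * cnj (b - z e)) = e * (norm (b - a))\<^sup>2"
        unfolding cmod_power2 by (simp add: z_def \<nu>_def p_eq power2_eq_square field_simps)
      then have "Re (winding_number L (z e)) > 0"
        unfolding L_def using elim ab by (intro winding_number_linepath_pos_lt) simp
      then have "Re (winding_number Q (z e)) \<le> -1" using arg_cong[OF sum, of Re] by simp
      then show ?case by (simp add: z_def)
    qed
  qed
  have "\<And>x. x \<in> inside ?K \<Longrightarrow> winding_number (closed_polygon cs) x = 1"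
  proof (rule simple_closed_path_winding_number_inside[OF simple])
    assume "\<And>x. x \<in> inside ?K \<Longrightarrow> winding_number (closed_polygon cs) x = -1"
    from le[OF this] ge show "winding_number (closed_polygon cs) x = 1" if "x \<in> inside ?K" for x by linarith
  qed
  then show ?thesis using len dist simple by (simp add: pos_polygon_def)
qed

lemma edges_nth: "Suc k < length xs \<Longrightarrow> (xs ! k, xs ! Suc k) \<in> edges xs"
  unfolding edges_def by (force simp: in_set_conv_nth nth_tl intro: exI[of _ k])

theorem theorem1:
  fixes cs :: "complex list" and D :: "complex set"
  assumes "length cs \<ge> 3"
    and "distinct cs"
    and "simple_path (closed_polygon cs)"
    and "D = inside (path_image (closed_polygon cs))"
    and "lies_left_of_polygon D cs"
  shows "\<exists>t :: nat \<Rightarrow> real. t 0 = 0 \<and> t (length cs) = 2 * pi \<and>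
           (\<forall>k < length cs. t k < t (Suc k)) \<and>
           harmonic_on (ball 0 1) (poisson_integral (step_fun t cs)) \<and>
           inj_on (poisson_integral (step_fun t cs)) (ball 0 1) \<and>
           poisson_integral (step_fun t cs) ` ball 0 1 = D"
proof -
  have pos: "pos_polygon cs"
    using assms by (intro pos_polygon_if_lies_left) auto
  \<comment> \<open>The list is opened at its closing edge from \<open>b\<close> to
    \<open>a\<close>, which is the edge of the initial two-gon and the base edge of the
    filling.\<close>
  obtain a L b where cs: "cs = a # L @ [b]" "L \<noteq> []"
  proof -
    obtain a N where N: "cs = a # N" "length N \<ge> 2" using assms(1) by (cases cs) auto
    then have "N = butlast N @ [last N]" "butlast N \<noteq> []" by (cases N rule: rev_cases; auto)+
    then show ?thesis using N(1) by (intro that[of a "butlast N" "last N"]) auto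
  qed
  have ear: "ear_fill a L b" using pos cs by (auto intro: ear_fill_pos_polygon)
  have "a \<noteq> b" using assms(2) cs by auto
  then obtain ts where ts: "admissible (cs @ [hd cs]) ts" "last ts = 2 * pi"
    using admissible_ear_fill[OF ear] by (auto simp: cs)
  show ?thesis
    unfolding assms(4)
  proof (rule poisson_integral_step_fun_univalent[OF _ _ ts])
    show "cs \<noteq> []" "2 \<le> length cs" using assms(1) by auto
    show "simple_path (closed_polygon cs)" by (rule assms(3))
    show "pathfinish (closed_polygon cs) = pathstart (closed_polygon cs)"
      using assms(1) by (intro closed_polygon_loop) auto
    show "\<exists>(\<zeta>, d)\<in>set (jumps (cs @ [hd cs]) ts). cnj d \<noteq> c * d" for c
      using ts(1) cs by (intro ear_fill_not_parallel[OF ear]) (auto simp: admissible_def)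
    show "closed_segment (cs ! k) ((cs @ [hd cs]) ! Suc k) \<subseteq> path_image (closed_polygon cs)" if "k < length cs" for k
    proof -
      have "(cs ! k, (cs @ [hd cs]) ! Suc k) \<in> edges (cs @ [hd cs])"
        using edges_nth[of k "cs @ [hd cs]"] that by (simp add: nth_append)
      moreover have "path_image (closed_polygon cs) = (\<Union>(p, q)\<in>edges (cs @ [hd cs]). closed_segment p q)"
        unfolding closed_polygon_def using assms(1) by (intro path_image_polypath) simp
      ultimately show ?thesis by blast
    qed
  qed
qed

end
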